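(* Let $f\in C^1[0,\infty)$ be non-negative with $f(u)/u$ increasing on $(0,\infty)$, let $\rho>0$, $-\rho-2<\eta\le0$, $\tau>0$, and suppose that $$b(x)=k^2(d(x))\bigl(1+\widetilde c\,d(x)^\theta+o(d(x)^\theta)\bigr)\quad\text{as } d(x)\to0,$$ where $\theta>0$ and $\widetilde c\in\mathbf R$ are constants and $k\in\mathcal K_{(01],\tau}$. Assume one of the following conditions: (i) $f\in\mathcal F_{\rho\eta}$ with $\eta L_\sharp\ne0$; (ii) $f\in\mathcal F_{\rho0,\tau}$ with $[\ell^\star(\ell_1-1)]^2+L_\sharp^2\ne0$. Then, for any $a\in(-\infty,\lambda_{\infty,1})$, the two-term blow-up rate of the unique large solution $u_a$ of $\Delta u+au=b(x)f(u)$ in $\Omega$ is $$u_a(x)=\xi_0h(d(x))\left[1+\widetilde\chi\,(-\ln d(x))^{-\tau}+o\bigl((-\ln d(x))^{-\tau}\bigr)\right]\quad\text{as } d(x)\searrow0,$$ where $h$ is given by $$\int_{h(t)}^\infty\frac{ds}{\sqrt{2F(s)}}=\int_0^tk(s)\,ds\quad\text{for } t>0\text{ small},\qquad F(t)=\int_0^tf(s)\,ds,$$ $\xi_0=[(2+\ell_1\rho)/(2+\rho)]^{1/\rho}$, and $$\widetilde\chi=\begin{cases}\dfrac{L_\sharp}{2+\rho\ell_1}=:\chi_2 & \text{if (i) holds},\\[2mm] \chi_2-\dfrac{\ell^\star}{\rho}\left(\dfrac{\rho\ell_1}{2}\right)^\tau\left[\dfrac{2(1-\ell_1)}{(\rho+2)(\rho\ell_1+2)}+\ln\xi_0\right]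 & \text{if (ii) holds}.\end{cases}$$
   Context: Setting: $\Omega\subset\mathbf R^N$ ($N\ge 3$) is a smooth bounded domain, $d(x)=\mathrm{dist}(x,\partial\Omega)$, $a\in\mathbf R$ is a parameter, and $b\in C^{0,\mu}(\overline\Omega)$ (for some Hölder exponent $\mu\in(0,1)$) satisfies $b\ge 0$, $b\not\equiv 0$ in $\Omega$. Let $\Omega_0:=\mathrm{int}\{x\in\Omega: b(x)=0\}$. It is assumed that $\Omega_0$ is connected (possibly empty), $\overline{\Omega}_0\subset\Omega$, $b>0$ in $\Omega\setminus\overline\Omega_0$ (so $b\ge0$, possibly vanishing, on $\partial\Omega$), and $\partial\Omega_0$ satisfies an exterior cone condition. $\lambda_{\infty,1}$ denotes the first Dirichlet eigenvalue of $-\Delta$ in $H_0^1(\Omega_0)$, with $\lambda_{\infty,1}=\infty$ if $\Omega_0=\emptyset$. A large solution of $\Delta u+au=b(x)f(u)$ in $\Omega$ is any non-negative $C^2(\Omega)$-solution $u$ such that $u(x)\to\infty$ as $d(x)\to0$. (Under the hypotheses it exists and is unique for $a<\lambda_{\infty,1}$.) A positive measurable function $R$ defined on $[A,\infty)$ for some $A>0$ is regularly varying (at infinity) with index $q\in\mathbf R$, written $R\in RV_q$, if $\lim_{u\to\infty}R(\lambda u)/R(u)=\lambda^q$ for all $\lambda>0$. (For a function defined on a larger set, this refers to its restriction to some $[A,\infty)$.) Classes for $k$: $\mathcal K$ is the set of all positive, non-decreasing $k\in C^1(0,\nu)$ (for some $\nu>0$) such that $\lim_{t\searrow0}\frac{\int_0^tk(s)ds}{k(t)}$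 and $\ell_1:=\lim_{t\searrow0}\left(\frac{\int_0^tk(s)ds}{k(t)}\right)'$ exist (the first limit is then $0$ and $\ell_1\in[0,1]$). $\mathcal K_{(01]}=\{k\in\mathcal K: 0<\ell_1\le1\}$. For $\tau>0$, $$\mathcal K_{(01],\tau}=\left\{k\in\mathcal K_{(01]}:\ \lim_{t\searrow0}(-\ln t)^\tau\left[\left(\frac{\int_0^tk(s)\,ds}{k(t)}\right)'-\ell_1\right]=:L_\sharp\in\mathbf R\right\}.$$ Classes for $f$: the condition $f'\in RV_\rho$ ($\rho>0$) is equivalent to $f$ being of the form $$f(u)=Cu^{\rho+1}\exp\left\{\int_B^u\frac{\phi(t)}{t}\,dt\right\},\quad u\ge B,$$ for some constants $B,C>0$, with $\phi\in C[B,\infty)$, $\lim_{u\to\infty}\phi(u)=0$ (so $\phi(u)=uf'(u)/f(u)-\rho-1$). For $-\rho-2<\eta\le0$, $\mathcal F_{\rho\eta}$ is the set of $f$ with $f'\in RV_\rho$ such that either $\phi\in RV_\eta$ or $-\phi\in RV_\eta$. For $\tau>0$, $\mathcal F_{\rho0,\tau}$ is the set of $f\in\mathcal F_{\rho0}$ (i.e. $\eta=0$) such that $\lim_{u\to\infty}(\ln u)^\tau\phi(u)=:\ell^\star\in\mathbf R$. *)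

theory Defs
  imports "HOL-Analysis.Analysis" "HOL-Library.Landau_Symbols"
begin

section \<open>Smooth functions, domains and the exterior cone condition\<close>

definition partial_deriv :: "'a::euclidean_space \<Rightarrow> ('a \<Rightarrow> real) \<Rightarrow> 'a \<Rightarrow> real" where
  "partial_deriv i u x = frechet_derivative u (at x) i"

text \<open>Only used for open \<open>S\<close>, where \<open>differentiable_on\<close> is differentiability at each point.\<close>

primrec Ck_on :: "nat \<Rightarrow> 'a::euclidean_space set \<Rightarrow> ('a \<Rightarrow> real) \<Rightarrow> bool" where
  "Ck_on 0 S u \<longleftrightarrow> continuous_on S u"
| "Ck_on (Suc n) S u \<longleftrightarrow> u differentiable_on S \<and> (\<forall>i\<in>Basis. Ck_on n S (partial_deriv i u))"

definition smooth_on :: "'a::euclidean_space set \<Rightarrow> ('a \<Rightarrow> real) \<Rightarrow> bool" where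
  "smooth_on S u \<longleftrightarrow> (\<forall>n. Ck_on n S u)"

definition gradient :: "('a::euclidean_space \<Rightarrow> real) \<Rightarrow> 'a \<Rightarrow> 'a" where
  "gradient u x = (\<Sum>i\<in>Basis. partial_deriv i u x *\<^sub>R i)"

definition laplacian :: "('a::euclidean_space \<Rightarrow> real) \<Rightarrow> 'a \<Rightarrow> real" where
  "laplacian u x = (\<Sum>i\<in>Basis. partial_deriv i (partial_deriv i u) x)"

text \<open>Near each boundary point, after a rotation, the set is the epigraph of a smooth function:
  \<open>e\<close> is the vertical direction and \<open>\<gamma>\<close> is only evaluated on the hyperplane orthogonal
  to \<open>e\<close>.\<close>

definition smooth_boundary :: "'a::euclidean_space set \<Rightarrow> bool" where
  "smooth_boundary \<Omega> \<longleftrightarrow> (\<forall>p\<in>frontier \<Omega>. \<exists>r>0. \<exists>e \<gamma>. norm e = 1 \<and> smooth_on UNIV \<gamma> \<and>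
     \<Omega> \<inter> ball p r = {x \<in> ball p r. \<gamma> (x - (x \<bullet> e) *\<^sub>R e) < x \<bullet> e})"

definition smooth_bounded_domain :: "'a::euclidean_space set \<Rightarrow> bool" where
  "smooth_bounded_domain \<Omega> \<longleftrightarrow>
     open \<Omega> \<and> connected \<Omega> \<and> \<Omega> \<noteq> {} \<and> bounded \<Omega> \<and> smooth_boundary \<Omega>"

text \<open>The closed finite right circular cone with vertex \<open>p\<close>, axis \<open>e\<close> (a unit vector),
  half-angle \<open>arccos c\<close> and height \<open>r\<close>.\<close>

definition finite_cone :: "'a::euclidean_space \<Rightarrow> 'a \<Rightarrow> real \<Rightarrow> real \<Rightarrow> 'a set" where
  "finite_cone p e c r = {x. c * norm (x - p) \<le> (x - p) \<bullet> e \<and> (x - p) \<bullet> e \<le> r}"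

definition exterior_cone_condition :: "'a::euclidean_space set \<Rightarrow> bool" where
  "exterior_cone_condition U \<longleftrightarrow> (\<forall>p\<in>frontier U. \<exists>e c r. norm e = 1 \<and> 0 < c \<and> c < 1 \<and> 0 < r \<and>
     finite_cone p e c r \<inter> closure U = {p})"

definition holder_on :: "real \<Rightarrow> 'a::euclidean_space set \<Rightarrow> ('a \<Rightarrow> real) \<Rightarrow> bool" where
  "holder_on \<mu> S b \<longleftrightarrow> (\<exists>M. \<forall>x\<in>S. \<forall>y\<in>S. \<bar>b x - b y\<bar> \<le> M * norm (x - y) powr \<mu>)"

section \<open>The first Dirichlet eigenvalue\<close>

definition test_function :: "'a::euclidean_space set \<Rightarrow> ('a \<Rightarrow> real) \<Rightarrow> bool" where
  "test_function U \<phi> \<longleftrightarrow>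
     smooth_on UNIV \<phi> \<and> (\<exists>K. compact K \<and> K \<subseteq> U \<and> (\<forall>x. x \<notin> K \<longrightarrow> \<phi> x = 0))"

definition L2_tendsto ::
  "'a::euclidean_space set \<Rightarrow> (nat \<Rightarrow> 'a \<Rightarrow> 'b::euclidean_space) \<Rightarrow> ('a \<Rightarrow> 'b) \<Rightarrow> bool" where
  "L2_tendsto U v w \<longleftrightarrow>
     (\<lambda>n. \<integral>\<^sup>+x. ennreal ((norm (v n x - w x))\<^sup>2) \<partial>lebesgue_on U) \<longlonglongrightarrow> 0"

text \<open>The function \<open>u\<close> lies in the closure of the test functions in the Sobolev space
  \<open>H\<^sup>1(U)\<close>, and \<open>g\<close> is its weak gradient (the \<open>L\<^sup>2\<close>-limit of the gradients, hence unique
  up to null sets).\<close>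

definition H01_with_gradient ::
  "'a::euclidean_space set \<Rightarrow> ('a \<Rightarrow> real) \<Rightarrow> ('a \<Rightarrow> 'a) \<Rightarrow> bool" where
  "H01_with_gradient U u g \<longleftrightarrow>
     u \<in> borel_measurable (lebesgue_on U) \<and> g \<in> borel_measurable (lebesgue_on U) \<and>
     (\<exists>\<phi>. (\<forall>n. test_function U (\<phi> n)) \<and>
        L2_tendsto U \<phi> u \<and> L2_tendsto U (\<lambda>n. gradient (\<phi> n)) g)"

definition dirichlet_eigenvalue :: "'a::euclidean_space set \<Rightarrow> real \<Rightarrow> bool" where
  "dirichlet_eigenvalue U l \<longleftrightarrow>
     (\<exists>u g. H01_with_gradient U u g \<and> \<not> (AE x in lebesgue_on U. u x = 0) \<and>
        (\<forall>v h. H01_with_gradient U v h \<longrightarrow>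
           (\<integral>x. g x \<bullet> h x \<partial>lebesgue_on U) = l * (\<integral>x. u x * v x \<partial>lebesgue_on U)))"

definition first_dirichlet_eigenvalue :: "'a::euclidean_space set \<Rightarrow> ereal" where
  "first_dirichlet_eigenvalue U =
     (if U = {} then \<infinity> else Inf (ereal ` {l. dirichlet_eigenvalue U l}))"

section \<open>Large solutions\<close>

definition bdist :: "'a::euclidean_space set \<Rightarrow> 'a \<Rightarrow> real" where
  "bdist \<Omega> x = infdist x (frontier \<Omega>)"

text \<open>The filter of the limit process \<open>d(x) \<rightarrow> 0\<close>, \<open>x \<in> \<Omega>\<close>.\<close>

definition near_boundary :: "'a::euclidean_space set \<Rightarrow> 'a filter" where
  "near_boundary \<Omega> = inf (filtercomap (bdist \<Omega>) (at_right 0)) (principal \<Omega>)"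

definition large_solution ::
  "'a::euclidean_space set \<Rightarrow> real \<Rightarrow> ('a \<Rightarrow> real) \<Rightarrow> (real \<Rightarrow> real) \<Rightarrow> ('a \<Rightarrow> real) \<Rightarrow> bool" where
  "large_solution \<Omega> a b f u \<longleftrightarrow>
     Ck_on 2 \<Omega> u \<and> (\<forall>x\<in>\<Omega>. u x \<ge> 0) \<and>
     (\<forall>x\<in>\<Omega>. laplacian u x + a * u x = b x * f (u x)) \<and>
     filterlim u at_top (near_boundary \<Omega>)"

section \<open>Regular variation and the classes of nonlinearities\<close>

definition regularly_varying :: "real \<Rightarrow> (real \<Rightarrow> real) \<Rightarrow> bool" where
  "regularly_varying q R \<longleftrightarrow>
     (\<exists>A>0. (\<forall>u\<ge>A. R u > 0) \<and> R \<in> borel_measurable (lebesgue_on {A..})) \<and>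
     (\<forall>l>0. ((\<lambda>u. R (l * u) / R u) \<longlongrightarrow> l powr q) at_top)"

definition C1_on_nonneg :: "(real \<Rightarrow> real) \<Rightarrow> bool" where
  "C1_on_nonneg f \<longleftrightarrow>
     (\<exists>f'. (\<forall>u\<ge>0. (f has_real_derivative f' u) (at u within {0..})) \<and> continuous_on {0..} f')"

definition karamata_form :: "real \<Rightarrow> (real \<Rightarrow> real) \<Rightarrow> (real \<Rightarrow> real) \<Rightarrow> bool" where
  "karamata_form \<rho> f \<phi> \<longleftrightarrow>
     (\<exists>B>0. \<exists>C>0. continuous_on {B..} \<phi> \<and> (\<phi> \<longlongrightarrow> 0) at_top \<and>
        (\<forall>u\<ge>B. f u = C * u powr (\<rho> + 1) * exp (integral {B..u} (\<lambda>t. \<phi> t / t))))"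

text \<open>The function \<open>\<phi>\<close> is determined by \<open>f\<close> near infinity, namely
  \<open>\<phi> u = u * deriv f u / f u - \<rho> - 1\<close>.\<close>

definition class_F :: "real \<Rightarrow> real \<Rightarrow> (real \<Rightarrow> real) \<Rightarrow> bool" where
  "class_F \<rho> \<eta> f \<longleftrightarrow> regularly_varying \<rho> (deriv f) \<and>
     (\<exists>\<phi>. karamata_form \<rho> f \<phi> \<and>
        (regularly_varying \<eta> \<phi> \<or> regularly_varying \<eta> (\<lambda>u. - \<phi> u)))"

text \<open>The parameter \<open>l\<close> is the value of the limit \<open>\<ell>\<^sup>\<star>\<close>.\<close>

definition class_F0 :: "real \<Rightarrow> real \<Rightarrow> real \<Rightarrow> (real \<Rightarrow> real) \<Rightarrow> bool" where
  "class_F0 \<rho> \<tau> l f \<longleftrightarrow> class_F \<rho> 0 f \<and>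
     (\<exists>\<phi>. karamata_form \<rho> f \<phi> \<and> ((\<lambda>u. (ln u) powr \<tau> * \<phi> u) \<longlongrightarrow> l) at_top)"

section \<open>The classes of weights\<close>

definition primitive_ratio :: "(real \<Rightarrow> real) \<Rightarrow> real \<Rightarrow> real" where
  "primitive_ratio k t = integral {0..t} k / k t"

text \<open>The parameters \<open>l1\<close> and \<open>L\<close> are the values of the limits \<open>\<ell>\<^sub>1\<close> and
  \<open>L\<^sub>\<sharp>\<close>.\<close>

definition class_K :: "real \<Rightarrow> (real \<Rightarrow> real) \<Rightarrow> bool" where
  "class_K l1 k \<longleftrightarrow>
     (\<exists>\<nu>>0. (\<forall>t\<in>{0<..<\<nu>}. k t > 0) \<and> mono_on {0<..<\<nu>} k \<and> k C1_differentiable_on {0<..<\<nu>}) \<and>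
     (\<exists>l0. (primitive_ratio k \<longlongrightarrow> l0) (at_right 0)) \<and>
     (deriv (primitive_ratio k) \<longlongrightarrow> l1) (at_right 0)"

definition class_K01 :: "real \<Rightarrow> real \<Rightarrow> real \<Rightarrow> (real \<Rightarrow> real) \<Rightarrow> bool" where
  "class_K01 \<tau> l1 L k \<longleftrightarrow> class_K l1 k \<and> 0 < l1 \<and> l1 \<le> 1 \<and>
     ((\<lambda>t. (- ln t) powr \<tau> * (deriv (primitive_ratio k) t - l1)) \<longlongrightarrow> L) (at_right 0)"

text \<open>The defining equation of \<open>h\<close>, with \<open>F t = integral {0..t} f\<close>; \<open>has_integral\<close>
  includes convergence of the improper integral.\<close>

definition blowup_profile :: "(real \<Rightarrow> real) \<Rightarrow> (real \<Rightarrow> real) \<Rightarrow> (real \<Rightarrow> real) \<Rightarrow> bool" where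
  "blowup_profile f k h \<longleftrightarrow>
     (\<forall>\<^sub>F t in at_right 0. h t > 0 \<and>
        ((\<lambda>s. 1 / sqrt (2 * integral {0..s} f)) has_integral integral {0..t} k) {h t..})"

end

theory Submission
  imports Defs "HOL-Real_Asymp.Real_Asymp"
begin

text \<open>
  Write \<open>s t = (- ln t) powr (- \<tau>)\<close> and consider the one-parameter family of profiles
  \<open>W q t = \<xi>\<^sub>0 * h t * (1 + q * s t)\<close>.  Differentiating the definition of \<open>h\<close> twice gives
  \<open>h' = - k * sqrt (2 F(h))\<close> and \<open>h'' = k\<^sup>2 f(h) (1 - (K k' / k\<^sup>2) Q(h))\<close>, where \<open>K\<close> and \<open>F\<close> are the
  primitives of \<open>k\<close> and \<open>f\<close>, and \<open>Q u = sqrt (2 F u) / (f u * I u)\<close> with \<open>I u\<close> the tail integral of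
  \<open>1 / sqrt (2 F)\<close>.  The class of \<open>k\<close> expands \<open>K k' / k\<^sup>2 = 1 - (K / k)'\<close> up to \<open>o(s)\<close>.  The class of \<open>f\<close>
  expands \<open>Q\<close> and \<open>f (\<xi> u) / f u\<close> up to \<open>o((ln u) powr (- \<tau>))\<close>, and these errors become \<open>o(s)\<close> at
  \<open>u = h t\<close> because \<open>ln (h t)\<close> is asymptotic to \<open>2 / (\<rho> l\<^sub>1) * (- ln t)\<close>.  Collecting the terms, with
  \<open>A = \<xi>\<^sub>0 powr \<rho>\<close>,
  the defect \<open>W'' - k\<^sup>2 f(W)\<close> divided by \<open>\<xi>\<^sub>0 k\<^sup>2 f(h)\<close> equals \<open>\<rho> A (chi - q) s + o(s)\<close>
  (lemma \<open>ansatz_defect_rate\<close>; the choice of \<open>\<xi>\<^sub>0\<close> makes the term of order one vanish).  First and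
  zeroth order terms and factors \<open>1 + O(t powr \<theta>)\<close> do not affect this, since they are of relative
  size \<open>O(t)\<close>, \<open>O(t\<^sup>2)\<close> and \<open>O(t powr \<theta>)\<close>.  So \<open>W q\<close> is a supersolution of the ordinary differential
  inequality near \<open>0\<close> if \<open>q > chi\<close>, and a subsolution if \<open>q < chi\<close>.

  The passage to \<open>\<Omega>\<close> avoids differentiating the distance \<open>d\<close> to the boundary.  Smoothness of
  the boundary provides inner and outer tangent balls of a uniform radius
  (\<open>uniform_touching_balls\<close>), so at each point near the boundary \<open>d\<close> lies between two functions
  of the form \<open>R - |x - z|\<close> and \<open>|x - z'| - R\<close> that agree with it there.  A comparison argument only
  looks at the Laplacian at one maximum point, and there the composition of a decreasing profile with
  \<open>d\<close> may be replaced by the composition with one of these radial functions.  Maximising the quotients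
  \<open>u / (G(d) + M)\<close> and \<open>G(d) / (u + M)\<close>, instead of differences, lets the monotonicity of \<open>f(s)/s\<close>
  absorb the linear term \<open>a u\<close> (\<open>upper_comparison\<close>, \<open>lower_comparison\<close>).  Applying this to the shifted
  profiles \<open>m(z) * W q (d - z)\<close> with \<open>m(z) \<longlongrightarrow> 1\<close>, and to \<open>W q (d + z)\<close>, and letting \<open>z\<close> tend to \<open>0\<close> yields
  \<open>W q (d) - M \<le> u\<close> for \<open>q < chi\<close> and \<open>u \<le> W q (d) + M\<close> for \<open>q > chi\<close>.  The constants \<open>M\<close> are
  negligible because \<open>h * s\<close> tends to infinity, and \<open>q\<close> is arbitrarily close to \<open>chi\<close>.
\<close>

section \<open>Limits with a prescribed rate and the nonlinearity\<close>

text \<open>The \<open>0/0\<close> form of l'Hopital's rule at infinity, by the substitution \<open>x \<mapsto> 1 / x\<close>.\<close>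
lemma lhopital_at_top_0:
  fixes f g :: "real \<Rightarrow> real"
  assumes "(f \<longlongrightarrow> 0) at_top" "(g \<longlongrightarrow> 0) at_top"
    and "\<forall>\<^sub>F x in at_top. g x \<noteq> 0" "\<forall>\<^sub>F x in at_top. g' x \<noteq> 0"
    and "\<forall>\<^sub>F x in at_top. (f has_real_derivative f' x) (at x)"
    and "\<forall>\<^sub>F x in at_top. (g has_real_derivative g' x) (at x)"
    and "((\<lambda>x. f' x / g' x) \<longlongrightarrow> l) at_top"
  shows "((\<lambda>x. f x / g x) \<longlongrightarrow> l) at_top"
  unfolding filterlim_at_top_to_right
proof (rule lhopital_right_0)
  let ?D = "\<lambda>d x. d (inverse x) * - (inverse x ^ Suc (Suc 0)) :: real"
  show "((\<lambda>x. f (inverse x)) \<longlongrightarrow> 0) (at_right 0)" "((\<lambda>x. g (inverse x)) \<longlongrightarrow> 0) (at_right 0)"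
    using assms(1,2) unfolding filterlim_at_top_to_right by auto
  show "\<forall>\<^sub>F x in at_right 0. g (inverse x) \<noteq> 0"
    using assms(3) unfolding eventually_at_top_to_right by auto
  show "\<forall>\<^sub>F x in at_right 0. ?D g' x \<noteq> 0"
    using assms(4) unfolding eventually_at_top_to_right
    by (rule eventually_elim2[OF _ eventually_at_right_less]) auto
  have D: "\<forall>\<^sub>F x in at_right 0. ((\<lambda>x. h (inverse x)) has_real_derivative ?D h' x) (at x)"
    if "\<forall>\<^sub>F x in at_top. (h has_real_derivative h' x) (at x)" for h h' :: "real \<Rightarrow> real"
    using that unfolding eventually_at_top_to_right
    by (rule eventually_elim2[OF _ eventually_at_right_less])
      (rule derivative_eq_intros DERIV_chain'[where f=inverse] | simp)+
  show "\<forall>\<^sub>F x in at_right 0. ((\<lambda>x. f (inverse x)) has_real_derivative ?D f' x) (at x)"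
    "\<forall>\<^sub>F x in at_right 0. ((\<lambda>x. g (inverse x)) has_real_derivative ?D g' x) (at x)"
    using D assms by auto
  show "((\<lambda>x. ?D f' x / ?D g' x) \<longlongrightarrow> l) (at_right 0)"
    using assms(7) unfolding filterlim_at_top_to_right
    by (rule Lim_transform_eventually) (rule eventually_mono[OF eventually_at_right_less], auto)
qed

text \<open>All expansions below are stated as limits of \<open>g x * (y x - c)\<close> with \<open>g\<close> tending to infinity;
  this is \<open>y = c + l / g + o(1 / g)\<close> in a form that the limit calculus handles.\<close>
lemma tendsto_0_if_rate:
  fixes g y :: "'b \<Rightarrow> real"
  assumes "filterlim g at_top G" "((\<lambda>x. g x * y x) \<longlongrightarrow> l) G"
  shows "(y \<longlongrightarrow> 0) G"
proof -
  have "((\<lambda>x. inverse (g x) * (g x * y x)) \<longlongrightarrow> 0 * l) G"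
    by (intro tendsto_mult assms tendsto_inverse_0_at_top)
  moreover have "\<forall>\<^sub>F x in G. inverse (g x) * (g x * y x) = y x"
    using filterlim_at_top_dense[THEN iffD1, OF assms(1), rule_format, of 0]
    by eventually_elim (auto simp: field_simps)
  ultimately show ?thesis
    by (auto elim: Lim_transform_eventually)
qed

lemma tendsto_if_rate:
  fixes g y :: "'b \<Rightarrow> real"
  assumes "filterlim g at_top G" "((\<lambda>x. g x * (y x - c)) \<longlongrightarrow> l) G"
  shows "(y \<longlongrightarrow> c) G"
  using tendsto_0_if_rate[OF assms] by (simp add: LIM_zero_iff)

lemma filterlim_ln_powr_at_top: "\<tau> > 0 \<Longrightarrow> filterlim (\<lambda>u::real. ln u powr \<tau>) at_top at_top"
  by real_asymp

lemma ln_powr_minus_0: "\<tau> > 0 \<Longrightarrow> ((\<lambda>u::real. ln u powr (- \<tau>)) \<longlongrightarrow> 0) at_top"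
  by real_asymp

lemma square_times_ln_powr_at_top: "filterlim (\<lambda>u::real. u^2 * ln u powr p) at_top at_top"
  by real_asymp

lemma inverse_ln_0: "((\<lambda>u::real. 1 / ln u) \<longlongrightarrow> 0) at_top"
  by real_asymp

lemma powr_times_const_at_top:
  "U > 0 \<Longrightarrow> p > 0 \<Longrightarrow> c > 0 \<Longrightarrow> filterlim (\<lambda>u::real. (u / U) powr p * c) at_top at_top"
  by real_asymp

text \<open>The two cases of the theorem share this setting: \<open>f\<close> has the Karamata form near infinity,
  encoded by its logarithmic derivative, and \<open>\<phi>\<close> has a logarithmic rate \<open>lstar\<close>.  For
  \<open>\<phi>\<close> regularly varying of negative index, \<open>lstar = 0\<close>.\<close>
locale nonlinearity =
  fixes f \<phi> :: "real \<Rightarrow> real" and \<rho> \<tau> lstar B :: real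
  assumes f_cont: "continuous_on {0..} f"
    and f_nonneg: "\<And>s. s \<ge> 0 \<Longrightarrow> f s \<ge> 0"
    and f_quot_mono: "strict_mono_on {0<..} (\<lambda>s. f s / s)"
    and \<rho>_pos: "\<rho> > 0" and \<tau>_pos: "\<tau> > 0" and B_pos: "B > 0"
    and f_deriv: "\<And>u. u > B \<Longrightarrow> (f has_real_derivative f u * (\<rho> + 1 + \<phi> u) / u) (at u)"
    and \<phi>_rate: "((\<lambda>u. ln u powr \<tau> * \<phi> u) \<longlongrightarrow> lstar) at_top"
begin

definition F where "F u = integral {0..u} f"

lemma \<phi>_0: "(\<phi> \<longlongrightarrow> 0) at_top"
  by (rule tendsto_0_if_rate[OF filterlim_ln_powr_at_top[OF \<tau>_pos] \<phi>_rate])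

lemma f_quot_less: "0 < s \<Longrightarrow> s < t \<Longrightarrow> f s / s < f t / t"
  using f_quot_mono by (auto simp: strict_mono_on_def)

lemma f_pos: "s > 0 \<Longrightarrow> f s > 0"
proof -
  assume s: "s > 0"
  have "0 \<le> f (s/2) / (s/2)" using f_nonneg[of "s/2"] s by auto
  also have "\<dots> < f s / s" using s by (intro f_quot_less) auto
  finally show ?thesis using s by (simp add: zero_less_divide_iff)
qed

lemma f_0: "f 0 = 0"
proof -
  have "(f \<longlongrightarrow> f 0) (at 0 within {0..})"
    using f_cont by (auto simp: continuous_on_def)
  then have 1: "(f \<longlongrightarrow> f 0) (at_right 0)"
    by (rule tendsto_mono[OF at_le, rotated]) auto
  have "((\<lambda>s. s * f 1) \<longlongrightarrow> 0 * f 1) (at_right 0)"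
    by (intro tendsto_intros)
  then have "((\<lambda>s. s * f 1) \<longlongrightarrow> 0) (at_right 0)" by simp
  then have "(f \<longlongrightarrow> 0) (at_right 0)"
  proof (rule tendsto_sandwich[rotated 2, OF tendsto_const])
    show "\<forall>\<^sub>F s in at_right 0. 0 \<le> f s"
      using eventually_at_right_less[of 0] by eventually_elim (auto intro: f_nonneg)
    show "\<forall>\<^sub>F s in at_right 0. f s \<le> s * f 1"
      using eventually_at_right_real[of 0 1, simplified]
      by eventually_elim (use f_quot_less[of _ 1] in \<open>auto simp: field_simps intro: less_imp_le\<close>)
  qed
  with 1 show ?thesis
    by (metis tendsto_unique trivial_limit_at_right_real)
qed

text \<open>The form in which monotonicity of \<open>f s / s\<close> contradicts a quotient of sub- and supersolution
  exceeding \<open>1\<close>; it includes \<open>s = 0\<close>, where the quotient \<open>f s / s\<close> is meaningless.\<close>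
lemma f_superlinear: "m > 1 \<Longrightarrow> s \<ge> 0 \<Longrightarrow> t > m * s \<Longrightarrow> m * f s < f t"
proof (cases "s = 0")
  case True
  assume "m > 1" "s \<ge> 0" "t > m * s" with True show ?thesis using f_pos[of t] f_0 by simp
next
  case False
  assume *: "m > 1" "s \<ge> 0" "t > m * s"
  with False have s: "s > 0" by auto
  then have st: "s < t" using * by (smt (verit) mult_less_cancel_right2)
  have "f s / s < f t / t" using f_quot_less[OF s st] .
  then have "f s * t < f t * s" using s st by (simp add: field_simps)
  moreover have "m * s * f s < t * f s" using f_pos[OF s] * by simp
  ultimately have "s * (m * f s) < s * f t" by (simp add: algebra_simps)
  then show ?thesis using s by simp
qed

lemma F_deriv: "u > 0 \<Longrightarrow> (F has_real_derivative f u) (at u)"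
proof -
  assume u: "u > 0"
  have "((\<lambda>u. integral {0..u} f) has_real_derivative f u) (at u within {0..u+1})"
    using u by (intro integral_has_real_derivative continuous_on_subset[OF f_cont]) auto
  moreover have "at u within {0..u+1} = at u"
    using u by (intro at_within_interior) (auto simp: interior_atLeastAtMost_real)
  ultimately show ?thesis unfolding F_def[abs_def] by simp
qed

lemma F_pos: "u > 0 \<Longrightarrow> F u > 0"
proof -
  assume u: "u > 0"
  have "f integrable_on {0..u}"
    by (intro integrable_continuous_real continuous_on_subset[OF f_cont]) auto
  moreover have "f integrable_on {u/2..u}" using u
    by (intro integrable_continuous_real continuous_on_subset[OF f_cont]) auto
  ultimately have "integral {u/2..u} f \<le> F u"
    unfolding F_def using u f_nonneg by (intro integral_subset_le) auto
  moreover have "integral {u/2..u} (\<lambda>_. 0) < integral {u/2..u} f"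
    using u f_pos continuous_on_subset[OF f_cont] by (intro integral_less_real) auto
  ultimately show ?thesis by simp
qed

text \<open>The mean value theorem for \<open>y \<mapsto> ln (f (exp y))\<close>, whose derivative is \<open>\<rho> + 1 + \<phi> (exp y)\<close>.
  It replaces the integral representation of regularly varying functions wherever \<open>f\<close> is compared
  at two proportional arguments.\<close>
lemma f_ratio_mvt:
  assumes "u > B" "v > B"
  obtains w where "min u v \<le> w" "w \<le> max u v" "f v / f u = exp ((\<rho> + 1 + \<phi> w) * ln (v / u))"
proof -
  have *: "\<exists>w. u \<le> w \<and> w \<le> v \<and> ln (f v) - ln (f u) = (\<rho> + 1 + \<phi> w) * (ln v - ln u)"
    if "B < u" "u < v" for u v
  proof -
    let ?g = "\<lambda>y. ln (f (exp y))"
    have u: "u > 0" "v > 0" using that B_pos by auto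
    have "\<exists>z>ln u. z < ln v \<and> ?g (ln v) - ?g (ln u) = (ln v - ln u) * (\<rho> + 1 + \<phi> (exp z))"
    proof (rule MVT2)
      show "ln u < ln v" using u that by simp
      fix y assume y: "ln u \<le> y" "y \<le> ln v"
      have e: "exp y > B" using u y that(1) by (metis exp_le_cancel_iff exp_ln less_le_trans)
      have fp: "f (exp y) > 0" by (intro f_pos) simp
      show "(?g has_real_derivative \<rho> + 1 + \<phi> (exp y)) (at y)"
        using fp DERIV_chain2[where f=f and g=exp, OF f_deriv[OF e] DERIV_exp]
          by (auto intro!: derivative_eq_intros)
    qed
    then obtain z where z: "z > ln u" "z < ln v"
      "?g (ln v) - ?g (ln u) = (ln v - ln u) * (\<rho> + 1 + \<phi> (exp z))" by blast
    have "exp (ln u) \<le> exp z" "exp z \<le> exp (ln v)" using z(1,2) by simp_all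
    then have "u \<le> exp z" "exp z \<le> v" using u by simp_all
    moreover have "ln (f v) - ln (f u) = (\<rho> + 1 + \<phi> (exp z)) * (ln v - ln u)"
      using z(3) u by (simp add: mult.commute)
    ultimately show ?thesis by (intro exI[of _ "exp z"] conjI)
  qed
  have **: "f v / f u = exp ((\<rho> + 1 + \<phi> w) * ln (v / u))"
    if "ln (f v) - ln (f u) = (\<rho> + 1 + \<phi> w) * (ln v - ln u)" for w
  proof -
    have "u > 0" "v > 0" "f u > 0" "f v > 0" using assms B_pos by (auto intro!: f_pos)
    then have "exp ((\<rho> + 1 + \<phi> w) * ln (v / u)) = exp (ln (f v) - ln (f u))"
      using \<open>u > 0\<close> \<open>v > 0\<close> by (simp only: that ln_divide_pos)
    also have "\<dots> = f v / f u" using \<open>f u > 0\<close> \<open>f v > 0\<close> by (simp only: exp_diff exp_ln)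
    finally show ?thesis by simp
  qed
  consider "u < v" | "v < u" | "u = v" by linarith
  then show ?thesis
  proof cases
    case 1
    from *[OF assms(1) 1] obtain w where w: "u \<le> w" "w \<le> v"
      "ln (f v) - ln (f u) = (\<rho> + 1 + \<phi> w) * (ln v - ln u)" by blast
    show ?thesis by (rule that[OF _ _ **[OF w(3)]]) (use w in auto)
  next
    case 2
    from *[OF assms(2) 2] obtain w where "v \<le> w" "w \<le> u" 
      "ln (f u) - ln (f v) = (\<rho> + 1 + \<phi> w) * (ln u - ln v)" by blast
    then have "ln (f v) - ln (f u) = (\<rho> + 1 + \<phi> w) * (ln v - ln u)" by (simp add: algebra_simps)
    from **[OF this] show ?thesis by (rule that[rotated 2]) (use \<open>v \<le> w\<close> \<open>w \<le> u\<close> in auto)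
  next
    case 3
    then have "f v / f u = exp ((\<rho> + 1 + \<phi> u) * ln (v / u))"
      using f_pos[of u] assms B_pos by simp
    then show ?thesis by (rule that[rotated 2]) (use 3 in auto)
  qed
qed

text \<open>Any exponent strictly between \<open>1\<close> and \<open>\<rho> + 1\<close> would do.  That it exceeds \<open>1\<close> leaves room to absorb
  an error in the weight by enlarging a supersolution by a factor \<open>m\<close>.\<close>
lemma f_power_growth:
  "\<exists>U>0. \<forall>u\<ge>U. \<forall>m\<ge>1. m powr (1 + \<rho> / 2) * f u \<le> f (m * u)"
proof -
  have "\<forall>\<^sub>F u in at_top. \<phi> u > - \<rho> / 2"
    using \<phi>_0 \<rho>_pos by (intro order_tendstoD) auto
  then obtain U0 where U0: "\<And>u. u \<ge> U0 \<Longrightarrow> \<phi> u > - \<rho> / 2"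
    by (auto simp: eventually_at_top_linorder)
  define U where "U = max U0 (B + 1)"
  have "m powr (1 + \<rho> / 2) * f u \<le> f (m * u)" if u: "u \<ge> U" and m: "m \<ge> 1" for u m
  proof -
    have uB: "u > B" "u > 0" using u B_pos by (auto simp: U_def)
    have mu1: "m * u \<ge> u" using m mult_right_mono[of 1 m u] uB by auto
    then have mu: "m * u > B" "m * u \<ge> u" using uB by linarith+
    obtain w where w: "min u (m*u) \<le> w" "f (m*u) / f u = exp ((\<rho> + 1 + \<phi> w) * ln (m*u / u))"
      using f_ratio_mvt[OF uB(1) mu(1)] by metis
    have "w \<ge> U0" using w(1) u mu by (auto simp: U_def)
    then have "(1 + \<rho> / 2) * ln m \<le> (\<rho> + 1 + \<phi> w) * ln m"
      using U0[of w] m by (intro mult_right_mono) auto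
    then have "m powr (1 + \<rho> / 2) \<le> f (m*u) / f u"
      using w(2) uB m by (simp add: powr_def)
    then show ?thesis using f_pos[OF uB(2)] by (simp add: field_simps)
  qed
  moreover have "U > 0" using B_pos by (auto simp: U_def)
  ultimately show ?thesis by blast
qed

lemma f_quot_at_top: "filterlim (\<lambda>u. f u / u) at_top at_top"
proof -
  obtain U where U: "U > 0" "\<And>u m. u \<ge> U \<Longrightarrow> m \<ge> 1 \<Longrightarrow> m powr (1 + \<rho> / 2) * f u \<le> f (m * u)"
    using f_power_growth by blast
  have c: "f U / U > 0" using f_pos U by simp
  have "filterlim (\<lambda>u. (u / U) powr (\<rho> / 2) * (f U / U)) at_top at_top"
    by (rule powr_times_const_at_top) (use c \<open>U > 0\<close> \<rho>_pos in auto)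
  then show ?thesis
  proof (rule filterlim_at_top_mono)
    show "\<forall>\<^sub>F u in at_top. (u / U) powr (\<rho> / 2) * (f U / U) \<le> f u / u"
      using eventually_ge_at_top[of U]
    proof eventually_elim
      case (elim u)
      have "(u / U) powr (1 + \<rho> / 2) * f U \<le> f u"
        using U(2)[of U "u/U"] elim U(1) by simp
      then have "(u / U) powr (1 + \<rho> / 2) * f U / u \<le> f u / u"
        using elim U(1) by (intro divide_right_mono) auto
      moreover have "(u / U) powr (1 + \<rho> / 2) = (u / U) * (u / U) powr (\<rho> / 2)"
        using elim U(1) by (subst powr_add) auto
      ultimately show ?case using elim U(1) by simp
    qed
  qed
qed

lemma F_at_top: "filterlim F at_top at_top"
proof -
  have "\<forall>\<^sub>F u in at_top. f u / u \<ge> 1"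
    using f_quot_at_top by (auto simp: filterlim_at_top)
  then obtain U0 where U0: "\<And>u. u \<ge> U0 \<Longrightarrow> f u / u \<ge> 1" by (auto simp: eventually_at_top_linorder)
  define U where "U = max U0 1"
  have "filterlim (\<lambda>u. u - U) at_top at_top" by real_asymp
  then show ?thesis
  proof (rule filterlim_at_top_mono)
    show "\<forall>\<^sub>F u in at_top. u - U \<le> F u" using eventually_gt_at_top[of U]
    proof eventually_elim
      case (elim u)
      have "\<exists>z>U. z < u \<and> F u - F U = (u - U) * f z"
        using elim by (intro MVT2 F_deriv) (auto simp: U_def)
      then obtain z where z: "z > U" "F u - F U = (u - U) * f z" by blast
      have "z > 1" using z by (auto simp: U_def)
      moreover have "f z / z \<ge> 1" using U0[of z] z by (auto simp: U_def)
      ultimately have "f z \<ge> 1" by (simp add: field_simps)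
      then have "(u - U) * 1 \<le> F u - F U" unfolding z(2) using elim by (intro mult_left_mono) auto
      moreover have "F U > 0" by (rule F_pos) (simp add: U_def)
      ultimately show ?case by simp
    qed
  qed
qed

text \<open>The elasticity of the primitive \<open>F\<close>.  By l'Hopital it differs from \<open>\<rho> + 2\<close> like the function
  \<open>\<phi>\<close>, since \<open>(u f - (\<rho> + 2) F)' = f \<phi>\<close>.\<close>
definition elasticity where "elasticity u = u * f u / F u"
lemma elasticity_lim: "(elasticity \<longlongrightarrow> \<rho> + 2) at_top"
  unfolding elasticity_def[abs_def]
proof (rule lhospital_at_top_at_top[OF F_at_top])
  show "\<forall>\<^sub>F x in at_top. f x \<noteq> 0"
    using eventually_gt_at_top[of 0] by eventually_elim (rule less_imp_neq[symmetric, OF f_pos])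
  show "\<forall>\<^sub>F x in at_top. (F has_real_derivative f x) (at x)"
    using eventually_gt_at_top[of 0] by eventually_elim (use F_deriv in auto)
  show "\<forall>\<^sub>F x in at_top. ((\<lambda>u. u * f u) has_real_derivative f x * (\<rho> + 2 + \<phi> x)) (at x)"
    using eventually_gt_at_top[of B]
  proof eventually_elim
    case (elim x) then show ?case using B_pos 
      by (auto intro!: derivative_eq_intros f_deriv simp: field_simps)
  qed
  have "((\<lambda>x. \<rho> + 2 + \<phi> x) \<longlongrightarrow> \<rho> + 2 + 0) at_top"
    by (intro tendsto_intros \<phi>_0)
  then have "((\<lambda>x. \<rho> + 2 + \<phi> x) \<longlongrightarrow> \<rho> + 2) at_top" by simp
  then show "((\<lambda>x. f x * (\<rho> + 2 + \<phi> x) / f x) \<longlongrightarrow> \<rho> + 2) at_top"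
    by (rule Lim_transform_eventually)
      (use eventually_gt_at_top[of 0] in eventually_elim, rule nonzero_mult_div_cancel_left[symmetric], rule less_imp_neq[symmetric, OF f_pos])
qed

lemma inverse_elasticity_lim: "((\<lambda>u. F u / (u * f u)) \<longlongrightarrow> 1 / (\<rho> + 2)) at_top"
proof -
  have "((\<lambda>u. 1 / elasticity u) \<longlongrightarrow> 1 / (\<rho> + 2)) at_top"
    using \<rho>_pos by (intro tendsto_intros elasticity_lim) auto
  then show ?thesis by (simp add: elasticity_def)
qed

lemma elasticity_rate: "((\<lambda>u. ln u powr \<tau> * (elasticity u - (\<rho> + 2))) \<longlongrightarrow> lstar) at_top"
proof -
  let ?N = "\<lambda>u. u * f u - (\<rho> + 2) * F u"
  let ?G = "\<lambda>u. F u * ln u powr (- \<tau>)"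
  let ?G' = "\<lambda>u. f u * ln u powr (- \<tau>) * (1 - \<tau> * (F u / (u * f u)) * (1 / ln u))"
  have d: "((\<lambda>u. 1 - \<tau> * (F u / (u * f u)) * (1 / ln u)) \<longlongrightarrow> 1 - \<tau> * (1 / (\<rho> + 2)) * 0) at_top"
    by (intro tendsto_intros inverse_elasticity_lim inverse_ln_0)
  then have d1: "((\<lambda>u. 1 - \<tau> * (F u / (u * f u)) * (1 / ln u)) \<longlongrightarrow> 1) at_top" by simp
  have dpos: "\<forall>\<^sub>F u in at_top. 1 - \<tau> * (F u / (u * f u)) * (1 / ln u) > 0"
    using d1 by (rule order_tendstoD) simp
  have "((\<lambda>u. ?N u / ?G u) \<longlongrightarrow> lstar) at_top"
  proof (rule lhospital_at_top_at_top)
    have "((\<lambda>u. F u / (u * f u)) \<longlongrightarrow> 1 / (\<rho> + 2)) at_top" by (rule inverse_elasticity_lim)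
    then have "filterlim (\<lambda>u. F u / (u * f u) * (f u / u * (u^2 * ln u powr (- \<tau>)))) at_top at_top"
    proof (rule filterlim_tendsto_pos_mult_at_top)
      show "0 < 1 / (\<rho> + 2)" using \<rho>_pos by simp
      show "filterlim (\<lambda>u. f u / u * (u^2 * ln u powr (- \<tau>))) at_top at_top"
        by (rule filterlim_at_top_mult_at_top[OF f_quot_at_top square_times_ln_powr_at_top])
    qed
    then show "filterlim ?G at_top at_top"
    proof (rule filterlim_cong[THEN iffD1, OF refl refl, rotated])
      show "\<forall>\<^sub>F u in at_top. F u / (u * f u) * (f u / u * (u^2 * ln u powr (- \<tau>))) = ?G u"
        using eventually_gt_at_top[of 0]
      proof eventually_elim
        case (elim u)
        have "f u > 0" using elim f_pos by auto
        then show ?case using elim by (simp add: power2_eq_square)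
      qed
    qed
    show "\<forall>\<^sub>F u in at_top. ?G' u \<noteq> 0"
      using eventually_gt_at_top[of 1] dpos
    proof eventually_elim
      case (elim u) 
      have "f u > 0" using elim f_pos by auto
      then have "?G' u > 0" using elim by (intro mult_pos_pos) auto
      then show ?case by (rule less_imp_neq[symmetric])
    qed
    show "\<forall>\<^sub>F u in at_top. (?N has_real_derivative f u * \<phi> u) (at u)"
      using eventually_gt_at_top[of B]
    proof eventually_elim
      case (elim x) then show ?case using B_pos 
        by (auto intro!: derivative_eq_intros f_deriv F_deriv simp: field_simps)
    qed
    show "\<forall>\<^sub>F u in at_top. (?G has_real_derivative ?G' u) (at u)"
      using eventually_gt_at_top[of 1]
    proof eventually_elim
      case (elim x) 
      have p: "ln x powr (- \<tau> - 1) = ln x powr (- \<tau>) / ln x" using elim by (simp add: powr_diff)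
      have "f x > 0" using elim f_pos by auto
      with elim show ?case 
        by (auto intro!: derivative_eq_intros F_deriv simp: p) (simp add: field_simps)
    qed
    have "((\<lambda>u. (ln u powr \<tau> * \<phi> u) / (1 - \<tau> * (F u / (u * f u)) * (1 / ln u))) \<longlongrightarrow> lstar / 1) at_top"
      by (intro tendsto_divide \<phi>_rate d1) simp
    then have "((\<lambda>u. (ln u powr \<tau> * \<phi> u) / (1 - \<tau> * (F u / (u * f u)) * (1 / ln u))) \<longlongrightarrow> lstar) at_top"
      by simp
    then show "((\<lambda>u. f u * \<phi> u / ?G' u) \<longlongrightarrow> lstar) at_top"
    proof (rule Lim_transform_eventually)
      show "\<forall>\<^sub>F u in at_top. ln u powr \<tau> * \<phi> u / (1 - \<tau> * (F u / (u * f u)) * (1 / ln u)) = f u * \<phi> u / ?G' u"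
        using eventually_gt_at_top[of 1]
      proof eventually_elim
        case (elim u)
        have L: "ln u powr (- \<tau>) = 1 / ln u powr \<tau>" by (simp add: powr_minus divide_simps)
        have alg: "A * y / c = w * y / (w * (1 / A) * c)" if "w > 0" for A y c w :: real
          using that by simp
        show ?case unfolding L by (rule alg, rule f_pos) (use elim in simp)
      qed
    qed
  qed
  then show ?thesis
  proof (rule Lim_transform_eventually)
    show "\<forall>\<^sub>F u in at_top. ?N u / ?G u = ln u powr \<tau> * (elasticity u - (\<rho> + 2))"
      using eventually_gt_at_top[of 1]
    proof eventually_elim
      case (elim u)
      have "F u > 0" using elim F_pos by auto
      then have "elasticity u - (\<rho> + 2) = ?N u / F u" by (simp add: elasticity_def diff_divide_distrib)
      then show ?case by (simp add: powr_minus field_simps)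
    qed
  qed
qed

text \<open>The numerator of the \<open>0/0\<close> quotients in the next section: \<open>u\<^sup>2 / F u\<close> is the elasticity divided
  by \<open>f u / u\<close>.\<close>
lemma u_over_sqrt_F_lim: "((\<lambda>u. u / sqrt (2 * F u)) \<longlongrightarrow> 0) at_top"
proof -
  have "filterlim (\<lambda>u. F u / (u * f u) * (f u / u)) at_top at_top"
    by (rule filterlim_tendsto_pos_mult_at_top[OF inverse_elasticity_lim _ f_quot_at_top]) (use \<rho>_pos in simp)
  then have "filterlim (\<lambda>u. sqrt (2 * (F u / (u * f u) * (f u / u)))) at_top at_top"
    by (intro filterlim_compose[OF sqrt_at_top] filterlim_tendsto_pos_mult_at_top[OF tendsto_const]) auto
  then have "((\<lambda>u. inverse (sqrt (2 * (F u / (u * f u) * (f u / u))))) \<longlongrightarrow> 0) at_top"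
    by (rule tendsto_inverse_0_at_top)
  then show ?thesis
  proof (rule Lim_transform_eventually)
    show "\<forall>\<^sub>F u in at_top. inverse (sqrt (2 * (F u / (u * f u) * (f u / u)))) = u / sqrt (2 * F u)"
      using eventually_gt_at_top[of 0]
    proof eventually_elim
      case (elim u)
      have "F u / (u * f u) * (f u / u) = F u / u^2" using f_pos[OF elim] by (simp add: power2_eq_square)
      then show ?case using elim by (simp add: real_sqrt_divide)
    qed
  qed
qed

end

section \<open>The tail integral of the nonlinearity\<close>

text \<open>Convergence of the Keller--Osserman integral, here from one point \<open>U1\<close> on.\<close>
locale keller_osserman = nonlinearity +
  fixes U1 :: real
  assumes U1_pos: "U1 > 0"
    and tail_integrable: "(\<lambda>s. 1 / sqrt (2 * F s)) integrable_on {U1..}"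
begin

definition I where "I u = integral {u..} (\<lambda>s. 1 / sqrt (2 * F s))"

lemma tail_abs: "u \<ge> U1 \<Longrightarrow> (\<lambda>s. 1 / sqrt (2 * F s)) absolutely_integrable_on {u..}"
proof -
  assume u: "u \<ge> U1"
  have "(\<lambda>s. 1 / sqrt (2 * F s)) absolutely_integrable_on {U1..}"
  proof (rule nonnegative_absolutely_integrable_1[OF tail_integrable])
    fix s assume "s \<in> {U1..}"
    then show "0 \<le> 1 / sqrt (2 * F s)" using F_pos[of s] U1_pos by auto
  qed
  then show ?thesis by (rule set_integrable_subset) (use u in auto)
qed

lemma F_cont: "continuous_on {0<..} F"
  by (intro continuous_at_imp_continuous_on ballI DERIV_isCont[OF F_deriv]) auto

lemma integrand_cont: "0 < u \<Longrightarrow> continuous_on {u..v} (\<lambda>s. 1 / sqrt (2 * F s))"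
proof (intro continuous_intros continuous_on_subset[OF F_cont])
  assume "0 < u"
  then have "sqrt (2 * F s) > 0" if "s \<in> {u..v}" for s using F_pos[of s] that by simp
  then show "\<forall>s\<in>{u..v}. sqrt (2 * F s) \<noteq> 0" by (metis less_irrefl)
qed auto

lemma I_split: "U1 \<le> u \<Longrightarrow> u \<le> v \<Longrightarrow> I u = integral {u..v} (\<lambda>s. 1 / sqrt (2 * F s)) + I v"
proof -
  assume uv: "U1 \<le> u" "u \<le> v"
  let ?g = "\<lambda>s. 1 / sqrt (2 * F s)"
  have "(?g has_integral integral {u..v} ?g) {u..v}"
    using uv U1_pos by (intro integrable_integral integrable_continuous_real integrand_cont) auto
  moreover have "(?g has_integral I v) {v..}"
    unfolding I_def using uv tail_abs[of v]
    by (intro integrable_integral) (auto simp: absolutely_integrable_on_def)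
  moreover have "{u..v} \<inter> {v..} = {v}" using uv by auto
  ultimately have "(?g has_integral (integral {u..v} ?g + I v)) ({u..v} \<union> {v..})"
    by (intro has_integral_Un) auto
  moreover have "{u..v} \<union> {v..} = {u..}" using uv by auto
  ultimately show ?thesis unfolding I_def by (simp add: integral_unique)
qed

lemma I_deriv: "u > U1 \<Longrightarrow> (I has_real_derivative - (1 / sqrt (2 * F u))) (at u)"
proof -
  assume u: "u > U1"
  let ?g = "\<lambda>s. 1 / sqrt (2 * F s)"
  have "((\<lambda>x. integral {U1..x} ?g) has_real_derivative ?g u) (at u within {U1..u+1})"
    using u U1_pos by (intro integral_has_real_derivative integrand_cont) auto
  moreover have "at u within {U1..u+1} = at u"
    using u by (intro at_within_interior) (auto simp: interior_atLeastAtMost_real)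
  ultimately have "((\<lambda>x. I U1 - integral {U1..x} ?g) has_real_derivative - ?g u) (at u)"
    by (auto intro!: derivative_eq_intros)
  then show ?thesis
  proof (rule has_field_derivative_transform_within_open[where S="{U1<..}"])
    fix x assume "x \<in> {U1<..}"
    then show "I U1 - integral {U1..x} ?g = I x" using I_split[of U1 x] by simp
  qed (use u in auto)
qed

lemma I_strict: "U1 \<le> u \<Longrightarrow> u < v \<Longrightarrow> I v < I u"
proof -
  assume uv: "U1 \<le> u" "u < v"
  have "integral {u..v} (\<lambda>_. 0) < integral {u..v} (\<lambda>s. 1 / sqrt (2 * F s))"
    using uv U1_pos F_pos by (intro integral_less_real integrand_cont) auto
  then show ?thesis using I_split[of u v] uv by simp
qed

lemma I_pos: "U1 \<le> u \<Longrightarrow> I u > 0"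
proof -
  assume u: "U1 \<le> u"
  have "0 \<le> I (u + 1)" unfolding I_def
  proof (rule integral_nonneg)
    show "(\<lambda>s. 1 / sqrt (2 * F s)) integrable_on {u + 1..}"
      using tail_abs[of "u+1"] u by (auto simp: absolutely_integrable_on_def)
    fix s assume "s \<in> {u + 1..}"
    then show "0 \<le> 1 / sqrt (2 * F s)" using F_pos[of s] U1_pos u by auto
  qed
  also have "\<dots> < I u" using u by (intro I_strict) auto
  finally show ?thesis .
qed

lemma I_lim: "(I \<longlongrightarrow> 0) at_top"
proof -
  let ?g = "\<lambda>s. 1 / sqrt (2 * F s)"
  have "((\<lambda>b. set_lebesgue_integral lebesgue {U1..b} ?g) \<longlongrightarrow> set_lebesgue_integral lebesgue {U1..} ?g) at_top"
    by (rule tendsto_set_lebesgue_integral_at_top) (use tail_abs[of U1] in auto)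
  moreover have "\<forall>\<^sub>F b in at_top. set_lebesgue_integral lebesgue {U1..b} ?g = I U1 - I b"
    using eventually_ge_at_top[of U1]
  proof eventually_elim
    case (elim b)
    have "?g absolutely_integrable_on {U1..b}"
      by (rule set_integrable_subset[OF tail_abs[of U1]]) auto
    then show ?case using I_split[of U1 b] elim by (simp add: set_lebesgue_integral_eq_integral)
  qed
  ultimately have "((\<lambda>b. I U1 - I b) \<longlongrightarrow> set_lebesgue_integral lebesgue {U1..} ?g) at_top"
    by (rule Lim_transform_eventually)
  moreover have "set_lebesgue_integral lebesgue {U1..} ?g = I U1"
    using tail_abs[of U1] by (simp add: set_lebesgue_integral_eq_integral I_def)
  ultimately have "((\<lambda>b. I U1 - (I U1 - I b)) \<longlongrightarrow> I U1 - I U1) at_top"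
    by (intro tendsto_diff tendsto_const) simp
  then show ?thesis by simp
qed

text \<open>The elasticity of the tail integral \<open>I\<close>, up to sign.\<close>
definition P where "P u = u / (sqrt (2 * F u) * I u)"

lemma sqrt_F_ratio_deriv:
  assumes "u > 0"
  shows "((\<lambda>u. u / sqrt (2 * F u)) has_real_derivative (1 - elasticity u / 2) * (1 / sqrt (2 * F u))) (at u)"
proof -
  have F: "F u > 0" using F_pos assms by auto
  have "((\<lambda>u. u / sqrt (2 * F u)) has_real_derivative
     (sqrt (2 * F u) - u * (f u / sqrt (2 * F u))) / (2 * F u)) (at u)"
    using F by (auto intro!: derivative_eq_intros F_deriv[OF assms] simp: field_simps)
  moreover have "(sqrt (2 * F u) - u * (f u / sqrt (2 * F u))) / (2 * F u)
    = (1 - elasticity u / 2) * (1 / sqrt (2 * F u))"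
  proof -
    have "u * (f u / sqrt (2 * F u)) = elasticity u / 2 * sqrt (2 * F u)"
      using F by (simp add: elasticity_def field_simps flip: real_sqrt_mult)
    moreover have "2 * F u = sqrt (2 * F u) * sqrt (2 * F u)" using F by simp
    ultimately have "(sqrt (2 * F u) - u * (f u / sqrt (2 * F u))) / (2 * F u)
      = ((1 - elasticity u / 2) * sqrt (2 * F u)) / (sqrt (2 * F u) * sqrt (2 * F u))"
      by (simp add: algebra_simps)
    also have "\<dots> = (1 - elasticity u / 2) * (1 / sqrt (2 * F u))"
    proof -
      have cancel: "a * b / (b * b) = a * (1 / b)" if "b \<noteq> 0" for a b :: real using that by simp
      show ?thesis by (rule cancel) (use F in simp)
    qed
    finally show ?thesis .
  qed
  ultimately show ?thesis by simp
qed

lemma P_lim: "(P \<longlongrightarrow> \<rho> / 2) at_top"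
proof -
  have "((\<lambda>u. (u / sqrt (2 * F u)) / I u) \<longlongrightarrow> \<rho> / 2) at_top"
  proof (rule lhopital_at_top_0[OF u_over_sqrt_F_lim I_lim])
    have ev: "\<forall>\<^sub>F u in at_top. u > U1" by (rule eventually_gt_at_top)
    show "\<forall>\<^sub>F u in at_top. I u \<noteq> 0"
      using ev by eventually_elim (rule less_imp_neq[symmetric, OF I_pos], simp)
    show "\<forall>\<^sub>F u in at_top. - (1 / sqrt (2 * F u)) \<noteq> 0"
      using ev
    proof eventually_elim
      case (elim u)
      then have "F u > 0" using F_pos[of u] U1_pos by auto
      then show ?case by simp
    qed
    show "\<forall>\<^sub>F u in at_top. (I has_real_derivative - (1 / sqrt (2 * F u))) (at u)"
      using ev by eventually_elim (use I_deriv in auto)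
    show "\<forall>\<^sub>F u in at_top. ((\<lambda>u. u / sqrt (2 * F u)) has_real_derivative (1 - elasticity u / 2) * (1 / sqrt (2 * F u))) (at u)"
      using ev by eventually_elim (rule sqrt_F_ratio_deriv, use U1_pos in auto)
    have "((\<lambda>u. elasticity u / 2 - 1) \<longlongrightarrow> (\<rho> + 2) / 2 - 1) at_top" by (intro tendsto_intros elasticity_lim) simp
    then have "((\<lambda>u. elasticity u / 2 - 1) \<longlongrightarrow> \<rho> / 2) at_top" by (simp add: field_simps)
    then show "((\<lambda>u. (1 - elasticity u / 2) * (1 / sqrt (2 * F u)) / - (1 / sqrt (2 * F u))) \<longlongrightarrow> \<rho> / 2) at_top"
    proof (rule Lim_transform_eventually)
      show "\<forall>\<^sub>F u in at_top. elasticity u / 2 - 1 = (1 - elasticity u / 2) * (1 / sqrt (2 * F u)) / - (1 / sqrt (2 * F u))"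
        using ev
      proof eventually_elim
        case (elim u)
        have "F u > 0" using elim U1_pos F_pos[of u] by simp
        then show ?case by (simp add: field_simps)
      qed
    qed
  qed
  then show ?thesis by (simp add: P_def[abs_def])
qed

text \<open>L'Hopital once more: \<open>(u / sqrt (2 F) - \<rho> / 2 * I)'\<close> is \<open>- 1 / sqrt (2 F)\<close> times half
  of the deviation of the elasticity from \<open>\<rho> + 2\<close>, whose rate is known.\<close>
lemma P_rate: "((\<lambda>u. ln u powr \<tau> * (P u - \<rho> / 2)) \<longlongrightarrow> lstar / 2) at_top"
proof -
  let ?r = "\<lambda>u. 1 / sqrt (2 * F u)"
  let ?N = "\<lambda>u. u / sqrt (2 * F u) - \<rho> / 2 * I u"
  let ?G = "\<lambda>u. I u * ln u powr (- \<tau>)"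
  let ?c = "\<lambda>u. 1 + \<tau> * (1 / P u) * (1 / ln u)"
  let ?N' = "\<lambda>u. (1 - elasticity u / 2) * ?r u - \<rho> / 2 * - ?r u"
  let ?G' = "\<lambda>u. - (?r u * ln u powr (- \<tau>) * ?c u)"
  have "(?c \<longlongrightarrow> 1 + \<tau> * (1 / (\<rho> / 2)) * 0) at_top"
    using \<rho>_pos by (intro tendsto_intros P_lim inverse_ln_0) simp
  then have c1: "(?c \<longlongrightarrow> 1) at_top" by simp
  have cpos: "\<forall>\<^sub>F u in at_top. ?c u > 0" using c1 by (rule order_tendstoD) simp
  have ev: "\<forall>\<^sub>F u in at_top. u > max U1 1" by (rule eventually_gt_at_top)
  have "((\<lambda>u. ?N u / ?G u) \<longlongrightarrow> lstar / 2) at_top"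
  proof (rule lhopital_at_top_0)
    have "(?N \<longlongrightarrow> 0 - \<rho> / 2 * 0) at_top" by (intro tendsto_intros u_over_sqrt_F_lim I_lim)
    then show "(?N \<longlongrightarrow> 0) at_top" by simp
    have "(?G \<longlongrightarrow> 0 * 0) at_top" by (intro tendsto_mult I_lim ln_powr_minus_0 \<tau>_pos)
    then show "(?G \<longlongrightarrow> 0) at_top" by simp
    show "\<forall>\<^sub>F u in at_top. ?G u \<noteq> 0" using ev
    proof eventually_elim
      case (elim u)
      then have "I u > 0" "ln u > 0" using I_pos by auto
      then show ?case by simp
    qed
    show "\<forall>\<^sub>F u in at_top. ?G' u \<noteq> 0" using ev cpos
    proof eventually_elim
      case (elim u)
      then have "?r u * ln u powr (- \<tau>) * ?c u > 0" using F_pos[of u] by (intro mult_pos_pos) auto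
      then show ?case by linarith
    qed
    show "\<forall>\<^sub>F u in at_top. (?N has_real_derivative ?N' u) (at u)"
      using ev by eventually_elim (intro DERIV_diff sqrt_F_ratio_deriv DERIV_cmult I_deriv; use U1_pos in auto)
    show "\<forall>\<^sub>F u in at_top. (?G has_real_derivative ?G' u) (at u)" using ev
    proof eventually_elim
      case (elim u)
      have p: "ln u powr (- \<tau> - 1) = ln u powr (- \<tau>) / ln u" using elim by (simp add: powr_diff)
      have F: "F u > 0" using elim F_pos by auto
      have d: "(?G has_real_derivative - ?r u * ln u powr (- \<tau>) + I u * (- \<tau> * ln u powr (- \<tau> - 1) * (1 / u))) (at u)"
        using elim by (auto intro!: derivative_eq_intros I_deriv)
      have "I u / u = ?r u * (1 / P u)" using elim F by (simp add: P_def field_simps)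
      moreover have "- r * L + J * (- \<tau> * (L / l) * (1 / v)) = - (r * L * (1 + \<tau> * q * (1 / l)))"
        if "J / v = r * q" for r L J l v q :: real
      proof -
        have "J * (- \<tau> * (L / l) * (1 / v)) = - \<tau> * (L / l) * (J / v)" by simp
        then show ?thesis unfolding that by (simp add: algebra_simps)
      qed
      ultimately have "- ?r u * ln u powr (- \<tau>) + I u * (- \<tau> * ln u powr (- \<tau> - 1) * (1 / u)) = ?G' u"
        unfolding p by blast
      with d show ?case by simp
    qed
    have "((\<lambda>u. (ln u powr \<tau> * (elasticity u - (\<rho> + 2))) / 2 / ?c u) \<longlongrightarrow> lstar / 2 / 1) at_top"
      by (intro tendsto_divide tendsto_const elasticity_rate c1) auto
    then have "((\<lambda>u. (ln u powr \<tau> * (elasticity u - (\<rho> + 2))) / 2 / ?c u) \<longlongrightarrow> lstar / 2) at_top" by simp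
    then show "((\<lambda>u. ?N' u / ?G' u) \<longlongrightarrow> lstar / 2) at_top"
    proof (rule Lim_transform_eventually)
      show "\<forall>\<^sub>F u in at_top. (ln u powr \<tau> * (elasticity u - (\<rho> + 2))) / 2 / ?c u = ?N' u / ?G' u"
        using ev cpos
      proof eventually_elim
        case (elim u)
        have r: "?r u > 0" using elim F_pos[of u] by simp
        have N: "?N' u = ?r u * (- (elasticity u - (\<rho> + 2)) / 2)" by (simp add: algebra_simps diff_divide_distrib add_divide_distrib)
        have L: "ln u powr (- \<tau>) = 1 / ln u powr \<tau>" "ln u powr \<tau> > 0"
          using elim by (auto simp: powr_minus divide_simps)
        have alg: "A * Y / 2 / c = r * (- Y / 2) / - (r * (1 / A) * c)"
          if "r > 0" "A > 0" "c > 0" for A Y c r :: real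
          using that by (simp add: field_simps)
        show ?case unfolding N L(1) by (rule alg[OF r L(2) elim(2)])
      qed
    qed
  qed
  then show ?thesis
  proof (rule Lim_transform_eventually)
    show "\<forall>\<^sub>F u in at_top. ?N u / ?G u = ln u powr \<tau> * (P u - \<rho> / 2)" using ev
    proof eventually_elim
      case (elim u)
      have "I u > 0" using elim I_pos by auto
      then have "P u - \<rho> / 2 = ?N u / I u" by (simp add: P_def diff_divide_distrib)
      moreover have "N / (J * inverse l) = l * (N / J)" for N J l :: real by (simp add: field_simps)
      ultimately show ?case by (simp only: powr_minus)
    qed
  qed
qed

text \<open>The factor through which \<open>f\<close> enters the second derivative of the profile.  Up to
  smaller terms it equals \<open>(\<rho> + y) / (\<rho> + 2 + y)\<close> with \<open>y = lstar * (ln u) powr (- \<tau>)\<close>, which explains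
  the constant in its rate.\<close>
definition Q where "Q u = sqrt (2 * F u) / (f u * I u)"

lemma Q_eq: "u > U1 \<Longrightarrow> Q u = 2 * P u / elasticity u"
proof -
  assume u: "u > U1"
  then have "u > 0" "F u > 0" "f u > 0" "I u > 0" using U1_pos F_pos[of u] f_pos[of u] I_pos[of u] by auto
  then show ?thesis
    by (simp add: Q_def P_def elasticity_def field_simps) 
qed

lemma Q_lim: "(Q \<longlongrightarrow> \<rho> / (\<rho> + 2)) at_top"
proof -
  have "((\<lambda>u. 2 * P u / elasticity u) \<longlongrightarrow> 2 * (\<rho> / 2) / (\<rho> + 2)) at_top"
    using \<rho>_pos by (intro tendsto_intros P_lim elasticity_lim) auto
  then have "((\<lambda>u. 2 * P u / elasticity u) \<longlongrightarrow> \<rho> / (\<rho> + 2)) at_top" by simp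
  then show ?thesis
    by (rule Lim_transform_eventually) (use eventually_gt_at_top[of U1] in eventually_elim, use Q_eq in auto)
qed

lemma Q_rate: "((\<lambda>u. ln u powr \<tau> * (Q u - \<rho> / (\<rho> + 2))) \<longlongrightarrow> 2 * lstar / (\<rho> + 2)\<^sup>2) at_top"
proof -
  let ?s = "\<lambda>u. ln u powr \<tau>"
  have "((\<lambda>u. (2 * (\<rho> + 2) * (?s u * (P u - \<rho> / 2)) - \<rho> * (?s u * (elasticity u - (\<rho> + 2)))) / (elasticity u * (\<rho> + 2)))
     \<longlongrightarrow> (2 * (\<rho> + 2) * (lstar / 2) - \<rho> * lstar) / ((\<rho> + 2) * (\<rho> + 2))) at_top"
    by (intro tendsto_divide tendsto_mult tendsto_diff tendsto_const P_rate elasticity_rate elasticity_lim) (use \<rho>_pos in simp)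
  also have "(2 * (\<rho> + 2) * (lstar / 2) - \<rho> * lstar) / ((\<rho> + 2) * (\<rho> + 2)) = 2 * lstar / (\<rho> + 2)\<^sup>2"
    by (simp add: power2_eq_square algebra_simps)
  finally show ?thesis
  proof (rule Lim_transform_eventually)
    have "\<forall>\<^sub>F u in at_top. elasticity u > 0" using \<rho>_pos by (intro order_tendstoD(1)[OF elasticity_lim]) auto
    then show "\<forall>\<^sub>F u in at_top. (2 * (\<rho> + 2) * (?s u * (P u - \<rho> / 2)) - \<rho> * (?s u * (elasticity u - (\<rho> + 2)))) / (elasticity u * (\<rho> + 2))
      = ?s u * (Q u - \<rho> / (\<rho> + 2))"
      using eventually_gt_at_top[of U1]
    proof eventually_elim
      case (elim u)
      have alg: "(2 * m * (s * (p - \<rho> / 2)) - \<rho> * (s * (x - m))) / (x * m) = s * (2 * p / x - \<rho> / m)"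
        if "m > 0" "x > 0" for m s p x :: real
        using that by (simp add: field_simps)
      show ?case using elim \<rho>_pos unfolding Q_eq[OF elim(2)] by (intro alg) auto
    qed
  qed
qed

end

section \<open>The blow-up profile\<close>

lemma log_rate_at_top: "\<tau> > 0 \<Longrightarrow> filterlim (\<lambda>t::real. (- ln t) powr \<tau>) at_top (at_right 0)"
  by real_asymp

lemma log_rate_powr_0: "\<theta> > 0 \<Longrightarrow> ((\<lambda>t::real. (- ln t) powr \<tau> * t powr \<theta>) \<longlongrightarrow> 0) (at_right 0)"
  by real_asymp

lemma inverse_minus_ln_0: "((\<lambda>t::real. 1 / - ln t) \<longlongrightarrow> 0) (at_right 0)"
  by real_asymp

lemma minus_ln_at_top: "filterlim (\<lambda>t::real. - ln t) at_top (at_right 0)"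
  by real_asymp

text \<open>Product and chain rule for first-order expansions.\<close>
lemma rate_mult:
  fixes x y \<sigma> :: "'b \<Rightarrow> real"
  assumes "filterlim \<sigma> at_top G"
    and "((\<lambda>t. \<sigma> t * (x t - a)) \<longlongrightarrow> p) G" "((\<lambda>t. \<sigma> t * (y t - b)) \<longlongrightarrow> q) G"
  shows "((\<lambda>t. \<sigma> t * (x t * y t - a * b)) \<longlongrightarrow> p * b + a * q) G"
proof -
  have "(y \<longlongrightarrow> b) G" by (rule tendsto_if_rate[OF assms(1,3)])
  then have "((\<lambda>t. \<sigma> t * (x t - a) * y t + a * (\<sigma> t * (y t - b))) \<longlongrightarrow> p * b + a * q) G"
    by (intro tendsto_intros assms)
  then show ?thesis by (simp add: algebra_simps)
qed

lemma rate_compose: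
  fixes x \<sigma> :: "'b \<Rightarrow> real" and g :: "real \<Rightarrow> real"
  assumes "filterlim \<sigma> at_top G" "((\<lambda>t. \<sigma> t * (x t - a)) \<longlongrightarrow> p) G"
    and "(g has_real_derivative d) (at a)"
  shows "((\<lambda>t. \<sigma> t * (g (x t) - g a)) \<longlongrightarrow> d * p) G"
proof -
  obtain \<gamma> where \<gamma>: "\<And>z. g z - g a = \<gamma> z * (z - a)" "isCont \<gamma> a" "\<gamma> a = d"
    using assms(3) unfolding CARAT_DERIV by blast
  have "((\<lambda>t. \<gamma> (x t)) \<longlongrightarrow> d) G"
    using isCont_tendsto_compose[OF \<gamma>(2) tendsto_if_rate[OF assms(1,2)]] \<gamma>(3) by simp
  then have "((\<lambda>t. \<gamma> (x t) * (\<sigma> t * (x t - a))) \<longlongrightarrow> d * p) G"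
    by (intro tendsto_mult assms)
  then show ?thesis unfolding \<gamma>(1) by (simp add: mult_ac)
qed

text \<open>Here \<open>K\<close> is the primitive of the weight \<open>k\<close>, and \<open>1 - K k' / k\<^sup>2\<close> is the derivative of \<open>K / k\<close>.\<close>
locale profile = keller_osserman +
  fixes k k' K h :: "real \<Rightarrow> real" and \<nu> l1 L :: real
  assumes \<nu>_pos: "\<nu> > 0"
    and k_pos: "\<And>t. 0 < t \<Longrightarrow> t < \<nu> \<Longrightarrow> k t > 0"
    and K_pos: "\<And>t. 0 < t \<Longrightarrow> t < \<nu> \<Longrightarrow> K t > 0"
    and k_deriv: "\<And>t. 0 < t \<Longrightarrow> t < \<nu> \<Longrightarrow> (k has_real_derivative k' t) (at t)"
    and K_deriv: "\<And>t. 0 < t \<Longrightarrow> t < \<nu> \<Longrightarrow> (K has_real_derivative k t) (at t)"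
    and K_lim: "(K \<longlongrightarrow> 0) (at_right 0)"
    and K_over_k_lim: "((\<lambda>t. K t / k t) \<longlongrightarrow> 0) (at_right 0)"
    and ratio_deriv_rate: "((\<lambda>t. (- ln t) powr \<tau> * ((1 - K t * k' t / (k t)\<^sup>2) - l1)) \<longlongrightarrow> L) (at_right 0)"
    and l1_pos: "l1 > 0"
    and h_eq: "\<forall>\<^sub>F t in at_right 0. U1 \<le> h t \<and> I (h t) = K t"
begin

abbreviation (input) \<sigma> where "\<sigma> t \<equiv> (- ln t) powr \<tau>"
abbreviation (input) s where "s t \<equiv> (- ln t) powr (- \<tau>)"

lemma \<sigma>_at_top: "filterlim \<sigma> at_top (at_right 0)"
  by (rule log_rate_at_top[OF \<tau>_pos])

lemma \<sigma>_s: "0 < t \<Longrightarrow> t < 1 \<Longrightarrow> \<sigma> t * s t = 1"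
  by (simp add: powr_minus)

lemma near0: "e > 0 \<Longrightarrow> \<forall>\<^sub>F t in at_right 0. 0 < t \<and> t < (e::real)"
  using eventually_at_right_real[of 0 e] by simp

text \<open>\<open>I\<close> is positive and decreasing, and \<open>I (h t) = K t\<close> tends to \<open>0\<close>.\<close>
lemma h_at_top: "filterlim h at_top (at_right 0)"
  unfolding filterlim_at_top
proof
  fix Z :: real
  define V where "V = max Z U1"
  have V: "V \<ge> U1" by (simp add: V_def)
  have "\<forall>\<^sub>F t in at_right 0. K t < I V" using I_pos[OF V] by (intro order_tendstoD(2)[OF K_lim])
  with h_eq show "\<forall>\<^sub>F t in at_right 0. Z \<le> h t"
  proof eventually_elim
    case (elim t)
    have "\<not> h t < V"
    proof
      assume "h t < V"
      then have "I V < I (h t)" using elim by (intro I_strict) auto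
      then show False using elim by simp
    qed
    then show ?case by (simp add: V_def)
  qed
qed

lemma h_regular:
  obtains \<delta> where "0 < \<delta>" "\<delta> \<le> \<nu>" "\<delta> \<le> 1" "\<And>t. 0 < t \<Longrightarrow> t < \<delta> \<Longrightarrow> h t > U1 \<and> I (h t) = K t"
proof -
  have "\<forall>\<^sub>F t in at_right 0. h t > U1 \<and> I (h t) = K t"
    using h_eq filterlim_at_top_dense[THEN iffD1, OF h_at_top, rule_format, of U1]
    by eventually_elim auto
  then obtain e where e: "e > 0" "\<And>t. 0 < t \<Longrightarrow> t < e \<Longrightarrow> h t > U1 \<and> I (h t) = K t"
    unfolding eventually_at_right_field by auto
  show ?thesis using e \<nu>_pos by (intro that[of "min e (min \<nu> 1)"]) auto
qed

lemma I_cont: "continuous_on {U1<..} I"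
  by (intro continuous_at_imp_continuous_on ballI DERIV_isCont[OF I_deriv]) auto

lemma I_inj: "inj_on I {U1<..}"
proof (rule linorder_inj_onI')
  fix x y assume "x \<in> {U1<..}" "x < y"
  then show "I x \<noteq> I y" using I_strict[of x y] by auto
qed

text \<open>\<open>h\<close> is the inverse of \<open>I\<close> composed with \<open>K\<close>.\<close>
lemma h_deriv_aux:
  assumes \<delta>: "\<delta> \<le> \<nu>" "\<And>t. 0 < t \<Longrightarrow> t < \<delta> \<Longrightarrow> h t > U1 \<and> I (h t) = K t" and t: "0 < t" "t < \<delta>"
  shows "(h has_real_derivative - (k t * sqrt (2 * F (h t)))) (at t)"
proof -
  define J where "J = the_inv_into {U1<..} I"
  have J: "J (I u) = u" if "u > U1" for u
    unfolding J_def by (rule the_inv_into_f_f[OF I_inj]) (use that in auto)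
  have hJ: "J (K x) = h x" if "0 < x" "x < \<delta>" for x using J[of "h x"] \<delta>(2)[OF that] by auto
  have ht: "h t > U1" "I (h t) = K t" using \<delta>(2) t by auto
  have Fp: "F (h t) > 0" using F_pos U1_pos ht by auto
  have "(J has_derivative (*) (- sqrt (2 * F (h t)))) (at (I (h t)))"
  proof (rule has_derivative_inverse_strong[where f=I and S="{U1<..}" and f'="(*) (- (1 / sqrt (2 * F (h t))))"])
    show "(I has_derivative (*) (- (1 / sqrt (2 * F (h t))))) (at (h t))"
      using I_deriv[OF ht(1)] by (simp add: has_field_derivative_def)
    show "(*) (- (1 / sqrt (2 * F (h t)))) \<circ> (*) (- sqrt (2 * F (h t))) = id"
      using Fp by (auto simp: fun_eq_iff)
  qed (use J ht I_cont in auto)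
  then have "(J has_real_derivative - sqrt (2 * F (h t))) (at (K t))"
    by (simp add: has_field_derivative_def ht(2))
  then have "((\<lambda>x. J (K x)) has_real_derivative - sqrt (2 * F (h t)) * k t) (at t)"
    by (rule DERIV_chain2) (use K_deriv t \<delta> in auto)
  then have "(h has_real_derivative - sqrt (2 * F (h t)) * k t) (at t)"
    by (rule has_field_derivative_transform_within_open[where S="{0<..<\<delta>}"]) (use t hJ in auto)
  then show ?thesis by (simp add: mult.commute)
qed

text \<open>\<open>kf\<close> is the right-hand side of the equation along the profile and serves as the unit in which
  all terms are measured; \<open>h1\<close> and \<open>h2\<close> are the first two derivatives of \<open>h\<close>.\<close>
definition kf where "kf t = (k t)\<^sup>2 * f (h t)"
definition h1 where "h1 t = - (k t * sqrt (2 * F (h t)))"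
definition h2 where "h2 t = kf t * (1 - (K t * k' t / (k t)\<^sup>2) * Q (h t))"

lemma h_facts:
  obtains \<delta> where "0 < \<delta>" "\<delta> \<le> \<nu>" "\<delta> \<le> 1"
    "\<And>t. 0 < t \<Longrightarrow> t < \<delta> \<Longrightarrow> h t > U1 \<and> I (h t) = K t \<and> f (h t) > 0 \<and> F (h t) > 0 \<and> k t > 0 \<and> K t > 0 \<and> kf t > 0
      \<and> (h has_real_derivative h1 t) (at t) \<and> (h1 has_real_derivative h2 t) (at t)"
proof -
  obtain \<delta> where \<delta>: "0 < \<delta>" "\<delta> \<le> \<nu>" "\<delta> \<le> 1" "\<And>t. 0 < t \<Longrightarrow> t < \<delta> \<Longrightarrow> h t > U1 \<and> I (h t) = K t"
    using h_regular by blast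
  have "h t > U1 \<and> I (h t) = K t \<and> f (h t) > 0 \<and> F (h t) > 0 \<and> k t > 0 \<and> K t > 0 \<and> kf t > 0
      \<and> (h has_real_derivative h1 t) (at t) \<and> (h1 has_real_derivative h2 t) (at t)"
    if t: "0 < t" "t < \<delta>" for t
  proof -
    note d = h_deriv_aux[OF \<delta>(2,4) t]
    have h0: "h t > 0" and It: "I (h t) = K t" using \<delta>(4)[OF t] U1_pos by auto
    have p: "f (h t) > 0" "F (h t) > 0" "k t > 0" "K t > 0"
      using f_pos F_pos h0 k_pos K_pos t \<delta>(2) by auto
    have kf: "kf t > 0" using p by (simp add: kf_def)
    have "((\<lambda>t. F (h t)) has_real_derivative f (h t) * h1 t) (at t)"
      by (rule DERIV_chain2[where f=F and g=h, OF F_deriv[OF h0]]) (use d in \<open>simp add: h1_def\<close>)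
    then have "((\<lambda>t. sqrt (2 * F (h t))) has_real_derivative (2 * (f (h t) * h1 t)) * (inverse (sqrt (2 * F (h t))) / 2)) (at t)"
      using p by (auto intro!: derivative_eq_intros)
    moreover have "(2 * (f (h t) * h1 t)) * (inverse (sqrt (2 * F (h t))) / 2) = - (f (h t) * k t)"
      using p by (simp add: h1_def)
    ultimately have D: "((\<lambda>t. sqrt (2 * F (h t))) has_real_derivative - (f (h t) * k t)) (at t)" by simp
    have kd: "(k has_real_derivative k' t) (at t)" using k_deriv t \<delta>(2) by simp
    have "(h1 has_real_derivative - (k' t * sqrt (2 * F (h t)) + - (f (h t) * k t) * k t)) (at t)"
      unfolding h1_def[abs_def] by (rule DERIV_minus[OF DERIV_mult[OF kd D]])
    moreover have "- (k' t * sqrt (2 * F (h t)) + - (f (h t) * k t) * k t) = h2 t"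
    proof -
      have "kf t * ((K t * k' t / (k t)\<^sup>2) * Q (h t)) = k' t * sqrt (2 * F (h t))"
        using p by (simp add: kf_def Q_def It)
      then show ?thesis unfolding h2_def by (simp add: kf_def algebra_simps power2_eq_square)
    qed
    ultimately show ?thesis using \<delta>(4)[OF t] p kf d by (simp add: h1_def)
  qed
  then show ?thesis using that \<delta> by blast
qed

lemma K_over_tk: "((\<lambda>t. K t / k t / t) \<longlongrightarrow> l1) (at_right 0)"
proof (rule lhopital_right_0[OF K_over_k_lim])
  show "((\<lambda>t::real. t) \<longlongrightarrow> 0) (at_right 0)" by (rule tendsto_ident_at)
  show "\<forall>\<^sub>F t::real in at_right 0. t \<noteq> 0" using eventually_at_right_less[of 0] by eventually_elim simp
  show "\<forall>\<^sub>F t::real in at_right 0. (1::real) \<noteq> 0" by simp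
  show "\<forall>\<^sub>F t::real in at_right 0. ((\<lambda>t. t) has_real_derivative 1) (at t)" by simp
  show "\<forall>\<^sub>F t in at_right 0. ((\<lambda>t. K t / k t) has_real_derivative 1 - K t * k' t / (k t)\<^sup>2) (at t)"
    using near0[OF \<nu>_pos]
  proof eventually_elim
    case (elim t)
    then have p: "k t > 0" using k_pos by auto
    have "((\<lambda>t. K t / k t) has_real_derivative (k t * k t - K t * k' t) / (k t * k t)) (at t)"
      by (rule DERIV_divide) (use elim k_deriv K_deriv p in auto)
    moreover have "(k t * k t - K t * k' t) / (k t * k t) = 1 - K t * k' t / (k t)\<^sup>2"
      using p by (simp add: diff_divide_distrib power2_eq_square)
    ultimately show ?case by simp
  qed
  show "((\<lambda>t. (1 - K t * k' t / (k t)\<^sup>2) / 1) \<longlongrightarrow> l1) (at_right 0)"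
    using tendsto_if_rate[OF \<sigma>_at_top ratio_deriv_rate] by simp
qed

lemma h1_lim: "((\<lambda>t. h1 t / kf t / t) \<longlongrightarrow> - (\<rho> / (\<rho> + 2) * l1)) (at_right 0)"
proof -
  have "((\<lambda>t. - (Q (h t) * (K t / k t / t))) \<longlongrightarrow> - (\<rho> / (\<rho> + 2) * l1)) (at_right 0)"
    by (intro tendsto_intros filterlim_compose[OF Q_lim h_at_top] K_over_tk)
  moreover obtain \<delta> where \<delta>: "0 < \<delta>" "\<And>t. 0 < t \<Longrightarrow> t < \<delta> \<Longrightarrow> I (h t) = K t \<and> f (h t) > 0 \<and> k t > 0 \<and> K t > 0"
    using h_facts by metis
  have "\<forall>\<^sub>F t in at_right 0. - (Q (h t) * (K t / k t / t)) = h1 t / kf t / t"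
    using near0[OF \<delta>(1)]
  proof eventually_elim
    case (elim t)
    with \<delta>(2)[of t] show ?case by (simp add: Q_def h1_def kf_def power2_eq_square)
  qed
  ultimately show ?thesis by (rule Lim_transform_eventually)
qed

lemma h_lim: "((\<lambda>t. h t / kf t / t\<^sup>2) \<longlongrightarrow> \<rho> / 2 * (\<rho> / (\<rho> + 2)) * l1\<^sup>2) (at_right 0)"
proof -
  have "((\<lambda>t. P (h t) * Q (h t) * (K t / k t / t)\<^sup>2) \<longlongrightarrow> \<rho> / 2 * (\<rho> / (\<rho> + 2)) * l1\<^sup>2) (at_right 0)"
    by (intro tendsto_intros filterlim_compose[OF Q_lim h_at_top] filterlim_compose[OF P_lim h_at_top] K_over_tk)
  moreover obtain \<delta> where \<delta>: "0 < \<delta>" "\<And>t. 0 < t \<Longrightarrow> t < \<delta> \<Longrightarrow> I (h t) = K t \<and> f (h t) > 0 \<and> F (h t) > 0 \<and> k t > 0 \<and> K t > 0"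
    using h_facts by metis
  have "\<forall>\<^sub>F t in at_right 0. P (h t) * Q (h t) * (K t / k t / t)\<^sup>2 = h t / kf t / t\<^sup>2"
    using near0[OF \<delta>(1)]
  proof eventually_elim
    case (elim t)
    have gen: "w / (r * K) * (r / (g * K)) * (K / k / t)\<^sup>2 = w / (k\<^sup>2 * g) / t\<^sup>2"
      if "r > 0" "K > 0" for w r K g k t :: real
      using that by (simp add: power2_eq_square)
    have "sqrt (2 * F (h t)) > 0" using \<delta>(2)[of t] elim by simp
    from gen[OF this, of "K t"] show ?case using \<delta>(2)[of t] elim
      by (simp add: P_def Q_def kf_def)
  qed
  ultimately show ?thesis by (rule Lim_transform_eventually)
qed

lemma ln_h_lim: "((\<lambda>t. ln (h t) / - ln t) \<longlongrightarrow> 2 / (\<rho> * l1)) (at_right 0)"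
proof -
  obtain \<delta> where \<delta>: "0 < \<delta>" "\<And>t. 0 < t \<Longrightarrow> t < \<delta> \<Longrightarrow> h t > U1 \<and> I (h t) = K t \<and> F (h t) > 0 \<and> k t > 0 \<and> K t > 0
     \<and> (h has_real_derivative h1 t) (at t)"
    using h_facts by metis
  show ?thesis
  proof (rule lhopital_right_0_at_top[OF minus_ln_at_top])
    show "\<forall>\<^sub>F t::real in at_right 0. - (1 / t) \<noteq> 0" using eventually_at_right_less[of 0] by eventually_elim simp
    show "\<forall>\<^sub>F t in at_right 0. ((\<lambda>t. - ln t) has_real_derivative - (1 / t)) (at t)"
      using eventually_at_right_less[of 0] by eventually_elim (auto intro!: derivative_eq_intros)
    show "\<forall>\<^sub>F t in at_right 0. ((\<lambda>t. ln (h t)) has_real_derivative h1 t / h t) (at t)"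
      using near0[OF \<delta>(1)]
    proof eventually_elim
      case (elim t)
      then have "(h has_real_derivative h1 t) (at t)" "h t > 0" using \<delta>(2)[of t] U1_pos by auto
      then show ?case by (auto intro!: derivative_eq_intros)
    qed
    have "((\<lambda>t. 1 / (K t / k t / t) * (1 / P (h t))) \<longlongrightarrow> 1 / l1 * (1 / (\<rho> / 2))) (at_right 0)"
      using l1_pos \<rho>_pos by (intro tendsto_intros filterlim_compose[OF P_lim h_at_top] K_over_tk) auto
    then have "((\<lambda>t. 1 / (K t / k t / t) * (1 / P (h t))) \<longlongrightarrow> 2 / (\<rho> * l1)) (at_right 0)"
      by (simp add: mult.commute)
    then show "((\<lambda>t. h1 t / h t / - (1 / t)) \<longlongrightarrow> 2 / (\<rho> * l1)) (at_right 0)"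
    proof (rule Lim_transform_eventually)
      show "\<forall>\<^sub>F t in at_right 0. 1 / (K t / k t / t) * (1 / P (h t)) = h1 t / h t / - (1 / t)"
        using near0[OF \<delta>(1)]
      proof eventually_elim
        case (elim t)
        have gen: "1 / (K / k / t) * (1 / (w / (r * K))) = - (k * r) / w / - (1 / t)"
          if "t > 0" "K > 0" for w r K k t :: real
          using that by simp
        show ?case using gen[of t "K t"] \<delta>(2)[of t] elim by (simp add: P_def h1_def)
      qed
    qed
  qed
qed

text \<open>Logarithmic rates at infinity become rates in \<open>- ln t\<close> along any \<open>v\<close> that grows like \<open>h\<close> on the
  logarithmic scale; this is where the factor \<open>(\<rho> l1 / 2) powr \<tau>\<close> of the second-order coefficient
  comes from.\<close>
lemma rate_transfer:
  assumes y: "((\<lambda>u. ln u powr \<tau> * y u) \<longlongrightarrow> c) at_top" and v: "filterlim v at_top (at_right 0)"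
    and lv: "((\<lambda>t. ln (v t) / - ln t) \<longlongrightarrow> 2 / (\<rho> * l1)) (at_right 0)"
  shows "((\<lambda>t. \<sigma> t * y (v t)) \<longlongrightarrow> (\<rho> * l1 / 2) powr \<tau> * c) (at_right 0)"
proof -
  have pl: "\<rho> * l1 > 0" using \<rho>_pos l1_pos by simp
  have "((\<lambda>t. (1 / (ln (v t) / - ln t)) powr \<tau>) \<longlongrightarrow> (1 / (2 / (\<rho> * l1))) powr \<tau>) (at_right 0)"
    using pl \<tau>_pos by (intro tendsto_intros lv) auto
  then have 1: "((\<lambda>t. (1 / (ln (v t) / - ln t)) powr \<tau> * (ln (v t) powr \<tau> * y (v t)))
      \<longlongrightarrow> (\<rho> * l1 / 2) powr \<tau> * c) (at_right 0)"
    by (intro tendsto_mult filterlim_compose[OF y v]) simp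
  have "\<forall>\<^sub>F t in at_right 0. v t > 1" using filterlim_at_top_dense[THEN iffD1, OF v] by blast
  with near0[OF zero_less_one] have "\<forall>\<^sub>F t in at_right 0. (1 / (ln (v t) / - ln t)) powr \<tau> * (ln (v t) powr \<tau> * y (v t)) = \<sigma> t * y (v t)"
  proof eventually_elim
    case (elim t)
    have l: "ln (v t) > 0" "- ln t > 0" using elim by auto
    have "1 / (ln (v t) / - ln t) = (- ln t) / ln (v t)" by simp
    then have "(1 / (ln (v t) / - ln t)) powr \<tau> = \<sigma> t / ln (v t) powr \<tau>"
      using l powr_divide[of "- ln t" "ln (v t)" \<tau>] by simp
    then show ?case using l by simp
  qed
  with 1 show ?thesis by (rule Lim_transform_eventually)
qed

end

section \<open>The two-term ansatz in one dimension\<close>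

context profile begin

text \<open>\<open>A\<close> and \<open>a1\<close> are the coefficients in \<open>h2 / kf = A + a1 * s + o(s)\<close>.  The constant \<open>\<xi>\<close> solves
  \<open>\<xi> powr \<rho> = A\<close>, so that \<open>\<xi> * h\<close> satisfies the equation to leading order, and \<open>chi\<close> is the value of
  \<open>c\<close> for which the ansatz \<open>W c\<close> satisfies it up to \<open>o(s)\<close>.\<close>
definition A where "A = (2 + l1 * \<rho>) / (2 + \<rho>)"
definition \<xi> where "\<xi> = A powr (1 / \<rho>)"
definition \<kappa> where "\<kappa> = (\<rho> * l1 / 2) powr \<tau>"
definition a1 where "a1 = L * (\<rho> / (\<rho> + 2)) - (1 - l1) * (\<kappa> * (2 * lstar / (\<rho> + 2)\<^sup>2))"
definition chi where "chi = (a1 / A - \<kappa> * lstar * ln \<xi>) / \<rho>"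

definition s1 where "s1 t = \<tau> * (- ln t) powr (- \<tau> - 1) / t"
definition s2 where "s2 t = (\<tau> * (\<tau> + 1) * (- ln t) powr (- \<tau> - 2) - \<tau> * (- ln t) powr (- \<tau> - 1)) / t\<^sup>2"

definition W where "W c t = \<xi> * (h t * (1 + c * s t))"
definition W1 where "W1 c t = \<xi> * (h1 t * (1 + c * s t) + h t * (c * s1 t))"
definition W2 where "W2 c t = \<xi> * (h2 t * (1 + c * s t) + 2 * (h1 t * (c * s1 t)) + h t * (c * s2 t))"

lemma A_pos: "A > 0"
  using \<rho>_pos l1_pos by (simp add: A_def add_pos_pos)

lemma \<xi>_pos: "\<xi> > 0"
  using A_pos by (simp add: \<xi>_def)

lemma \<xi>_powr: "exp ((\<rho> + 1) * ln \<xi>) = \<xi> * A"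
proof -
  have "exp ((\<rho> + 1) * ln \<xi>) = \<xi> powr (\<rho> + 1)" using \<xi>_pos by (simp add: powr_def)
  also have "\<dots> = \<xi> powr \<rho> * \<xi>" using \<xi>_pos by (simp add: powr_add)
  also have "\<xi> powr \<rho> = A" unfolding \<xi>_def using \<rho>_pos A_pos by (simp add: powr_powr)
  finally show ?thesis by simp
qed

lemma s_deriv: "0 < t \<Longrightarrow> t < 1 \<Longrightarrow> (s has_real_derivative s1 t) (at t)"
proof -
  assume t: "0 < t" "t < 1"
  have "((\<lambda>t. - ln t) has_real_derivative - (1 / t)) (at t)"
    using t by (auto intro!: derivative_eq_intros)
  from DERIV_powr[OF this _ DERIV_const, of "- \<tau>"] t
  have "(s has_real_derivative (- ln t) powr (- \<tau>) * (0 * ln (- ln t) + - (1 / t) * (- \<tau>) / (- ln t))) (at t)" by simp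
  moreover have "(- ln t) powr (- \<tau> - 1) = (- ln t) powr (- \<tau>) / (- ln t)"
    using t by (subst powr_diff) auto
  ultimately show ?thesis by (simp add: s1_def mult_ac)
qed

lemma s1_deriv: "0 < t \<Longrightarrow> t < 1 \<Longrightarrow> (s1 has_real_derivative s2 t) (at t)"
proof -
  assume t: "0 < t" "t < 1"
  have "((\<lambda>t. - ln t) has_real_derivative - (1 / t)) (at t)"
    using t by (auto intro!: derivative_eq_intros)
  from DERIV_powr[OF this _ DERIV_const, of "- \<tau> - 1"] t
  have D0: "((\<lambda>t. (- ln t) powr (- \<tau> - 1)) has_real_derivative
    (- ln t) powr (- \<tau> - 1) * (0 * ln (- ln t) + - (1 / t) * (- \<tau> - 1) / (- ln t))) (at t)" by simp
  have p: "(- ln t) powr (- \<tau> - 2) = (- ln t) powr (- \<tau> - 1) / (- ln t)"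
    using t powr_diff[of "- ln t" "- \<tau> - 1" 1] by (simp add: algebra_simps)
  have D: "((\<lambda>t. (- ln t) powr (- \<tau> - 1)) has_real_derivative
      (\<tau> + 1) * (- ln t) powr (- \<tau> - 2) / t) (at t)"
  proof -
    have "p * (0 * z + - (1 / t) * (- \<tau> - 1) / m) = (\<tau> + 1) * (p / m) / t" for p z m
      using t by (cases "m = 0") (simp_all add: field_simps)
    then show ?thesis unfolding p using D0 by (simp only:)
  qed
  have "((\<lambda>t. \<tau> * (- ln t) powr (- \<tau> - 1) / t) has_real_derivative
    (\<tau> * ((\<tau> + 1) * (- ln t) powr (- \<tau> - 2) / t) * t - \<tau> * (- ln t) powr (- \<tau> - 1) * 1) / (t * t)) (at t)"
    by (intro DERIV_divide DERIV_cmult D DERIV_ident) (use t in auto)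
  moreover have "(\<tau> * ((\<tau> + 1) * p / t) * t - \<tau> * q * 1) / (t * t) = (\<tau> * (\<tau> + 1) * p - \<tau> * q) / t\<^sup>2" for p q
    using t by (simp add: power2_eq_square)
  ultimately show ?thesis unfolding s1_def[abs_def] s2_def by simp
qed

lemma W_derivs:
  assumes "(h has_real_derivative h1 t) (at t)" "(h1 has_real_derivative h2 t) (at t)" "0 < t" "t < 1"
  shows "(W c has_real_derivative W1 c t) (at t)" "(W1 c has_real_derivative W2 c t) (at t)"
proof -
  note S = s_deriv[OF assms(3,4)] s1_deriv[OF assms(3,4)]
  have "(W c has_real_derivative \<xi> * (h1 t * (1 + c * s t) + (0 + c * s1 t) * h t)) (at t)"
    unfolding W_def[abs_def] by (intro DERIV_cmult DERIV_mult DERIV_add DERIV_const S assms)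
  then show "(W c has_real_derivative W1 c t) (at t)" by (simp add: W1_def mult.commute)
  have "(W1 c has_real_derivative \<xi> * ((h2 t * (1 + c * s t) + (0 + c * s1 t) * h1 t) + (h1 t * (c * s1 t) + c * s2 t * h t))) (at t)"
    unfolding W1_def[abs_def] by (intro DERIV_cmult DERIV_mult DERIV_add DERIV_const S assms)
  moreover have "\<xi> * ((h2 t * (1 + c * s t) + (0 + c * s1 t) * h1 t) + (h1 t * (c * s1 t) + c * s2 t * h t)) = W2 c t"
    unfolding W2_def by (simp add: algebra_simps)
  ultimately show "(W1 c has_real_derivative W2 c t) (at t)" by simp
qed

lemma t_s1_rate: "((\<lambda>t. \<sigma> t * (t * s1 t)) \<longlongrightarrow> 0) (at_right 0)"
proof -
  have "((\<lambda>t. \<tau> * (1 / - ln t)) \<longlongrightarrow> \<tau> * 0) (at_right 0)" by (intro tendsto_intros inverse_minus_ln_0)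
  then have "((\<lambda>t. \<tau> * (1 / - ln t)) \<longlongrightarrow> 0) (at_right 0)" by simp
  then show ?thesis
  proof (rule Lim_transform_eventually)
    show "\<forall>\<^sub>F t in at_right 0. \<tau> * (1 / - ln t) = \<sigma> t * (t * s1 t)"
      using near0[OF zero_less_one]
    proof eventually_elim
      case (elim t)
      have "\<sigma> t * (- ln t) powr (- \<tau> - 1) = 1 / - ln t"
        using elim by (simp add: powr_minus_divide flip: powr_add)
      moreover have "\<sigma> t * (t * s1 t) = \<tau> * (\<sigma> t * (- ln t) powr (- \<tau> - 1))"
        using elim by (simp add: s1_def)
      ultimately show ?case by simp
    qed
  qed
qed

lemma t2_s2_rate: "((\<lambda>t. \<sigma> t * (t\<^sup>2 * s2 t)) \<longlongrightarrow> 0) (at_right 0)"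
proof -
  have "((\<lambda>t. \<tau> * (\<tau> + 1) * (1 / - ln t)\<^sup>2 - \<tau> * (1 / - ln t)) \<longlongrightarrow> \<tau> * (\<tau> + 1) * 0\<^sup>2 - \<tau> * 0) (at_right 0)"
    by (intro tendsto_intros inverse_minus_ln_0)
  then have "((\<lambda>t. \<tau> * (\<tau> + 1) * (1 / - ln t)\<^sup>2 - \<tau> * (1 / - ln t)) \<longlongrightarrow> 0) (at_right 0)" by simp
  then show ?thesis
  proof (rule Lim_transform_eventually)
    show "\<forall>\<^sub>F t in at_right 0. \<tau> * (\<tau> + 1) * (1 / - ln t)\<^sup>2 - \<tau> * (1 / - ln t) = \<sigma> t * (t\<^sup>2 * s2 t)"
      using near0[OF zero_less_one]
    proof eventually_elim
      case (elim t)
      have l: "- ln t > 0" using elim by simp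
      have "\<sigma> t * (- ln t) powr (- \<tau> - 1) = (- ln t) powr (- 1)" "\<sigma> t * (- ln t) powr (- \<tau> - 2) = (- ln t) powr (- 2)"
        by (simp_all flip: powr_add)
      moreover have "(- ln t) powr (- 1) = 1 / - ln t" using l by (simp add: powr_minus_divide)
      moreover have "(- ln t) powr (- 2) = (1 / - ln t)\<^sup>2" using l by (simp add: powr_minus_divide power_divide)
      ultimately have e: "\<sigma> t * (- ln t) powr (- \<tau> - 1) = 1 / - ln t" "\<sigma> t * (- ln t) powr (- \<tau> - 2) = (1 / - ln t)\<^sup>2"
        by simp_all
      have "\<sigma> t * (t\<^sup>2 * s2 t) = \<tau> * (\<tau> + 1) * (\<sigma> t * (- ln t) powr (- \<tau> - 2)) - \<tau> * (\<sigma> t * (- ln t) powr (- \<tau> - 1))"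
      proof -
        have "g * (t\<^sup>2 * ((\<tau> * (\<tau> + 1) * p - \<tau> * q) / t\<^sup>2)) = \<tau> * (\<tau> + 1) * (g * p) - \<tau> * (g * q)" for g p q
        proof -
          have "t\<^sup>2 * (x / t\<^sup>2) = x" for x using elim by simp
          then show ?thesis by (simp only:) (simp add: algebra_simps)
        qed
        then show ?thesis unfolding s2_def .
      qed
      then show ?case unfolding e by simp
    qed
  qed
qed

lemma one_plus_s_rate: "((\<lambda>t. \<sigma> t * ((1 + c * s t) - 1)) \<longlongrightarrow> c) (at_right 0)"
proof (rule Lim_transform_eventually[OF tendsto_const])
  show "\<forall>\<^sub>F t in at_right 0. c = \<sigma> t * ((1 + c * s t) - 1)"
    using near0[OF zero_less_one]
  proof eventually_elim
    case (elim t)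
    have "\<sigma> t * ((1 + c * s t) - 1) = c * (\<sigma> t * s t)" by simp
    then show ?case using \<sigma>_s elim by simp
  qed
qed

lemma one_plus_s_lim: "((\<lambda>t. 1 + c * s t) \<longlongrightarrow> 1) (at_right 0)"
  by (rule tendsto_if_rate[OF \<sigma>_at_top one_plus_s_rate])

lemma \<sigma>_t_power: "((\<lambda>t. \<sigma> t * t) \<longlongrightarrow> 0) (at_right 0)" "((\<lambda>t. \<sigma> t * t\<^sup>2) \<longlongrightarrow> 0) (at_right 0)"
proof -
  have "((\<lambda>t. \<sigma> t * t powr 1) \<longlongrightarrow> 0) (at_right 0)" by (rule log_rate_powr_0) simp
  then show 1: "((\<lambda>t. \<sigma> t * t) \<longlongrightarrow> 0) (at_right 0)"
    by (rule Lim_transform_eventually) (rule eventually_mono[OF near0[OF zero_less_one]], simp)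
  have "((\<lambda>t. \<sigma> t * t * t) \<longlongrightarrow> 0 * 0) (at_right 0)"
    by (intro tendsto_mult 1 tendsto_ident_at)
  then show "((\<lambda>t. \<sigma> t * t\<^sup>2) \<longlongrightarrow> 0) (at_right 0)" by (simp add: power2_eq_square mult.assoc)
qed

lemma kf_pos_ev: "\<forall>\<^sub>F t in at_right 0. 0 < t \<and> t < 1 \<and> h t > U1 \<and> f (h t) > 0 \<and> k t > 0 \<and> kf t > 0
   \<and> (h has_real_derivative h1 t) (at t) \<and> (h1 has_real_derivative h2 t) (at t)"
proof -
  obtain \<delta> where \<delta>: "0 < \<delta>" "\<delta> \<le> 1"
    "\<And>t. 0 < t \<Longrightarrow> t < \<delta> \<Longrightarrow> h t > U1 \<and> f (h t) > 0 \<and> k t > 0 \<and> kf t > 0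
      \<and> (h has_real_derivative h1 t) (at t) \<and> (h1 has_real_derivative h2 t) (at t)"
    using h_facts by metis
  show ?thesis using near0[OF \<delta>(1)]
    by eventually_elim (use \<delta> in force)
qed

text \<open>Only \<open>h2 * (1 + c * s)\<close> contributes: the terms with derivatives of \<open>s\<close> carry the factors
  \<open>t * s1\<close> and \<open>t\<^sup>2 * s2\<close>, which are smaller than \<open>s\<close> by a factor \<open>1 / (- ln t)\<close>.\<close>
lemma W2_rate: "((\<lambda>t. \<sigma> t * (W2 c t / (\<xi> * kf t) - A)) \<longlongrightarrow> a1 + A * c) (at_right 0)"
proof -
  let ?y = "\<lambda>t. K t * k' t / (k t)\<^sup>2"
  have y: "((\<lambda>t. \<sigma> t * (?y t - (1 - l1))) \<longlongrightarrow> - L) (at_right 0)"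
    using tendsto_minus[OF ratio_deriv_rate] by (rule Lim_transform_eventually) (simp add: algebra_simps)
  have q: "((\<lambda>t. \<sigma> t * (Q (h t) - \<rho> / (\<rho> + 2))) \<longlongrightarrow> \<kappa> * (2 * lstar / (\<rho> + 2)\<^sup>2)) (at_right 0)"
    unfolding \<kappa>_def by (rule rate_transfer[OF Q_rate h_at_top ln_h_lim])
  have A_eq: "A = 1 - (1 - l1) * (\<rho> / (\<rho> + 2))" using \<rho>_pos by (simp add: A_def field_simps)
  have "((\<lambda>t. - (\<sigma> t * (?y t * Q (h t) - (1 - l1) * (\<rho> / (\<rho> + 2))))) \<longlongrightarrow>
      - (- L * (\<rho> / (\<rho> + 2)) + (1 - l1) * (\<kappa> * (2 * lstar / (\<rho> + 2)\<^sup>2)))) (at_right 0)"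
    by (intro tendsto_minus rate_mult[OF \<sigma>_at_top y q])
  moreover have "- (g * (z - (1 - l1) * (\<rho> / (\<rho> + 2)))) = g * ((1 - z) - A)" for g z
    unfolding A_eq by (simp only: right_diff_distrib)
  ultimately have E: "((\<lambda>t. \<sigma> t * ((1 - ?y t * Q (h t)) - A)) \<longlongrightarrow> a1) (at_right 0)"
    unfolding a1_def by simp
  have "((\<lambda>t. \<sigma> t * ((1 - ?y t * Q (h t)) * (1 + c * s t) - A * 1)
      + 2 * c * ((h1 t / kf t / t) * (\<sigma> t * (t * s1 t))) + c * ((h t / kf t / t\<^sup>2) * (\<sigma> t * (t\<^sup>2 * s2 t))))
     \<longlongrightarrow> (a1 * 1 + A * c) + 2 * c * (- (\<rho> / (\<rho> + 2) * l1) * 0) + c * (\<rho> / 2 * (\<rho> / (\<rho> + 2)) * l1\<^sup>2 * 0)) (at_right 0)"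
    by (intro tendsto_add tendsto_mult tendsto_const rate_mult[OF \<sigma>_at_top E one_plus_s_rate] h1_lim h_lim t_s1_rate t2_s2_rate)
  then have "((\<lambda>t. \<sigma> t * ((1 - ?y t * Q (h t)) * (1 + c * s t) - A * 1)
      + 2 * c * ((h1 t / kf t / t) * (\<sigma> t * (t * s1 t))) + c * ((h t / kf t / t\<^sup>2) * (\<sigma> t * (t\<^sup>2 * s2 t))))
     \<longlongrightarrow> a1 + A * c) (at_right 0)" by simp
  then show ?thesis
  proof (rule Lim_transform_eventually)
    show "\<forall>\<^sub>F t in at_right 0. \<sigma> t * ((1 - ?y t * Q (h t)) * (1 + c * s t) - A * 1)
      + 2 * c * ((h1 t / kf t / t) * (\<sigma> t * (t * s1 t))) + c * ((h t / kf t / t\<^sup>2) * (\<sigma> t * (t\<^sup>2 * s2 t)))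
      = \<sigma> t * (W2 c t / (\<xi> * kf t) - A)"
      using kf_pos_ev
    proof eventually_elim
      case (elim t)
      have gen: "g * (e * v - A * 1) + 2 * c * ((p / k / t) * (g * (t * x))) + c * ((w / k / t\<^sup>2) * (g * (t\<^sup>2 * z)))
         = g * (\<xi> * (k * e * v + 2 * (p * (c * x)) + w * (c * z)) / (\<xi> * k) - A)"
        if "k > 0" "t > 0" for g e v p k t x w z :: real
        using that \<xi>_pos by (simp add: add_divide_distrib algebra_simps)
      show ?case unfolding W2_def h2_def by (rule gen) (use elim in auto)
    qed
  qed
qed

lemma W_over_h: "0 < h t \<Longrightarrow> W c t / h t = \<xi> * (1 + c * s t)"
  by (simp add: W_def)

lemma W_ratio_lim: "((\<lambda>t. \<xi> * (1 + c * s t)) \<longlongrightarrow> \<xi>) (at_right 0)"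
  using tendsto_mult[OF tendsto_const[of \<xi>] one_plus_s_lim[of c]] by simp

lemma W_at_top: "filterlim (W c) at_top (at_right 0)"
proof -
  have "filterlim (\<lambda>t. \<xi> * (1 + c * s t) * h t) at_top (at_right 0)"
    by (rule filterlim_tendsto_pos_mult_at_top[OF W_ratio_lim \<xi>_pos h_at_top])
  then show ?thesis by (simp add: W_def[abs_def] mult_ac)
qed

text \<open>By \<open>f_ratio_mvt\<close> the logarithm of \<open>f (W c t) / f (h t)\<close> is \<open>(\<rho> + 1 + \<phi> (v t)) * ln (W c t / h t)\<close>
  with \<open>v t\<close> between \<open>h t\<close> and \<open>W c t\<close>.  These two are proportional in the limit, so \<open>ln (v t)\<close> and
  \<open>ln (h t)\<close> differ by a bounded amount and \<open>rate_transfer\<close> applies to \<open>v\<close>.\<close>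
lemma fW_rate: "((\<lambda>t. \<sigma> t * (f (W c t) / (\<xi> * f (h t)) - A)) \<longlongrightarrow> A * (\<kappa> * lstar * ln \<xi> + (\<rho> + 1) * c)) (at_right 0)"
proof -
  let ?r = "\<lambda>t. \<xi> * (1 + c * s t)"
  let ?P = "\<lambda>t w. min (h t) (W c t) \<le> w \<and> w \<le> max (h t) (W c t) \<and> f (W c t) / f (h t) = exp ((\<rho> + 1 + \<phi> w) * ln (W c t / h t))"
  have big: "\<forall>\<^sub>F t in at_right 0. h t > max B 1 \<and> W c t > max B 1"
    by (intro eventually_conj filterlim_at_top_dense[THEN iffD1, OF h_at_top, rule_format]
        filterlim_at_top_dense[THEN iffD1, OF W_at_top, rule_format])
  define v where "v t = (SOME w. ?P t w)" for t
  have v: "?P t (v t)" if "h t > max B 1 \<and> W c t > max B 1" for t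
  proof -
    have "h t > B" "W c t > B" using that by auto
    then have "\<exists>w. ?P t w" using f_ratio_mvt[of "h t" "W c t"] by metis
    then show ?thesis unfolding v_def by (rule someI_ex)
  qed
  have v_top: "filterlim v at_top (at_right 0)"
    unfolding filterlim_at_top
  proof
    fix Z
    have "\<forall>\<^sub>F t in at_right 0. Z \<le> h t" "\<forall>\<^sub>F t in at_right 0. Z \<le> W c t"
      using h_at_top W_at_top by (auto simp: filterlim_at_top)
    with big show "\<forall>\<^sub>F t in at_right 0. Z \<le> v t"
      by eventually_elim (use v in \<open>meson min.boundedI order_trans\<close>)
  qed
  have lr: "((\<lambda>t. ln (?r t)) \<longlongrightarrow> ln \<xi>) (at_right 0)"
    by (intro tendsto_ln W_ratio_lim) (use \<xi>_pos in simp)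
  have "((\<lambda>t. (ln (v t) - ln (h t)) * (1 / - ln t)) \<longlongrightarrow> 0) (at_right 0)"
  proof (rule Lim_null_comparison)
    have "((\<lambda>t. \<bar>ln (?r t)\<bar> * (1 / - ln t)) \<longlongrightarrow> \<bar>ln \<xi>\<bar> * 0) (at_right 0)"
      by (intro tendsto_mult tendsto_rabs lr inverse_minus_ln_0)
    then show "((\<lambda>t. \<bar>ln (?r t)\<bar> * (1 / - ln t)) \<longlongrightarrow> 0) (at_right 0)" by simp
    show "\<forall>\<^sub>F t in at_right 0. norm ((ln (v t) - ln (h t)) * (1 / - ln t)) \<le> \<bar>ln (?r t)\<bar> * (1 / - ln t)"
      using big near0[OF zero_less_one]
    proof eventually_elim
      case (elim t)
      have p: "h t > 0" "W c t > 0" "v t > 0" using elim(1) v[OF elim(1)] by auto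
      have "ln (?r t) = ln (W c t) - ln (h t)"
        using W_over_h[OF p(1), of c] ln_divide_pos[OF p(2,1)] by simp
      moreover have "ln (min (h t) (W c t)) \<le> ln (v t)" "ln (v t) \<le> ln (max (h t) (W c t))"
        using p v[OF elim(1)] by (auto simp del: ln_le_cancel_iff intro!: ln_mono)
      ultimately have "\<bar>ln (v t) - ln (h t)\<bar> \<le> \<bar>ln (?r t)\<bar>"
        by (auto simp: min_def max_def split: if_splits)
      moreover have "1 / - ln t > 0" using elim(2) by simp
      ultimately show ?case by (simp only: real_norm_def abs_mult abs_of_pos) (rule mult_right_mono, auto)
    qed
  qed
  from tendsto_add[OF ln_h_lim this]
  have lim: "((\<lambda>t. ln (h t) / - ln t + (ln (v t) - ln (h t)) * (1 / - ln t)) \<longlongrightarrow> 2 / (\<rho> * l1) + 0) (at_right 0)" .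
  have "p / m + (q - p) * (1 / m) = q / m" for p q m :: real by (simp add: diff_divide_distrib)
  with lim have "((\<lambda>t. ln (v t) / - ln t) \<longlongrightarrow> 2 / (\<rho> * l1)) (at_right 0)"
    by (simp only: add_0_right)
  then have \<phi>v: "((\<lambda>t. \<sigma> t * \<phi> (v t)) \<longlongrightarrow> \<kappa> * lstar) (at_right 0)"
    unfolding \<kappa>_def by (rule rate_transfer[OF \<phi>_rate v_top])
  have x: "((\<lambda>t. \<sigma> t * ((\<rho> + 1 + \<phi> (v t)) - (\<rho> + 1))) \<longlongrightarrow> \<kappa> * lstar) (at_right 0)"
    using \<phi>v by simp
  have "((\<lambda>t. \<xi> * (\<sigma> t * ((1 + c * s t) - 1))) \<longlongrightarrow> \<xi> * c) (at_right 0)"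
    by (intro tendsto_mult tendsto_const one_plus_s_rate)
  moreover have "\<xi> * (g * (y - 1)) = g * (\<xi> * y - \<xi>)" for g y by (simp add: algebra_simps)
  ultimately have "((\<lambda>t. \<sigma> t * (?r t - \<xi>)) \<longlongrightarrow> \<xi> * c) (at_right 0)" by (simp only:)
  from rate_compose[OF \<sigma>_at_top this, of ln "1 / \<xi>"]
  have y: "((\<lambda>t. \<sigma> t * (ln (?r t) - ln \<xi>)) \<longlongrightarrow> c) (at_right 0)"
    using \<xi>_pos DERIV_ln_divide[OF \<xi>_pos] by simp
  have "((\<lambda>t. \<sigma> t * ((\<rho> + 1 + \<phi> (v t)) * ln (?r t) - (\<rho> + 1) * ln \<xi>)) \<longlongrightarrow> \<kappa> * lstar * ln \<xi> + (\<rho> + 1) * c) (at_right 0)"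
    by (rule rate_mult[OF \<sigma>_at_top x y])
  from rate_compose[OF \<sigma>_at_top this DERIV_exp]
  have "((\<lambda>t. \<sigma> t * (exp ((\<rho> + 1 + \<phi> (v t)) * ln (?r t)) - \<xi> * A) / \<xi>)
      \<longlongrightarrow> (\<xi> * A) * (\<kappa> * lstar * ln \<xi> + (\<rho> + 1) * c) / \<xi>) (at_right 0)"
    unfolding \<xi>_powr using \<xi>_pos by (intro tendsto_divide tendsto_const) auto
  then have "((\<lambda>t. \<sigma> t * (exp ((\<rho> + 1 + \<phi> (v t)) * ln (?r t)) - \<xi> * A) / \<xi>)
      \<longlongrightarrow> A * (\<kappa> * lstar * ln \<xi> + (\<rho> + 1) * c)) (at_right 0)" using \<xi>_pos by simp
  then show ?thesis
  proof (rule Lim_transform_eventually)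
    show "\<forall>\<^sub>F t in at_right 0. \<sigma> t * (exp ((\<rho> + 1 + \<phi> (v t)) * ln (?r t)) - \<xi> * A) / \<xi>
        = \<sigma> t * (f (W c t) / (\<xi> * f (h t)) - A)"
      using big
    proof eventually_elim
      case (elim t)
      have p: "h t > 0" using elim by auto
      have e: "f (W c t) / f (h t) = exp ((\<rho> + 1 + \<phi> (v t)) * ln (?r t))"
        using v[OF elim] W_over_h[OF p, of c] by simp
      have gen: "g * (z - \<xi> * A) / \<xi> = g * (z / \<xi> - A)" for g z using \<xi>_pos by (simp add: field_simps)
      have "f (W c t) / (\<xi> * f (h t)) = (f (W c t) / f (h t)) / \<xi>" by simp
      then show ?case unfolding e by (simp only: gen)
    qed
  qed
qed

lemma W1_lim: "((\<lambda>t. W1 c t / (\<xi> * kf t) / t) \<longlongrightarrow> - (\<rho> / (\<rho> + 2) * l1)) (at_right 0)"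
proof -
  have ts1: "((\<lambda>t. t * s1 t) \<longlongrightarrow> 0) (at_right 0)" by (rule tendsto_0_if_rate[OF \<sigma>_at_top t_s1_rate])
  have "((\<lambda>t. (h1 t / kf t / t) * (1 + c * s t) + c * ((h t / kf t / t\<^sup>2) * (t * s1 t)))
    \<longlongrightarrow> - (\<rho> / (\<rho> + 2) * l1) * 1 + c * (\<rho> / 2 * (\<rho> / (\<rho> + 2)) * l1\<^sup>2 * 0)) (at_right 0)"
    by (intro tendsto_add tendsto_mult tendsto_const one_plus_s_lim h1_lim h_lim ts1)
  then have "((\<lambda>t. (h1 t / kf t / t) * (1 + c * s t) + c * ((h t / kf t / t\<^sup>2) * (t * s1 t)))
    \<longlongrightarrow> - (\<rho> / (\<rho> + 2) * l1)) (at_right 0)" by simp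
  then show ?thesis
  proof (rule Lim_transform_eventually)
    show "\<forall>\<^sub>F t in at_right 0. (h1 t / kf t / t) * (1 + c * s t) + c * ((h t / kf t / t\<^sup>2) * (t * s1 t)) = W1 c t / (\<xi> * kf t) / t"
      using kf_pos_ev
    proof eventually_elim
      case (elim t)
      have gen: "(p / k / t) * v + c * ((w / k / t\<^sup>2) * (t * x)) = \<xi> * (p * v + w * (c * x)) / (\<xi> * k) / t"
        if "t > 0" "k > 0" for p k t v w x :: real
        using that \<xi>_pos by (simp add: add_divide_distrib power2_eq_square)
      show ?case unfolding W1_def by (rule gen) (use elim in auto)
    qed
  qed
qed

lemma W_lim: "((\<lambda>t. W c t / (\<xi> * kf t) / t\<^sup>2) \<longlongrightarrow> \<rho> / 2 * (\<rho> / (\<rho> + 2)) * l1\<^sup>2) (at_right 0)"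
proof -
  have "((\<lambda>t. (h t / kf t / t\<^sup>2) * (1 + c * s t)) \<longlongrightarrow> \<rho> / 2 * (\<rho> / (\<rho> + 2)) * l1\<^sup>2 * 1) (at_right 0)"
    by (intro tendsto_mult one_plus_s_lim h_lim)
  moreover have "(h t / kf t / t\<^sup>2) * (1 + c * s t) = W c t / (\<xi> * kf t) / t\<^sup>2" for t
    unfolding W_def using \<xi>_pos by simp
  ultimately show ?thesis by simp
qed

lemma W1_W_rate:
  "((\<lambda>t. \<sigma> t * (W1 c t / (\<xi> * kf t))) \<longlongrightarrow> 0) (at_right 0)"
  "((\<lambda>t. \<sigma> t * (W c t / (\<xi> * kf t))) \<longlongrightarrow> 0) (at_right 0)"
proof -
  have "((\<lambda>t. (\<sigma> t * t) * (W1 c t / (\<xi> * kf t) / t)) \<longlongrightarrow> 0 * - (\<rho> / (\<rho> + 2) * l1)) (at_right 0)"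
    "((\<lambda>t. (\<sigma> t * t\<^sup>2) * (W c t / (\<xi> * kf t) / t\<^sup>2)) \<longlongrightarrow> 0 * (\<rho> / 2 * (\<rho> / (\<rho> + 2)) * l1\<^sup>2)) (at_right 0)"
    by (intro tendsto_mult \<sigma>_t_power W1_lim W_lim)+
  then have *: "((\<lambda>t. (\<sigma> t * t) * (W1 c t / (\<xi> * kf t) / t)) \<longlongrightarrow> 0) (at_right 0)"
    "((\<lambda>t. (\<sigma> t * t\<^sup>2) * (W c t / (\<xi> * kf t) / t\<^sup>2)) \<longlongrightarrow> 0) (at_right 0)" by simp_all
  have cancel: "(g * x) * (y / x) = g * y" if "x \<noteq> 0" for g x y :: real using that by simp
  show "((\<lambda>t. \<sigma> t * (W1 c t / (\<xi> * kf t))) \<longlongrightarrow> 0) (at_right 0)"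
    by (rule Lim_transform_eventually[OF *(1)], rule eventually_mono[OF near0[OF zero_less_one]], rule cancel) simp
  show "((\<lambda>t. \<sigma> t * (W c t / (\<xi> * kf t))) \<longlongrightarrow> 0) (at_right 0)"
    by (rule Lim_transform_eventually[OF *(2)], rule eventually_mono[OF near0[OF zero_less_one]], rule cancel) simp
qed

text \<open>The key computation.  The coefficients \<open>c1\<close>, \<open>c2\<close>, \<open>c3\<close> stand for the curvature of the boundary,
  the linear term of the equation and the error in the weight; none of them survives in the limit.\<close>
lemma ansatz_defect_rate:
  assumes "\<theta> > 0"
  shows "((\<lambda>t. \<sigma> t * ((W2 c t + c1 * W1 c t + c2 * W c t - (1 + c3 * t powr \<theta>) * ((k t)\<^sup>2 * f (W c t))) / (\<xi> * kf t)))
    \<longlongrightarrow> \<rho> * A * (chi - c)) (at_right 0)"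
proof -
  have fW: "((\<lambda>t. f (W c t) / (\<xi> * f (h t))) \<longlongrightarrow> A) (at_right 0)"
    by (rule tendsto_if_rate[OF \<sigma>_at_top fW_rate])
  have "((\<lambda>t. \<sigma> t * (W2 c t / (\<xi> * kf t) - A) + c1 * (\<sigma> t * (W1 c t / (\<xi> * kf t))) + c2 * (\<sigma> t * (W c t / (\<xi> * kf t)))
      - \<sigma> t * (f (W c t) / (\<xi> * f (h t)) - A) - c3 * ((\<sigma> t * t powr \<theta>) * (f (W c t) / (\<xi> * f (h t)))))
    \<longlongrightarrow> (a1 + A * c) + c1 * 0 + c2 * 0 - A * (\<kappa> * lstar * ln \<xi> + (\<rho> + 1) * c) - c3 * (0 * A)) (at_right 0)"
    by (intro tendsto_add tendsto_diff tendsto_mult tendsto_const W2_rate W1_W_rate fW_rate fW log_rate_powr_0[OF assms])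
  also have "(a1 + A * c) + c1 * 0 + c2 * 0 - A * (\<kappa> * lstar * ln \<xi> + (\<rho> + 1) * c) - c3 * (0 * A) = \<rho> * A * (chi - c)"
  proof -
    have "\<rho> * A * chi = a1 - A * (\<kappa> * lstar * ln \<xi>)"
    proof -
      have "\<rho> * A * ((a1 / A - y) / \<rho>) = a1 - A * y" for y
        using \<rho>_pos A_pos by (simp add: field_simps)
      then show ?thesis unfolding chi_def .
    qed
    then show ?thesis by (simp add: algebra_simps)
  qed
  finally show ?thesis
  proof (rule Lim_transform_eventually)
    show "\<forall>\<^sub>F t in at_right 0. \<sigma> t * (W2 c t / (\<xi> * kf t) - A) + c1 * (\<sigma> t * (W1 c t / (\<xi> * kf t))) + c2 * (\<sigma> t * (W c t / (\<xi> * kf t)))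
      - \<sigma> t * (f (W c t) / (\<xi> * f (h t)) - A) - c3 * ((\<sigma> t * t powr \<theta>) * (f (W c t) / (\<xi> * f (h t))))
      = \<sigma> t * ((W2 c t + c1 * W1 c t + c2 * W c t - (1 + c3 * t powr \<theta>) * ((k t)\<^sup>2 * f (W c t))) / (\<xi> * kf t))"
      using kf_pos_ev
    proof eventually_elim
      case (elim t)
      have e: "f (W c t) / (\<xi> * f (h t)) = ((k t)\<^sup>2 * f (W c t)) / (\<xi> * kf t)"
        using elim by (simp add: kf_def)
      have gen: "g * (x2 / d - A) + c1 * (g * (x1 / d)) + c2 * (g * (x / d)) - g * (y / d - A) - c3 * ((g * z) * (y / d))
         = g * ((x2 + c1 * x1 + c2 * x - (1 + c3 * z) * y) / d)" for g x2 d x1 x y z :: real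
        by (simp add: add_divide_distrib diff_divide_distrib algebra_simps)
      show ?case unfolding e by (rule gen)
    qed
  qed
qed

lemma ansatz_regular:
  "\<forall>\<^sub>F t in at_right 0. 0 < W c t \<and> (W c has_real_derivative W1 c t) (at t) \<and> (W1 c has_real_derivative W2 c t) (at t) \<and> W1 c t \<le> 0"
proof -
  have "\<forall>\<^sub>F t in at_right 0. W1 c t / (\<xi> * kf t) / t < 0"
    using \<rho>_pos l1_pos by (intro order_tendstoD(2)[OF W1_lim]) simp
  moreover have "\<forall>\<^sub>F t in at_right 0. 0 < W c t"
    using filterlim_at_top_dense[THEN iffD1, OF W_at_top] by blast
  ultimately show ?thesis using kf_pos_ev
  proof eventually_elim
    case (elim t)
    then have "\<xi> * kf t > 0" "t > 0" using \<xi>_pos by auto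
    moreover have "x \<le> 0" if "x / d / t < 0" "d > 0" "t > 0" for x d t :: real
      using that by (metis divide_nonneg_pos le_less linorder_not_less)
    ultimately have "W1 c t \<le> 0" using elim(1) by blast
    then show ?case using elim W_derivs[of t c] by auto
  qed
qed

lemma ansatz_supersolution:
  assumes "c > chi" "\<theta> > 0"
  shows "\<forall>\<^sub>F t in at_right 0. W2 c t - c1 * W1 c t + c2 * W c t \<le> (1 - c3 * t powr \<theta>) * ((k t)\<^sup>2 * f (W c t))"
proof -
  have "\<rho> * A * (chi - c) < 0" using assms(1) \<rho>_pos A_pos by (simp add: mult_pos_neg)
  from order_tendstoD(2)[OF ansatz_defect_rate[OF assms(2), of c "- c1" c2 "- c3"] this]
  show ?thesis using kf_pos_ev
  proof eventually_elim
    case (elim t)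
    have "\<xi> * kf t > 0" "\<sigma> t > 0" using elim(2) \<xi>_pos by auto
    moreover have "z < 0" if "g * (z / d) < 0" "d > 0" "g > 0" for g z d :: real
      using that by (simp add: mult_less_0_iff divide_less_0_iff)
    ultimately have "W2 c t + - c1 * W1 c t + c2 * W c t - (1 + - c3 * t powr \<theta>) * ((k t)\<^sup>2 * f (W c t)) < 0"
      using elim(1) by blast
    then show ?case by simp
  qed
qed

lemma ansatz_subsolution:
  assumes "c < chi" "\<theta> > 0"
  shows "\<forall>\<^sub>F t in at_right 0. (1 + c3 * t powr \<theta>) * ((k t)\<^sup>2 * f (W c t)) + c2 * W c t \<le> W2 c t + c1 * W1 c t"
proof -
  have "\<rho> * A * (chi - c) > 0" using assms(1) \<rho>_pos A_pos by simp
  from order_tendstoD(1)[OF ansatz_defect_rate[OF assms(2), of c c1 "- c2" c3] this]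
  show ?thesis using kf_pos_ev
  proof eventually_elim
    case (elim t)
    have "\<xi> * kf t > 0" "\<sigma> t > 0" using elim(2) \<xi>_pos by auto
    moreover have "0 < z" if "0 < g * (z / d)" "d > 0" "g > 0" for g z d :: real
      using that by (simp add: zero_less_mult_iff zero_less_divide_iff)
    ultimately have "0 < W2 c t + c1 * W1 c t + - c2 * W c t - (1 + c3 * t powr \<theta>) * ((k t)\<^sup>2 * f (W c t))"
      using elim(1) by blast
    then show ?case by simp
  qed
qed

lemma linear_term_dominated:
  assumes "\<theta> > 0"
  shows "\<forall>\<^sub>F t in at_right 0. c2 * W c t \<le> (1 - c3 * t powr \<theta>) * ((k t)\<^sup>2 * f (W c t))"
proof -
  have fW: "((\<lambda>t. f (W c t) / (\<xi> * f (h t))) \<longlongrightarrow> A) (at_right 0)"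
    by (rule tendsto_if_rate[OF \<sigma>_at_top fW_rate])
  have w: "((\<lambda>t. W c t / (\<xi> * kf t)) \<longlongrightarrow> 0) (at_right 0)" by (rule tendsto_0_if_rate[OF \<sigma>_at_top W1_W_rate(2)])
  have th: "((\<lambda>t. t powr \<theta>) \<longlongrightarrow> 0) (at_right 0)" by (rule tendsto_0_if_rate[OF \<sigma>_at_top log_rate_powr_0[OF assms]])
  have "((\<lambda>t. (1 - c3 * t powr \<theta>) * (f (W c t) / (\<xi> * f (h t))) - c2 * (W c t / (\<xi> * kf t))) \<longlongrightarrow> (1 - c3 * 0) * A - c2 * 0) (at_right 0)"
    by (intro tendsto_diff tendsto_mult tendsto_const fW w th)
  then have "((\<lambda>t. (1 - c3 * t powr \<theta>) * (f (W c t) / (\<xi> * f (h t))) - c2 * (W c t / (\<xi> * kf t))) \<longlongrightarrow> A) (at_right 0)" by simp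
  from order_tendstoD(1)[OF this A_pos] show ?thesis using kf_pos_ev
  proof eventually_elim
    case (elim t)
    have e: "f (W c t) / (\<xi> * f (h t)) = ((k t)\<^sup>2 * f (W c t)) / (\<xi> * kf t)"
      using elim by (simp add: kf_def)
    have "\<xi> * kf t > 0" using elim(2) \<xi>_pos by auto
    moreover have "x * (y / d) - c2 * (w / d) = (x * y - c2 * w) / d" for x y w d :: real
      by (simp add: diff_divide_distrib)
    moreover have "0 < z" if "0 < z / d" "d > 0" for z d :: real using that by (simp add: zero_less_divide_iff)
    ultimately have "0 < (1 - c3 * t powr \<theta>) * ((k t)\<^sup>2 * f (W c t)) - c2 * W c t"
      using elim(1) unfolding e by metis
    then show ?case by simp
  qed
qed

end

section \<open>The classes of nonlinearities and weights\<close>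

lemma powr_times_ln_powr_0: "p < 0 \<Longrightarrow> V > 0 \<Longrightarrow> ((\<lambda>u::real. ln u powr \<tau> * (M * (u / V) powr p)) \<longlongrightarrow> 0) at_top"
  by real_asymp

lemma inverse_times_ln_powr_0: "((\<lambda>u::real. ln u powr \<tau> * (1 / u)) \<longlongrightarrow> 0) at_top"
  by real_asymp

text \<open>Regular variation at the factor \<open>2\<close> gives \<open>g (2 * u) \<le> 2 powr (\<eta> / 2) * g u\<close> for large \<open>u\<close>.
  Iterating this from a compact interval, on which the continuous function \<open>g\<close> is bounded, yields
  \<open>g u = O(u powr (\<eta> / 2))\<close>.\<close>
lemma regularly_varying_neg_log_rate:
  fixes g :: "real \<Rightarrow> real"
  assumes "regularly_varying \<eta> g" "\<eta> < 0" and cont: "continuous_on {B..} g"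
  shows "((\<lambda>u. ln u powr \<tau> * g u) \<longlongrightarrow> 0) at_top"
proof -
  obtain A where A: "\<And>u. u \<ge> A \<Longrightarrow> g u > 0" using assms(1) unfolding regularly_varying_def by auto
  have "((\<lambda>u. g (2 * u) / g u) \<longlongrightarrow> 2 powr \<eta>) at_top"
    using assms(1) unfolding regularly_varying_def by simp
  moreover have "2 powr \<eta> < (2::real) powr (\<eta> / 2)" using assms(2) by simp
  ultimately have "\<forall>\<^sub>F u in at_top. g (2 * u) / g u < 2 powr (\<eta> / 2)" by (rule order_tendstoD)
  then obtain V where V: "\<And>u. u \<ge> V \<Longrightarrow> g (2 * u) / g u < 2 powr (\<eta> / 2)"
    unfolding eventually_at_top_linorder by blast
  define U where "U = max (max A V) (max B 1)"
  have U: "U \<ge> A" "U \<ge> V" "U \<ge> B" "U \<ge> 1" by (auto simp: U_def)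
  have step: "g (2 * u) \<le> 2 powr (\<eta> / 2) * g u" if "u \<ge> U" for u
    using V[of u] A[of u] U that by (simp add: pos_divide_less_eq)
  have "compact (g ` {U..2 * U})"
    by (rule compact_continuous_image[OF continuous_on_subset[OF cont]]) (use U in auto)
  then have "bounded (g ` {U..2 * U})" by (rule compact_imp_bounded)
  then obtain M where "\<forall>u\<in>{U..2 * U}. \<bar>g u\<bar> \<le> M" unfolding bounded_iff by auto
  then have M: "U \<le> u \<Longrightarrow> u \<le> 2 * U \<Longrightarrow> \<bar>g u\<bar> \<le> M" for u by auto
  have M0: "M \<ge> 0" using M[of U] U by auto
  let ?B = "\<lambda>u. M * (u / (2 * U)) powr (\<eta> / 2)"
  have main: "U \<le> u \<Longrightarrow> u \<le> 2 ^ n * (2 * U) \<Longrightarrow> g u \<le> ?B u" for n u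
  proof (induction n arbitrary: u)
    case 0
    have "(u / (2 * U)) powr (\<eta> / 2) \<ge> 1 powr (\<eta> / 2)"
      using 0 U assms(2) by (intro powr_mono2') (auto simp: field_simps)
    then have "M * 1 \<le> ?B u" using M0 by (intro mult_left_mono) auto
    then show ?case using M[of u] 0 by auto
  next
    case (Suc n)
    show ?case
    proof (cases "u \<le> 2 * U")
      case True
      have "1 * (2 * U) \<le> 2 ^ n * (2 * U)" using U by (intro mult_right_mono one_le_power) auto
      then show ?thesis using Suc.IH[OF Suc.prems(1)] True by linarith
    next
      case False
      define v where "v = u / 2"
      have v: "U \<le> v" "v \<le> 2 ^ n * (2 * U)" "u = 2 * v" using False Suc.prems by (auto simp: v_def)
      have "g u \<le> 2 powr (\<eta> / 2) * g v" using step[OF v(1)] v(3) by simp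
      also have "\<dots> \<le> 2 powr (\<eta> / 2) * ?B v" using Suc.IH[OF v(1,2)] by (intro mult_left_mono) auto
      also have "\<dots> = M * (2 powr (\<eta> / 2) * (v / (2 * U)) powr (\<eta> / 2))" by simp
      also have "2 powr (\<eta> / 2) * (v / (2 * U)) powr (\<eta> / 2) = (2 * (v / (2 * U))) powr (\<eta> / 2)"
        by (rule powr_mult[symmetric])
      finally show ?thesis by (simp add: v(3))
    qed
  qed
  have bound: "g u \<le> ?B u" if "u \<ge> U" for u
  proof -
    obtain n where "u / (2 * U) < 2 ^ n" using real_arch_pow[of 2 "u / (2 * U)"] by auto
    then have "u \<le> 2 ^ n * (2 * U)" using U by (simp add: pos_divide_less_eq)
    then show ?thesis by (rule main[OF that])
  qed
  have lim: "((\<lambda>u. ln u powr \<tau> * ?B u) \<longlongrightarrow> 0) at_top"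
    by (rule powr_times_ln_powr_0) (use assms(2) U in auto)
  show ?thesis
  proof (rule tendsto_sandwich[OF _ _ tendsto_const lim])
    show "\<forall>\<^sub>F u in at_top. 0 \<le> ln u powr \<tau> * g u"
      using eventually_ge_at_top[of U]
    proof eventually_elim
      case (elim u)
      have "g u > 0" using A[of u] U elim by simp
      then show ?case by simp
    qed
    show "\<forall>\<^sub>F u in at_top. ln u powr \<tau> * g u \<le> ln u powr \<tau> * ?B u"
      using eventually_ge_at_top[of U] by eventually_elim (intro mult_left_mono bound, auto)
  qed
qed

lemma class_F_log_rate:
  assumes "class_F \<rho> \<eta> f" "\<eta> < 0"
  obtains \<phi> where "karamata_form \<rho> f \<phi>" "((\<lambda>u. ln u powr \<tau> * \<phi> u) \<longlongrightarrow> 0) at_top"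
proof -
  obtain \<phi> where \<phi>: "karamata_form \<rho> f \<phi>" "regularly_varying \<eta> \<phi> \<or> regularly_varying \<eta> (\<lambda>u. - \<phi> u)"
    using assms(1) unfolding class_F_def by blast
  obtain B where B: "continuous_on {B..} \<phi>" using \<phi>(1) unfolding karamata_form_def by blast
  from \<phi>(2) have "((\<lambda>u. ln u powr \<tau> * \<phi> u) \<longlongrightarrow> 0) at_top"
  proof
    assume "regularly_varying \<eta> \<phi>"
    then show ?thesis by (rule regularly_varying_neg_log_rate[OF _ assms(2) B])
  next
    assume "regularly_varying \<eta> (\<lambda>u. - \<phi> u)"
    then have "((\<lambda>u. ln u powr \<tau> * - \<phi> u) \<longlongrightarrow> 0) at_top"
      by (rule regularly_varying_neg_log_rate[OF _ assms(2) continuous_on_minus[OF B]])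
    then have "((\<lambda>u. - (ln u powr \<tau> * - \<phi> u)) \<longlongrightarrow> - 0) at_top" by (rule tendsto_minus)
    then show ?thesis by simp
  qed
  with \<phi>(1) show ?thesis by (rule that)
qed

lemma karamata_form_deriv:
  assumes "karamata_form \<rho> f \<phi>"
  obtains B where "B > 0" "\<And>u. u > B \<Longrightarrow> (f has_real_derivative f u * (\<rho> + 1 + \<phi> u) / u) (at u)"
proof -
  obtain B C where B: "B > 0" "C > 0" "continuous_on {B..} \<phi>"
    "\<And>u. u \<ge> B \<Longrightarrow> f u = C * u powr (\<rho> + 1) * exp (integral {B..u} (\<lambda>t. \<phi> t / t))"
    using assms unfolding karamata_form_def by blast
  let ?g = "\<lambda>u. C * u powr (\<rho> + 1) * exp (integral {B..u} (\<lambda>t. \<phi> t / t))"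
  show ?thesis
  proof (rule that[OF B(1)])
    fix u assume u: "u > B"
    have u0: "u > 0" using u B(1) by simp
    have "((\<lambda>x. integral {B..x} (\<lambda>t. \<phi> t / t)) has_real_derivative \<phi> u / u) (at u within {B..u + 1})"
      using u B(1) by (intro integral_has_real_derivative continuous_on_divide continuous_on_subset[OF B(3)] continuous_on_id) auto
    moreover have "at u within {B..u + 1} = at u"
      using u by (intro at_within_interior) (auto simp: interior_atLeastAtMost_real)
    ultimately have D: "((\<lambda>x. integral {B..x} (\<lambda>t. \<phi> t / t)) has_real_derivative \<phi> u / u) (at u)" by simp
    have P: "((\<lambda>x. x powr (\<rho> + 1)) has_real_derivative (\<rho> + 1) * u powr (\<rho> + 1 - 1)) (at u)"
      using u0 by (rule has_real_derivative_powr)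
    have "(?g has_real_derivative C * ((\<rho> + 1) * u powr (\<rho> + 1 - 1)) * exp (integral {B..u} (\<lambda>t. \<phi> t / t))
       + exp (integral {B..u} (\<lambda>t. \<phi> t / t)) * (\<phi> u / u) * (C * u powr (\<rho> + 1))) (at u)"
      by (intro DERIV_mult DERIV_cmult P DERIV_chain2[where f=exp and g="\<lambda>x. integral {B..x} (\<lambda>t. \<phi> t / t)", OF DERIV_exp D])
    moreover have "C * ((\<rho> + 1) * u powr (\<rho> + 1 - 1)) * e + e * (\<phi> u / u) * (C * u powr (\<rho> + 1))
       = C * u powr (\<rho> + 1) * e * (\<rho> + 1 + \<phi> u) / u" for e
    proof -
      have "u powr (\<rho> + 1) = u powr (\<rho> + 1 - 1) * u" using u0 by (simp add: powr_add)
      then show ?thesis using u0 by (simp add: field_simps)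
    qed
    ultimately have "(?g has_real_derivative ?g u * (\<rho> + 1 + \<phi> u) / u) (at u)" by simp
    then have "(f has_real_derivative ?g u * (\<rho> + 1 + \<phi> u) / u) (at u)"
      by (rule has_field_derivative_transform_within_open[where S="{B<..}"]) (use u B(4) in auto)
    then show "(f has_real_derivative f u * (\<rho> + 1 + \<phi> u) / u) (at u)" using B(4)[of u] u by simp
  qed
qed

text \<open>The value \<open>k 0\<close> is arbitrary, so integrability on \<open>{0..t}\<close> is first shown for the monotone
  function that vanishes at \<open>0\<close>.  Monotonicity also gives \<open>K t \<le> t * k t\<close>, hence both limits.\<close>
lemma class_K_primitive:
  assumes "class_K l1 k"
  obtains \<nu> k' where "\<nu> > 0"
    "\<And>t. 0 < t \<Longrightarrow> t < \<nu> \<Longrightarrow> k t > 0"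
    "\<And>t x. 0 < x \<Longrightarrow> x \<le> t \<Longrightarrow> t < \<nu> \<Longrightarrow> k x \<le> k t"
    "\<And>t. 0 < t \<Longrightarrow> t < \<nu> \<Longrightarrow> integral {0..t} k > 0"
    "\<And>t. 0 < t \<Longrightarrow> t < \<nu> \<Longrightarrow> (k has_real_derivative k' t) (at t)"
    "\<And>t. 0 < t \<Longrightarrow> t < \<nu> \<Longrightarrow> ((\<lambda>t. integral {0..t} k) has_real_derivative k t) (at t)"
    "((\<lambda>t. integral {0..t} k) \<longlongrightarrow> 0) (at_right 0)"
    "((\<lambda>t. integral {0..t} k / k t) \<longlongrightarrow> 0) (at_right 0)"
    "\<And>t. 0 < t \<Longrightarrow> t < \<nu> \<Longrightarrow> deriv (primitive_ratio k) t = 1 - integral {0..t} k * k' t / (k t)\<^sup>2"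
proof -
  obtain \<nu> where \<nu>: "\<nu> > 0" and kp: "\<And>t. t \<in> {0<..<\<nu>} \<Longrightarrow> k t > 0" and mono: "mono_on {0<..<\<nu>} k"
    and C1: "k C1_differentiable_on {0<..<\<nu>}"
    using assms unfolding class_K_def by blast
  obtain k' where k': "\<And>t. t \<in> {0<..<\<nu>} \<Longrightarrow> (k has_real_derivative k' t) (at t)"
    using C1 unfolding C1_differentiable_on_def has_real_derivative_iff_has_vector_derivative by blast
  have km: "k x \<le> k t" if "0 < x" "x \<le> t" "t < \<nu>" for x t
    using mono that by (auto simp: mono_on_def)
  define k0 where "k0 t = (if t \<le> 0 then 0 else k t)" for t
  have k0_mono: "mono_on {0..t} k0" if "t < \<nu>" for t
    using that km kp by (auto simp: mono_on_def k0_def intro: less_imp_le)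
  have k0_int: "k0 integrable_on {0..t}" if "t < \<nu>" for t
    by (rule integrable_on_mono_on[OF k0_mono[OF that]])
  have k_int: "k integrable_on {0..t}" if "t < \<nu>" for t
    by (rule integrable_spike[OF k0_int[OF that], of "{0}"]) (auto simp: k0_def)
  have K_eq: "integral {0..t} k = integral {0..t} k0" for t
    by (rule integral_spike[of "{0}"]) (auto simp: k0_def)
  have kc: "continuous (at t) k" if "t \<in> {0<..<\<nu>}" for t
    using DERIV_isCont[OF k'[OF that]] .
  have Kd: "((\<lambda>t. integral {0..t} k) has_real_derivative k t) (at t)" if t: "0 < t" "t < \<nu>" for t
  proof -
    define e where "e = (t + \<nu>) / 2"
    have e: "t < e" "e < \<nu>" using t by (auto simp: e_def)
    have "((\<lambda>x. integral {0..x} k) has_vector_derivative k t) (at t within ({0..e} - {}))"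
      by (rule integral_has_vector_derivative_continuous_at[OF k_int[OF e(2)] _ _ continuous_at_imp_continuous_at_within[OF kc]])
        (use t e in auto)
    moreover have "at t within ({0..e} - {}) = at t"
      using t e by (intro at_within_interior) (auto simp: interior_atLeastAtMost_real)
    ultimately show ?thesis by (simp add: has_real_derivative_iff_has_vector_derivative)
  qed
  have Kpos: "integral {0..t} k > 0" if t: "0 < t" "t < \<nu>" for t
  proof -
    have "integral {t/2..t} (\<lambda>_. k (t/2)) \<le> integral {t/2..t} k0"
    proof (rule integral_le)
      show "k0 integrable_on {t/2..t}" by (rule integrable_subinterval_real[OF k0_int[OF t(2)]]) (use t in auto)
      show "k (t/2) \<le> k0 x" if "x \<in> {t/2..t}" for x using that t km[of "t/2" x] by (auto simp: k0_def)
    qed auto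
    also have "\<dots> \<le> integral {0..t} k0"
    proof (rule integral_subset_le)
      show "k0 integrable_on {t/2..t}" by (rule integrable_subinterval_real[OF k0_int[OF t(2)]]) (use t in auto)
      show "\<forall>x\<in>{0..t}. 0 \<le> k0 x"
      proof
        fix x assume "x \<in> {0..t}"
        then show "0 \<le> k0 x" using t kp[of x] by (auto simp: k0_def)
      qed
    qed (use t k0_int in auto)
    finally have "t / 2 * k (t/2) \<le> integral {0..t} k" using t by (simp add: K_eq)
    moreover have "t / 2 * k (t/2) > 0" using t kp[of "t/2"] by simp
    ultimately show ?thesis by linarith
  qed
  have Kle: "integral {0..t} k \<le> t * k t" if t: "0 < t" "t < \<nu>" for t
  proof -
    have "integral {0..t} k0 \<le> integral {0..t} (\<lambda>_. k t)"
      by (rule integral_le) (use t k0_int km kp in \<open>auto simp: k0_def less_imp_le\<close>)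
    then show ?thesis using t by (simp add: K_eq)
  qed
  have near: "\<forall>\<^sub>F t in at_right 0. 0 < t \<and> t < \<nu> / 2" using eventually_at_right_real[of 0 "\<nu> / 2"] \<nu> by simp
  have ratio: "((\<lambda>t. integral {0..t} k / k t) \<longlongrightarrow> 0) (at_right 0)"
  proof (rule tendsto_sandwich[OF _ _ tendsto_const tendsto_ident_at])
    show "\<forall>\<^sub>F t in at_right 0. 0 \<le> integral {0..t} k / k t" using near
      by eventually_elim (use Kpos kp \<nu> in \<open>auto intro!: divide_nonneg_nonneg less_imp_le\<close>)
    show "\<forall>\<^sub>F t in at_right 0. integral {0..t} k / k t \<le> t" using near
      by eventually_elim (use Kle kp \<nu> in \<open>auto simp: pos_divide_le_eq\<close>)
  qed
  have K0: "((\<lambda>t. integral {0..t} k) \<longlongrightarrow> 0) (at_right 0)"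
  proof (rule tendsto_sandwich[OF _ _ tendsto_const])
    have "((\<lambda>t. t * k (\<nu> / 2)) \<longlongrightarrow> 0 * k (\<nu> / 2)) (at_right 0)" by (intro tendsto_intros)
    then show "((\<lambda>t. t * k (\<nu> / 2)) \<longlongrightarrow> 0) (at_right 0)" by simp
    show "\<forall>\<^sub>F t in at_right 0. 0 \<le> integral {0..t} k" using near
    proof eventually_elim
      case (elim t) then show ?case using Kpos[of t] \<nu> by simp
    qed
    show "\<forall>\<^sub>F t in at_right 0. integral {0..t} k \<le> t * k (\<nu> / 2)" using near
    proof eventually_elim
      case (elim t)
      have "t * k t \<le> t * k (\<nu> / 2)" using elim km[of t "\<nu> / 2"] by (intro mult_left_mono) auto
      moreover have "integral {0..t} k \<le> t * k t" using Kle[of t] elim \<nu> by simp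
      ultimately show ?case by (rule order_trans[rotated])
    qed
  qed
  have dr: "deriv (primitive_ratio k) t = 1 - integral {0..t} k * k' t / (k t)\<^sup>2" if t: "0 < t" "t < \<nu>" for t
  proof (rule DERIV_imp_deriv)
    have p: "k t > 0" using kp t by simp
    have "((\<lambda>t. integral {0..t} k / k t) has_real_derivative (k t * k t - integral {0..t} k * k' t) / (k t * k t)) (at t)"
      by (intro DERIV_divide Kd k') (use t p in auto)
    moreover have "(k t * k t - integral {0..t} k * k' t) / (k t * k t) = 1 - integral {0..t} k * k' t / (k t)\<^sup>2"
      using p by (simp add: diff_divide_distrib power2_eq_square)
    ultimately show "(primitive_ratio k has_real_derivative 1 - integral {0..t} k * k' t / (k t)\<^sup>2) (at t)"
      by (simp add: primitive_ratio_def[abs_def])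
  qed
  show ?thesis
    by (rule that[of \<nu> k']) (use \<nu> kp km Kpos k' Kd K0 ratio dr in auto)
qed

section \<open>Tangent balls at the boundary\<close>

lemma frechet_derivative_eq_gradient:
  assumes "u differentiable (at x)"
  shows "frechet_derivative u (at x) v = gradient u x \<bullet> v"
proof -
  interpret linear "frechet_derivative u (at x)"
    by (rule linear_frechet_derivative[OF assms])
  have "frechet_derivative u (at x) v = frechet_derivative u (at x) (\<Sum>i\<in>Basis. (v \<bullet> i) *\<^sub>R i)"
    by (simp add: euclidean_representation)
  also have "\<dots> = (\<Sum>i\<in>Basis. (v \<bullet> i) * partial_deriv i u x)"
    by (simp add: sum scale partial_deriv_def)
  also have "\<dots> = gradient u x \<bullet> v"
    unfolding gradient_def inner_sum_left by (intro sum.cong refl) (simp add: inner_commute)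
  finally show ?thesis .
qed

lemma C1_lipschitz_on_cball:
  fixes u :: "'a::euclidean_space \<Rightarrow> real"
  assumes "Ck_on 1 UNIV u"
  shows "\<exists>B\<ge>0. \<forall>x\<in>cball p r. \<forall>y\<in>cball p r. \<bar>u x - u y\<bar> \<le> B * norm (x - y)"
proof -
  have d: "u differentiable (at x)" for x using assms by (simp add: differentiable_on_def)
  have c: "continuous_on UNIV (partial_deriv i u)" if "i \<in> Basis" for i using assms that by simp
  have "continuous_on UNIV (gradient u)"
    unfolding gradient_def[abs_def] by (intro continuous_intros c)
  then have "compact (gradient u ` cball p r)"
    by (intro compact_continuous_image) (auto intro: continuous_on_subset)
  then have "bounded (gradient u ` cball p r)" by (rule compact_imp_bounded)
  then obtain B where "B > 0" "\<forall>y\<in>gradient u ` cball p r. norm y \<le> B" unfolding bounded_pos by blast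
  then have B: "B > 0" "\<And>x. x \<in> cball p r \<Longrightarrow> norm (gradient u x) \<le> B" by auto
  have "norm (u x - u y) \<le> B * norm (x - y)" if "x \<in> cball p r" "y \<in> cball p r" for x y
  proof (rule differentiable_bound[where S="cball p r"])
    fix z assume z: "z \<in> cball p r"
    show "(u has_derivative frechet_derivative u (at z)) (at z within cball p r)"
      using d[of z] frechet_derivative_works has_derivative_at_withinI by blast
    show "onorm (frechet_derivative u (at z)) \<le> B"
    proof (rule onorm_le)
      fix v
      have "\<bar>gradient u z \<bullet> v\<bar> \<le> norm (gradient u z) * norm v" by (rule Cauchy_Schwarz_ineq2)
      also have "\<dots> \<le> B * norm v" using B(2)[OF z] by (rule mult_right_mono) simp
      finally show "norm (frechet_derivative u (at z) v) \<le> B * norm v"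
        by (simp add: frechet_derivative_eq_gradient[OF d])
    qed
  qed (use that in auto)
  then show ?thesis using B(1) by (intro exI[of _ B]) auto
qed

text \<open>Mean value theorem along the segment, with a Lipschitz bound for the gradient.\<close>
lemma C2_taylor_on_cball:
  fixes u :: "'a::euclidean_space \<Rightarrow> real"
  assumes "Ck_on 2 UNIV u"
  shows "\<exists>M\<ge>0. \<forall>x\<in>cball p r. \<forall>y\<in>cball p r.
           \<bar>u x - u y - gradient u y \<bullet> (x - y)\<bar> \<le> M * (norm (x - y))\<^sup>2"
proof -
  have C2: "u differentiable (at x)" "i \<in> Basis \<Longrightarrow> Ck_on 1 UNIV (partial_deriv i u)" for x i
    using assms by (simp_all add: differentiable_on_def numeral_2_eq_2)
  have "\<forall>i\<in>Basis. \<exists>B\<ge>0. \<forall>x\<in>cball p r. \<forall>y\<in>cball p r.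
      \<bar>partial_deriv i u x - partial_deriv i u y\<bar> \<le> B * norm (x - y)"
    using C1_lipschitz_on_cball[OF C2(2)] by blast
  then obtain B where B: "\<And>i. i \<in> Basis \<Longrightarrow> B i \<ge> 0"
    "\<And>i x y. i \<in> Basis \<Longrightarrow> x \<in> cball p r \<Longrightarrow> y \<in> cball p r \<Longrightarrow>
      \<bar>partial_deriv i u x - partial_deriv i u y\<bar> \<le> B i * norm (x - y)"
    by metis
  define M where "M = (\<Sum>i\<in>Basis. B i)"
  have M0: "M \<ge> 0" unfolding M_def by (rule sum_nonneg) (rule B(1))
  have grad: "norm (gradient u x - gradient u y) \<le> M * norm (x - y)"
    if "x \<in> cball p r" "y \<in> cball p r" for x y
  proof -
    have "gradient u x - gradient u y = (\<Sum>i\<in>Basis. (partial_deriv i u x - partial_deriv i u y) *\<^sub>R i)"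
      by (simp add: gradient_def sum_subtractf scaleR_diff_left)
    also have "norm \<dots> \<le> (\<Sum>i\<in>Basis. \<bar>partial_deriv i u x - partial_deriv i u y\<bar>)"
      by (rule order_trans[OF norm_sum]) simp
    also have "\<dots> \<le> (\<Sum>i\<in>Basis. B i * norm (x - y))"
      using B(2) that by (intro sum_mono) auto
    finally show ?thesis by (simp add: M_def sum_distrib_right)
  qed
  have "\<bar>u x - u y - gradient u y \<bullet> (x - y)\<bar> \<le> M * (norm (x - y))\<^sup>2"
    if xy: "x \<in> cball p r" "y \<in> cball p r" for x y
  proof -
    have "\<exists>z\<in>closed_segment y x. u x - u y = frechet_derivative u (at z) (x - y)" if "x \<noteq> y"
    proof -
      have "\<exists>t>0. t < 1 \<and> u (y + 1 *\<^sub>R (x - y)) - u (y + 0 *\<^sub>R (x - y))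
          = (1 - 0) * frechet_derivative u (at (y + t *\<^sub>R (x - y))) (x - y)"
      proof (rule MVT2)
        fix t :: real
        let ?D = "frechet_derivative u (at (y + t *\<^sub>R (x - y)))"
        have D: "(u has_derivative ?D) (at (y + t *\<^sub>R (x - y)))"
          using C2(1) frechet_derivative_works by blast
        interpret linear ?D by (rule linear_frechet_derivative[OF C2(1)])
        have "((\<lambda>t. y + t *\<^sub>R (x - y)) has_derivative (\<lambda>s. s *\<^sub>R (x - y))) (at t)"
          by (auto intro!: derivative_eq_intros)
        from diff_chain_at[OF this D] have "((\<lambda>t. u (y + t *\<^sub>R (x - y))) has_derivative (\<lambda>s. s * ?D (x - y))) (at t)"
          by (simp add: o_def scale)
        then show "((\<lambda>t. u (y + t *\<^sub>R (x - y))) has_real_derivative ?D (x - y)) (at t)"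
          by (simp add: has_field_derivative_def mult.commute[of _ "?D (x - y)"] mult_commute_abs)
      qed simp
      then obtain t where t: "0 < t" "t < 1" "u x - u y = frechet_derivative u (at (y + t *\<^sub>R (x - y))) (x - y)"
        by auto
      have "y + t *\<^sub>R (x - y) \<in> closed_segment y x"
        unfolding in_segment
      proof (intro exI[of _ t] conjI)
        show "y + t *\<^sub>R (x - y) = (1 - t) *\<^sub>R y + t *\<^sub>R x" by (simp add: algebra_simps)
      qed (use t in auto)
      with t(3) show ?thesis by (rule bexI)
    qed
    then have "\<exists>z\<in>closed_segment y x. u x - u y = gradient u z \<bullet> (x - y)"
      using frechet_derivative_eq_gradient[OF C2(1)] by (cases "x = y") simp_all
    then obtain z where z: "z \<in> closed_segment y x" "u x - u y = gradient u z \<bullet> (x - y)" by (rule bexE)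
    have zc: "z \<in> cball p r" using z(1) xy convex_cball[of p r] by (metis closed_segment_subset subsetD)
    have nz: "norm (z - y) \<le> norm (x - y)"
      using segment_bound1[OF z(1)] by (simp add: norm_minus_commute)
    have "\<bar>u x - u y - gradient u y \<bullet> (x - y)\<bar> = \<bar>(gradient u z - gradient u y) \<bullet> (x - y)\<bar>"
      by (simp add: z(2) inner_diff_left)
    also have "\<dots> \<le> norm (gradient u z - gradient u y) * norm (x - y)" by (rule Cauchy_Schwarz_ineq2)
    also have "\<dots> \<le> (M * norm (z - y)) * norm (x - y)"
      by (intro mult_right_mono grad zc xy) auto
    also have "\<dots> \<le> (M * norm (x - y)) * norm (x - y)"
      using nz M0 by (intro mult_right_mono mult_left_mono) auto
    finally show ?thesis by (simp add: power2_eq_square mult.assoc)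
  qed
  then show ?thesis using M0 by (intro exI[of _ M] conjI ballI)
qed

text \<open>With the graph function \<open>\<gamma>\<close> in direction \<open>e\<close>, take \<open>G x = x \<bullet> e - \<gamma> (\<pi> x)\<close>, where \<open>\<pi>\<close> is the
  projection onto the hyperplane orthogonal to \<open>e\<close>.  Its gradient \<open>g\<close> has component \<open>1\<close> along \<open>e\<close>,
  whence the lower bound for its norm.\<close>
lemma local_defining_function:
  fixes \<Omega> :: "'a::euclidean_space set"
  assumes "smooth_boundary \<Omega>" "p \<in> frontier \<Omega>"
  shows "\<exists>r>0. \<exists>M>0. \<exists>G g. (\<forall>x\<in>ball p r. x \<in> \<Omega> \<longleftrightarrow> 0 < G x) \<and> (\<forall>y. 1 \<le> norm (g y)) \<and>
     (\<forall>x\<in>ball p r. \<forall>y\<in>ball p r. \<bar>G x - G y - g y \<bullet> (x - y)\<bar> \<le> M * (norm (x - y))\<^sup>2)"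
proof -
  obtain r e \<gamma> where r: "r > 0" "norm e = 1" "smooth_on UNIV \<gamma>"
    "\<Omega> \<inter> ball p r = {x \<in> ball p r. \<gamma> (x - (x \<bullet> e) *\<^sub>R e) < x \<bullet> e}"
    using assms unfolding smooth_boundary_def by blast
  define \<pi> where "\<pi> x = x - (x \<bullet> e) *\<^sub>R e" for x
  have ee: "e \<bullet> e = 1" using r(2) by (simp add: dot_square_norm)
  have \<pi>_diff: "\<pi> x - \<pi> y = \<pi> (x - y)" for x y by (simp add: \<pi>_def inner_diff_left algebra_simps)
  have \<pi>_adj: "v \<bullet> \<pi> w = \<pi> v \<bullet> w" for v w
    by (simp add: \<pi>_def inner_diff_left inner_diff_right inner_commute[of e w])
  have \<pi>_norm: "norm (\<pi> x) \<le> norm x" for x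
  proof (rule power2_le_imp_le)
    show "(norm (\<pi> x))\<^sup>2 \<le> (norm x)\<^sup>2"
      unfolding power2_norm_eq_inner using zero_le_square[of "x \<bullet> e"]
      by (simp add: \<pi>_def inner_diff_left inner_diff_right inner_commute[of e x] ee)
  qed simp
  have "Ck_on 2 UNIV \<gamma>" using r(3) by (simp add: smooth_on_def)
  from C2_taylor_on_cball[OF this] obtain M where M: "M \<ge> 0"
    "\<And>x y. x \<in> cball (\<pi> p) r \<Longrightarrow> y \<in> cball (\<pi> p) r \<Longrightarrow>
       \<bar>\<gamma> x - \<gamma> y - gradient \<gamma> y \<bullet> (x - y)\<bar> \<le> M * (norm (x - y))\<^sup>2" by blast
  define G where "G x = x \<bullet> e - \<gamma> (\<pi> x)" for x
  define g where "g y = e - \<pi> (gradient \<gamma> (\<pi> y))" for y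
  have p1: "x \<in> \<Omega> \<longleftrightarrow> 0 < G x" if "x \<in> ball p r" for x
  proof -
    have "x \<in> \<Omega> \<longleftrightarrow> x \<in> \<Omega> \<inter> ball p r" using that by simp
    also have "\<dots> \<longleftrightarrow> 0 < G x" unfolding r(4) G_def \<pi>_def using that by simp
    finally show ?thesis .
  qed
  have p2: "1 \<le> norm (g y)" for y
  proof -
    have "g y \<bullet> e = 1" using ee by (simp add: g_def inner_diff_left \<pi>_def)
    then show ?thesis using Cauchy_Schwarz_ineq2[of "g y" e] r(2) by simp
  qed
  have p3: "\<bar>G x - G y - g y \<bullet> (x - y)\<bar> \<le> (M + 1) * (norm (x - y))\<^sup>2"
    if xy: "x \<in> ball p r" "y \<in> ball p r" for x y
  proof -
    have cb: "\<pi> x \<in> cball (\<pi> p) r" if "x \<in> ball p r" for x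
      using that \<pi>_norm[of "p - x"] by (simp add: dist_norm \<pi>_diff)
    have "\<bar>G x - G y - g y \<bullet> (x - y)\<bar> = \<bar>\<gamma> (\<pi> x) - \<gamma> (\<pi> y) - gradient \<gamma> (\<pi> y) \<bullet> (\<pi> x - \<pi> y)\<bar>"
    proof -
      have "g y \<bullet> (x - y) = e \<bullet> (x - y) - gradient \<gamma> (\<pi> y) \<bullet> (\<pi> x - \<pi> y)"
        unfolding g_def inner_diff_left[of e] \<pi>_adj[symmetric] \<pi>_diff ..
      moreover have "e \<bullet> (x - y) = x \<bullet> e - y \<bullet> e"
        by (simp add: inner_commute[of e "x - y"] inner_diff_left)
      ultimately have "G x - G y - g y \<bullet> (x - y) = - (\<gamma> (\<pi> x) - \<gamma> (\<pi> y) - gradient \<gamma> (\<pi> y) \<bullet> (\<pi> x - \<pi> y))"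
        unfolding G_def by linarith
      then show ?thesis by simp
    qed
    also have "\<dots> \<le> M * (norm (\<pi> x - \<pi> y))\<^sup>2" by (intro M cb xy)
    also have "\<dots> \<le> M * (norm (x - y))\<^sup>2"
      unfolding \<pi>_diff by (intro mult_left_mono power_mono \<pi>_norm M(1) norm_ge_zero)
    also have "\<dots> \<le> (M + 1) * (norm (x - y))\<^sup>2" by (simp add: algebra_simps)
    finally show ?thesis .
  qed
  have "(\<forall>x\<in>ball p r. x \<in> \<Omega> \<longleftrightarrow> 0 < G x) \<and> (\<forall>y. 1 \<le> norm (g y)) \<and>
     (\<forall>x\<in>ball p r. \<forall>y\<in>ball p r. \<bar>G x - G y - g y \<bullet> (x - y)\<bar> \<le> (M + 1) * (norm (x - y))\<^sup>2)"
    by (intro conjI ballI allI p1 p2 p3)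
  moreover have "M + 1 > 0" using M(1) by simp
  ultimately show ?thesis using r(1)
    by - (rule exI[of _ r], rule conjI, assumption, rule exI[of _ "M + 1"], rule conjI, assumption, rule exI, rule exI)
qed

text \<open>The vector \<open>n\<close> stands for the inner unit normal at the boundary point \<open>y\<close>.\<close>
definition normal_balls :: "'a::euclidean_space set \<Rightarrow> 'a \<Rightarrow> 'a \<Rightarrow> real \<Rightarrow> bool" where
  "normal_balls \<Omega> y n R \<longleftrightarrow>
     ball (y + R *\<^sub>R n) R \<inter> frontier \<Omega> = {} \<and> ball (y - R *\<^sub>R n) R \<inter> closure \<Omega> = {}"

text \<open>Let \<open>n\<close> be the unit vector along the gradient \<open>g y\<close>.  A point \<open>x\<close> of the open ball with centre
  \<open>y + R n\<close> and radius \<open>R\<close> satisfies \<open>|x - y|\<^sup>2 < 2 R n \<bullet> (x - y)\<close>, so for small \<open>R\<close> the linear term of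
  the defining function beats the quadratic error and \<open>G x > 0\<close>.  The other ball is treated in the
  same way, with \<open>s = - 1\<close> in the proof.\<close>
lemma frontier_touching_balls:
  fixes \<Omega> :: "'a::euclidean_space set"
  assumes "open \<Omega>" "smooth_boundary \<Omega>" "p \<in> frontier \<Omega>"
  shows "\<exists>\<epsilon>>0. \<forall>y\<in>frontier \<Omega> \<inter> ball p \<epsilon>. \<exists>n. norm n = 1 \<and> (\<forall>R\<in>{0<..\<epsilon>}. normal_balls \<Omega> y n R)"
proof -
  obtain r M G g where r: "r > 0" "M > 0" and G: "\<And>x. x \<in> ball p r \<Longrightarrow> x \<in> \<Omega> \<longleftrightarrow> 0 < G x"
    and g: "\<And>y. 1 \<le> norm (g y)"
    and T: "\<And>x y. x \<in> ball p r \<Longrightarrow> y \<in> ball p r \<Longrightarrow> \<bar>G x - G y - g y \<bullet> (x - y)\<bar> \<le> M * (norm (x - y))\<^sup>2"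
    using local_defining_function[OF assms(2,3)] by metis
  have Gcont: "isCont G y" if y: "y \<in> ball p r" for y
  proof -
    have "((\<lambda>x. g y \<bullet> (x - y) - M * (norm (x - y))\<^sup>2) \<longlongrightarrow> g y \<bullet> (y - y) - M * (norm (y - y))\<^sup>2) (at y)"
      "((\<lambda>x. g y \<bullet> (x - y) + M * (norm (x - y))\<^sup>2) \<longlongrightarrow> g y \<bullet> (y - y) + M * (norm (y - y))\<^sup>2) (at y)"
      by (intro tendsto_intros)+
    then have L: "((\<lambda>x. g y \<bullet> (x - y) - M * (norm (x - y))\<^sup>2) \<longlongrightarrow> 0) (at y)"
      "((\<lambda>x. g y \<bullet> (x - y) + M * (norm (x - y))\<^sup>2) \<longlongrightarrow> 0) (at y)" by simp_all
    have ev: "\<forall>\<^sub>F x in at y. x \<in> ball p r" using y by (intro eventually_at_in_open') auto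
    have "((\<lambda>x. G x - G y) \<longlongrightarrow> 0) (at y)"
    proof (rule tendsto_sandwich[OF _ _ L])
      show "\<forall>\<^sub>F x in at y. g y \<bullet> (x - y) - M * (norm (x - y))\<^sup>2 \<le> G x - G y"
        using ev
      proof eventually_elim
        case (elim x) show ?case using T[OF elim y] by linarith
      qed
      show "\<forall>\<^sub>F x in at y. G x - G y \<le> g y \<bullet> (x - y) + M * (norm (x - y))\<^sup>2"
        using ev
      proof eventually_elim
        case (elim x) show ?case using T[OF elim y] by linarith
      qed
    qed
    then show ?thesis by (simp add: isCont_def LIM_zero_iff)
  qed
  have neg: "x \<notin> closure \<Omega>" if "x \<in> ball p r" "G x < 0" for x
  proof -
    have "\<forall>\<^sub>F y in at x. G y < 0" using Gcont[OF that(1)] that(2)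
      unfolding isCont_def by (intro order_tendstoD) auto
    moreover have "\<forall>\<^sub>F y in at x. y \<in> ball p r" using that by (intro eventually_at_in_open') auto
    ultimately have "\<forall>\<^sub>F y in at x. y \<notin> \<Omega>" by eventually_elim (simp add: G)
    then have "\<not> x islimpt \<Omega>" unfolding islimpt_conv_frequently_at frequently_def by simp
    moreover have "x \<notin> \<Omega>" using G[OF that(1)] that(2) by simp
    ultimately show ?thesis by (simp add: closure_def)
  qed
  have fr0: "G y = 0" if "y \<in> frontier \<Omega>" "y \<in> ball p r" for y
  proof -
    have "y \<notin> \<Omega>" "y \<in> closure \<Omega>" using that(1) assms(1) by (auto simp: frontier_def interior_open)
    then show ?thesis using G[OF that(2)] neg[OF that(2)] by (meson linorder_neqE_linordered_idom)
  qed
  define \<epsilon> where "\<epsilon> = min (r / 4) (1 / (2 * M))"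
  have \<epsilon>: "\<epsilon> > 0" "\<epsilon> \<le> r / 4" "\<epsilon> \<le> 1 / (2 * M)" using r by (auto simp: \<epsilon>_def)
  have "\<exists>n. norm n = 1 \<and> (\<forall>R\<in>{0<..\<epsilon>}. normal_balls \<Omega> y n R)"
    if y: "y \<in> frontier \<Omega>" "y \<in> ball p \<epsilon>" for y
  proof -
    have yr: "y \<in> ball p r" using y(2) \<epsilon> r by simp
    have Gy: "G y = 0" using fr0[OF y(1) yr] .
    define n where "n = g y /\<^sub>R norm (g y)"
    have g0: "norm (g y) \<noteq> 0" using g[of y] by linarith
    then have n: "norm n = 1" by (simp add: n_def)
    from g0 have gn: "g y = norm (g y) *\<^sub>R n" by (simp add: n_def)
    have key: "x \<in> ball p r \<and> M * (norm (x - y))\<^sup>2 < \<bar>g y \<bullet> (x - y)\<bar> \<and> 0 < s * (g y \<bullet> (x - y))"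
      if R: "0 < R" "R \<le> \<epsilon>" and s: "\<bar>s\<bar> = 1" and x: "x \<in> ball (y + (s * R) *\<^sub>R n) R" for x R and s :: real
    proof -
      define w where "w = x - y"
      have "norm (w - (s * R) *\<^sub>R n) < R" using x by (simp add: w_def dist_norm norm_minus_commute algebra_simps)
      then have "(norm (w - (s * R) *\<^sub>R n))\<^sup>2 < R\<^sup>2" using R by (intro power_strict_mono) auto
      moreover have "(norm (w - (s * R) *\<^sub>R n))\<^sup>2 = (norm w)\<^sup>2 - 2 * R * (s * (n \<bullet> w)) + R\<^sup>2"
      proof -
        have "n \<bullet> n = 1" "s * s = 1" using n s by (auto simp: dot_square_norm abs_if split: if_splits)
        have "(norm (w - q *\<^sub>R n))\<^sup>2 = (norm w)\<^sup>2 - 2 * q * (n \<bullet> w) + q\<^sup>2 * (n \<bullet> n)" for q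
          unfolding power2_norm_eq_inner
          by (simp add: inner_diff_left inner_diff_right inner_commute[of w n] power2_eq_square algebra_simps)
        from this[of "s * R"] show ?thesis
          using \<open>n \<bullet> n = 1\<close> \<open>s * s = 1\<close> by (simp add: power_mult_distrib power2_eq_square mult_ac)
      qed
      ultimately have 1: "(norm w)\<^sup>2 < 2 * R * (s * (n \<bullet> w))" by simp
      have "0 < 2 * R * (s * (n \<bullet> w))" by (rule le_less_trans[OF zero_le_power2 1])
      then have pos: "0 < s * (n \<bullet> w)" using R by (simp add: zero_less_mult_iff)
      have "2 * M * R \<le> 2 * M * \<epsilon>" using R r(2) by simp
      also have "\<dots> \<le> 2 * M * (1 / (2 * M))" using \<epsilon>(3) r(2) by (intro mult_left_mono) auto
      also have "\<dots> = 1" using r(2) by simp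
      finally have "2 * M * R \<le> 1" .
      then have "2 * M * R * (s * (n \<bullet> w)) \<le> 1 * (s * (n \<bullet> w))" using pos by (intro mult_right_mono) auto
      moreover have "M * (norm w)\<^sup>2 < M * (2 * R * (s * (n \<bullet> w)))" using 1 r(2) by simp
      ultimately have 2: "M * (norm w)\<^sup>2 < s * (n \<bullet> w)" by (simp add: algebra_simps)
      have gw: "s * (g y \<bullet> w) = norm (g y) * (s * (n \<bullet> w))" by (subst gn) simp
      have 3: "s * (n \<bullet> w) \<le> s * (g y \<bullet> w)" unfolding gw using mult_right_mono[OF g[of y], of "s * (n \<bullet> w)"] pos by simp
      have "s * (g y \<bullet> w) \<le> \<bar>g y \<bullet> w\<bar>" using s by (auto simp: abs_if split: if_splits)
      moreover have "x \<in> ball p r"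
      proof -
        have "norm w \<le> norm (w - (s * R) *\<^sub>R n) + norm ((s * R) *\<^sub>R n)" using norm_triangle_ineq[of "w - (s * R) *\<^sub>R n" "(s * R) *\<^sub>R n"] by simp
        also have "\<dots> \<le> R + R" using \<open>norm (w - (s * R) *\<^sub>R n) < R\<close> n s R by (simp add: abs_mult)
        finally have "dist y x \<le> 2 * \<epsilon>" using R by (simp add: w_def dist_norm norm_minus_commute)
        then have "dist p x \<le> \<epsilon> + 2 * \<epsilon>" using y(2) dist_triangle[of p x y] by simp
        then show ?thesis using \<epsilon>(2) r(1) by simp
      qed
      ultimately show ?thesis using 2 3 pos unfolding w_def by linarith
    qed
    have balls: "normal_balls \<Omega> y n R"
      if R: "0 < R" "R \<le> \<epsilon>" for R
      unfolding normal_balls_def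
    proof
      show "ball (y + R *\<^sub>R n) R \<inter> frontier \<Omega> = {}"
      proof safe
        fix x assume x: "x \<in> ball (y + R *\<^sub>R n) R" "x \<in> frontier \<Omega>"
        with key[OF R, of 1 x] have "x \<in> ball p r" "M * (norm (x - y))\<^sup>2 < g y \<bullet> (x - y)" by auto
        then have "G x > 0" using T[of x y] yr Gy by (auto simp: abs_le_iff)
        then show "x \<in> {}" using fr0[OF x(2) \<open>x \<in> ball p r\<close>] by simp
      qed
      show "ball (y - R *\<^sub>R n) R \<inter> closure \<Omega> = {}"
      proof safe
        fix x assume x: "x \<in> ball (y - R *\<^sub>R n) R" "x \<in> closure \<Omega>"
        with key[OF R, of "-1" x] have "x \<in> ball p r" "M * (norm (x - y))\<^sup>2 < - (g y \<bullet> (x - y))" by auto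
        then have "G x < 0" using T[of x y] yr Gy by (auto simp: abs_le_iff)
        then show "x \<in> {}" using neg[OF \<open>x \<in> ball p r\<close>] x(2) by simp
      qed
    qed
    show ?thesis using n balls by (intro exI[of _ n]) auto
  qed
  then show ?thesis using \<epsilon>(1) by (intro exI[of _ \<epsilon>]) auto
qed

lemma frontier_nonempty_bounded:
  fixes \<Omega> :: "'a::euclidean_space set"
  assumes "smooth_bounded_domain \<Omega>"
  shows "frontier \<Omega> \<noteq> {}" "compact (frontier \<Omega>)"
proof -
  have \<Omega>: "\<Omega> \<noteq> {}" "bounded \<Omega>" using assms by (auto simp: smooth_bounded_domain_def)
  then have "\<Omega> \<noteq> UNIV" using not_bounded_UNIV by metis
  then show "frontier \<Omega> \<noteq> {}" using \<Omega> by (intro frontier_not_empty) auto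
  show "compact (frontier \<Omega>)" using \<Omega> by (intro compact_frontier_bounded)
qed

text \<open>Let \<open>y\<close> be a boundary point nearest to \<open>x\<close>.  The ball around \<open>x\<close> of radius \<open>d\<close> lies in \<open>\<Omega>\<close> and is
  therefore disjoint from the outer ball at \<open>y\<close>, while both have \<open>y\<close> on their boundary.  This is
  equality in the triangle inequality, which forces \<open>x - y = d n\<close>: the point \<open>x\<close> lies on the axis
  through the centres of the inner and the outer ball.\<close>
lemma touching_ball_configuration:
  fixes \<Omega> :: "'a::euclidean_space set"
  assumes "open \<Omega>" and x: "x \<in> \<Omega>" and y: "y \<in> frontier \<Omega>" "dist x y = bdist \<Omega> x" and n: "norm n = 1"
    and R: "R > 0" and d: "bdist \<Omega> x < R"
    and inner: "ball (y + R *\<^sub>R n) R \<inter> frontier \<Omega> = {}" and outer: "ball (y - R *\<^sub>R n) R \<inter> closure \<Omega> = {}"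
  shows "norm (x - (y + R *\<^sub>R n)) = R - bdist \<Omega> x \<and> (\<forall>x'. R - norm (x' - (y + R *\<^sub>R n)) \<le> bdist \<Omega> x') \<and>
         norm (x - (y - R *\<^sub>R n)) = R + bdist \<Omega> x \<and> (\<forall>x'\<in>\<Omega>. bdist \<Omega> x' \<le> norm (x' - (y - R *\<^sub>R n)) - R)"
proof -
  let ?d = "bdist \<Omega> x" and ?z = "y + R *\<^sub>R n" and ?z' = "y - R *\<^sub>R n"
  have fne: "frontier \<Omega> \<noteq> {}" using y by auto
  have d0: "?d \<ge> 0" by (simp add: bdist_def infdist_nonneg)
  have dle: "?d \<le> dist x q" if "q \<in> frontier \<Omega>" for q using that by (simp add: bdist_def infdist_le)
  have xball: "ball x ?d \<subseteq> \<Omega>"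
  proof (rule ccontr)
    assume *: "\<not> ball x ?d \<subseteq> \<Omega>"
    then obtain q where "dist x q < ?d" by (auto simp: subset_iff)
    then have "?d > 0" by (rule le_less_trans[OF zero_le_dist])
    then have "ball x ?d \<inter> \<Omega> \<noteq> {}" using x by (metis IntI centre_in_ball empty_iff)
    then have "ball x ?d \<inter> frontier \<Omega> \<noteq> {}" using * by (intro connected_Int_frontier) auto
    then show False using dle by fastforce
  qed
  have dz': "norm (x - ?z') = ?d + R"
  proof (rule antisym)
    have "norm (x - ?z') \<le> norm (x - y) + norm (R *\<^sub>R n)"
      using norm_triangle_ineq[of "x - y" "R *\<^sub>R n"] by (simp add: algebra_simps)
    then show "norm (x - ?z') \<le> ?d + R" using y(2) n R by (simp add: dist_norm)
    show "?d + R \<le> norm (x - ?z')"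
    proof (rule ccontr)
      assume "\<not> ?d + R \<le> norm (x - ?z')"
      then have lt: "dist x ?z' < ?d + R" by (simp add: dist_norm)
      define q where "q = x + (?d / (?d + R)) *\<^sub>R (?z' - x)"
      have "?z' - q = (R / (?d + R)) *\<^sub>R (?z' - x)"
      proof -
        have s: "R / (?d + R) = 1 - ?d / (?d + R)" using R d0 by (simp add: field_simps)
        have "v - (x + s *\<^sub>R (v - x)) = (1 - s) *\<^sub>R (v - x)" for v :: 'a and s
          by (simp add: algebra_simps)
        then show ?thesis unfolding q_def s .
      qed
      then have "dist ?z' q = R * (dist x ?z' / (?d + R))"
        using R d0 by (simp add: dist_norm norm_minus_commute)
      also have "\<dots> < R * 1" using lt R d0 by (intro mult_strict_left_mono) auto
      finally have q1: "q \<in> ball ?z' R" by simp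
      have "dist x q = ?d * (dist x ?z' / (?d + R))"
        using R d0 by (simp add: q_def dist_norm norm_minus_commute)
      also have "\<dots> \<le> ?d * 1" using lt R d0 by (intro mult_left_mono) auto
      finally have "q \<in> cball x ?d" by simp
      then have "q \<in> closure \<Omega>"
      proof (cases "?d = 0")
        case True then show ?thesis using \<open>q \<in> cball x ?d\<close> x closure_subset by auto
      next
        case False then show ?thesis
          using closure_mono[OF xball] closure_ball[of ?d x] \<open>q \<in> cball x ?d\<close> d0 by auto
      qed
      then show False using q1 outer by auto
    qed
  qed
  have "norm ((x - y) + R *\<^sub>R n) = norm (x - y) + norm (R *\<^sub>R n)"
    using dz' y(2) n R by (simp add: dist_norm algebra_simps)
  then have "norm (x - y) *\<^sub>R (R *\<^sub>R n) = norm (R *\<^sub>R n) *\<^sub>R (x - y)" by (rule norm_triangle_eq[THEN iffD1])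
  then have "R *\<^sub>R (x - y) = R *\<^sub>R (?d *\<^sub>R n)" using y(2) n R by (simp add: dist_norm mult.commute)
  then have "x - y = ?d *\<^sub>R n \<or> R = 0" by (simp only: scaleR_cancel_left)
  then have xy: "x - y = ?d *\<^sub>R n" using R by (elim disjE) simp_all
  have "x - ?z = (?d - R) *\<^sub>R n" using xy by (simp add: algebra_simps)
  then have 1: "norm (x - ?z) = R - ?d" using n d by simp
  have 2: "R - norm (x' - ?z) \<le> bdist \<Omega> x'" for x'
  proof -
    have "R - norm (x' - ?z) \<le> infdist x' (frontier \<Omega>)"
      unfolding infdist_notempty[OF fne]
    proof (rule cINF_greatest[OF fne])
      fix q assume "q \<in> frontier \<Omega>"
      then have "R \<le> dist ?z q" using inner by force
      then show "R - norm (x' - ?z) \<le> dist x' q"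
        using dist_triangle[of ?z q x'] by (simp add: dist_norm norm_minus_commute)
    qed
    then show ?thesis by (simp add: bdist_def)
  qed
  have 3: "bdist \<Omega> x' \<le> norm (x' - ?z') - R" if "x' \<in> \<Omega>" for x'
  proof -
    have "?z' \<notin> \<Omega>" using outer R closure_subset[of \<Omega>] by force
    then have "closed_segment x' ?z' \<inter> frontier \<Omega> \<noteq> {}"
      using that by (intro connected_Int_frontier) auto
    then obtain q where q: "q \<in> closed_segment x' ?z'" "q \<in> frontier \<Omega>" by blast
    have "R \<le> dist ?z' q" using outer q(2) by (force simp: frontier_def)
    moreover have "dist x' ?z' = dist x' q + dist q ?z'" using q(1) by (simp add: between_mem_segment[symmetric] between)
    moreover have "bdist \<Omega> x' \<le> dist x' q" using q(2) by (simp add: bdist_def infdist_le)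
    ultimately show ?thesis by (simp add: dist_norm norm_minus_commute)
  qed
  show ?thesis using 1 2 3 dz' by (simp add: add.commute)
qed

text \<open>The two quantified parts are a radial minorant and a radial majorant of the distance to the
  boundary; the two equations say that they touch it at \<open>x\<close>.\<close>
definition touched_by_balls :: "'a::euclidean_space set \<Rightarrow> real \<Rightarrow> 'a \<Rightarrow> bool" where
  "touched_by_balls \<Omega> R x \<longleftrightarrow> (\<exists>z z'.
     norm (x - z) = R - bdist \<Omega> x \<and> (\<forall>x'. R - norm (x' - z) \<le> bdist \<Omega> x') \<and>
     norm (x - z') = R + bdist \<Omega> x \<and> (\<forall>x'\<in>\<Omega>. bdist \<Omega> x' \<le> norm (x' - z') - R))"

text \<open>Compactness of the boundary makes the radius uniform.\<close>
lemma uniform_touching_balls: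
  fixes \<Omega> :: "'a::euclidean_space set"
  assumes "smooth_bounded_domain \<Omega>"
  obtains R where "R > 0" "\<And>x. x \<in> \<Omega> \<Longrightarrow> bdist \<Omega> x < R \<Longrightarrow> touched_by_balls \<Omega> R x"
proof -
  note fr = frontier_nonempty_bounded[OF assms]
  have \<Omega>: "open \<Omega>" "smooth_boundary \<Omega>" using assms by (auto simp: smooth_bounded_domain_def)
  obtain \<epsilon> where \<epsilon>: "\<And>p. p \<in> frontier \<Omega> \<Longrightarrow> \<epsilon> p > 0"
    "\<And>p y. p \<in> frontier \<Omega> \<Longrightarrow> y \<in> frontier \<Omega> \<inter> ball p (\<epsilon> p) \<Longrightarrow> \<exists>n. norm n = 1 \<and> (\<forall>R\<in>{0<..\<epsilon> p}. normal_balls \<Omega> y n R)"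
    using frontier_touching_balls[OF \<Omega>] by metis
  have "frontier \<Omega> \<subseteq> (\<Union>p\<in>frontier \<Omega>. ball p (\<epsilon> p))" using \<epsilon>(1) by force
  then obtain D where D: "D \<subseteq> frontier \<Omega>" "finite D" "frontier \<Omega> \<subseteq> (\<Union>p\<in>D. ball p (\<epsilon> p))"
    by (rule compactE_image[OF fr(2), of "frontier \<Omega>" "\<lambda>p. ball p (\<epsilon> p)", rotated]) auto
  have "D \<noteq> {}" using D(3) fr(1) by auto
  define R where "R = Min (\<epsilon> ` D)"
  have R: "R > 0" "\<And>p. p \<in> D \<Longrightarrow> R \<le> \<epsilon> p"
    using D(1,2) \<open>D \<noteq> {}\<close> \<epsilon>(1) by (auto simp: R_def)
  show ?thesis
  proof (rule that[OF R(1)])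
    fix x assume x: "x \<in> \<Omega>" "bdist \<Omega> x < R"
    obtain y where y: "y \<in> frontier \<Omega>" "bdist \<Omega> x = dist x y"
      unfolding bdist_def by (rule infdist_attains_inf[OF frontier_closed fr(1)])
    then obtain p where p: "p \<in> D" "y \<in> ball p (\<epsilon> p)" using D(3) by auto
    have pf: "p \<in> frontier \<Omega>" using p(1) D(1) by auto
    obtain n where n1: "norm n = 1" "\<forall>R\<in>{0<..\<epsilon> p}. normal_balls \<Omega> y n R"
      using \<epsilon>(2)[OF pf, of y] y(1) p(2) by auto
    have "normal_balls \<Omega> y n R" using n1(2) R(1) R(2)[OF p(1)] by simp
    then have n: "norm n = 1" "ball (y + R *\<^sub>R n) R \<inter> frontier \<Omega> = {}" "ball (y - R *\<^sub>R n) R \<inter> closure \<Omega> = {}"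
      using n1(1) by (simp_all add: normal_balls_def)
    show "touched_by_balls \<Omega> R x"
      unfolding touched_by_balls_def
      by (rule exI, rule exI, rule touching_ball_configuration[OF \<Omega>(1) x(1) y(1) y(2)[symmetric] n(1) R(1) x(2) n(2,3)])
  qed
qed

section \<open>Comparison with functions of the distance\<close>

lemma second_derivative_nonpos_at_max:
  fixes g :: "real \<Rightarrow> real"
  assumes "\<forall>\<^sub>F s in nhds 0. g s \<le> g 0"
    and "\<forall>\<^sub>F s in nhds 0. (g has_real_derivative g1 s) (at s)"
    and "(g1 has_real_derivative g2) (at 0)"
  shows "g2 \<le> 0"
proof (rule ccontr)
  assume "\<not> g2 \<le> 0"
  then have pos: "g2 > 0" by simp
  from assms(1,2) have "\<forall>\<^sub>F s in nhds 0. g s \<le> g 0 \<and> (g has_real_derivative g1 s) (at s)"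
    by (rule eventually_conj)
  then obtain d where d: "d > 0" "\<And>s. \<bar>s\<bar> < d \<Longrightarrow> g s \<le> g 0"
    "\<And>s. \<bar>s\<bar> < d \<Longrightarrow> (g has_real_derivative g1 s) (at s)"
    by (auto simp: eventually_nhds_metric dist_real_def)
  have "g1 0 = 0"
    by (rule DERIV_local_max[OF d(3) d(1)]) (use d in auto)
  moreover obtain e where e: "e > 0" "\<And>h. 0 < h \<Longrightarrow> h < e \<Longrightarrow> g1 0 < g1 (0 + h)"
    using DERIV_pos_inc_right[OF assms(3) pos] by blast
  define s where "s = min d e / 2"
  have s: "0 < s" "s < d" "s < e" using d e by (auto simp: s_def)
  have "\<exists>z>0. z < s \<and> g s - g 0 = (s - 0) * g1 z"
    by (rule MVT2) (use s d(3) in auto)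
  then obtain z where z: "0 < z" "z < s" "g s - g 0 = s * g1 z" by auto
  have "g1 z > 0" using e(2)[of z] z s \<open>g1 0 = 0\<close> by simp
  then have "s * g1 z > 0" using s by simp
  then show False using z(3) d(2)[of s] s by simp
qed

lemma has_real_derivative_along_axis:
  assumes "u differentiable (at (x + t *\<^sub>R i))"
  shows "((\<lambda>t. u (x + t *\<^sub>R i)) has_real_derivative partial_deriv i u (x + t *\<^sub>R i)) (at t)"
proof -
  let ?D = "frechet_derivative u (at (x + t *\<^sub>R i))"
  have D: "(u has_derivative ?D) (at (x + t *\<^sub>R i))"
    using assms frechet_derivative_works by blast
  interpret linear ?D by (rule linear_frechet_derivative[OF assms])
  have "((\<lambda>t. x + t *\<^sub>R i) has_derivative (\<lambda>s. s *\<^sub>R i)) (at t)"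
    by (auto intro!: derivative_eq_intros)
  from diff_chain_at[OF this D] have "((\<lambda>t. u (x + t *\<^sub>R i)) has_derivative (\<lambda>s. s * ?D i)) (at t)"
    by (simp add: o_def scale)
  then show ?thesis
    by (simp add: has_field_derivative_def partial_deriv_def mult_commute_abs)
qed

lemma norm_along_axis_deriv:
  fixes y i :: "'a::euclidean_space"
  assumes "norm i = 1" "y + t *\<^sub>R i \<noteq> 0"
  shows "((\<lambda>t. norm (y + t *\<^sub>R i)) has_real_derivative (y \<bullet> i + t) / norm (y + t *\<^sub>R i)) (at t)"
proof -
  have ii: "i \<bullet> i = 1" using assms(1) by (simp add: dot_square_norm)
  have e: "(y + t *\<^sub>R i) \<bullet> (y + t *\<^sub>R i) = y \<bullet> y + 2 * t * (y \<bullet> i) + t\<^sup>2" for t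
    by (simp add: inner_add_left inner_add_right ii inner_commute[of i y] power2_eq_square algebra_simps)
  have n: "norm (y + t *\<^sub>R i) = sqrt (y \<bullet> y + 2 * t * (y \<bullet> i) + t\<^sup>2)" for t
    unfolding norm_eq_sqrt_inner e ..
  have p: "y \<bullet> y + 2 * t * (y \<bullet> i) + t\<^sup>2 > 0" unfolding e[symmetric] using assms(2) by simp
  have "((\<lambda>t. y \<bullet> y + 2 * t * (y \<bullet> i) + t\<^sup>2) has_real_derivative 2 * (y \<bullet> i + t)) (at t)"
    by (auto intro!: derivative_eq_intros)
  then have "((\<lambda>t. sqrt (y \<bullet> y + 2 * t * (y \<bullet> i) + t\<^sup>2)) has_real_derivative
      inverse (sqrt (y \<bullet> y + 2 * t * (y \<bullet> i) + t\<^sup>2)) / 2 * (2 * (y \<bullet> i + t))) (at t)"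
    by (rule DERIV_chain2[where f=sqrt and g="\<lambda>t. y \<bullet> y + 2 * t * (y \<bullet> i) + t\<^sup>2", OF DERIV_real_sqrt[OF p]])
  moreover have "inverse s / 2 * (2 * p) = p / s" for s p :: real by (simp add: inverse_eq_divide)
  ultimately show ?thesis unfolding n by (simp only:)
qed

text \<open>At a maximum of \<open>c u - w(|y - z|)\<close> each pure second derivative is nonpositive; summed over the
  axes, those of the radial function give \<open>w'' + w' (N - 1) / r\<close>.\<close>
lemma laplacian_le_radial_at_max:
  fixes u :: "'a::euclidean_space \<Rightarrow> real"
  assumes "open \<Omega>" "Ck_on 2 \<Omega> u" "x \<in> \<Omega>" "x \<noteq> z"
    and w1: "\<forall>\<^sub>F r in nhds (norm (x - z)). (w has_real_derivative w1 r) (at r)"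
    and w2: "(w1 has_real_derivative w2) (at (norm (x - z)))"
    and max: "\<forall>\<^sub>F y in nhds x. c * u y - w (norm (y - z)) \<le> c * u x - w (norm (x - z))"
  shows "c * laplacian u x \<le> w2 + w1 (norm (x - z)) * (real DIM('a) - 1) / norm (x - z)"
proof -
  define y where "y = x - z"
  define r where "r = norm y"
  have r0: "r > 0" using assms(4) by (simp add: r_def y_def)
  have u2: "Ck_on (Suc (Suc 0)) \<Omega> u" using assms(2) by (simp add: numeral_2_eq_2)
  have ud: "u differentiable (at v)" if "v \<in> \<Omega>" for v
    using u2 that differentiable_on_eq_differentiable_at[OF assms(1)] by (simp only: Ck_on.simps) blast
  have pd: "partial_deriv i u differentiable (at x)" if "i \<in> Basis" for i
    using u2 that assms(3) differentiable_on_eq_differentiable_at[OF assms(1)] by (simp only: Ck_on.simps) blast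
  let ?q = "\<lambda>i. w2 * ((y \<bullet> i) / r)\<^sup>2 + w1 r * ((1 - ((y \<bullet> i) / r)\<^sup>2) / r)"
  have each: "c * partial_deriv i (partial_deriv i u) x \<le> ?q i" if i: "i \<in> Basis" for i
  proof -
    have ni: "norm i = 1" using i by simp
    let ?n = "\<lambda>t. norm (y + t *\<^sub>R i)"
    let ?g = "\<lambda>t. c * u (x + t *\<^sub>R i) - w (?n t)"
    have lin: "((\<lambda>t. x + t *\<^sub>R i) \<longlongrightarrow> x) (nhds 0)" "(?n \<longlongrightarrow> r) (nhds 0)"
    proof -
      have "((\<lambda>t. x + t *\<^sub>R i) \<longlongrightarrow> x + 0 *\<^sub>R i) (nhds 0)" "(?n \<longlongrightarrow> norm (y + 0 *\<^sub>R i)) (nhds 0)"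
        by (intro tendsto_intros filterlim_ident)+
      then show "((\<lambda>t. x + t *\<^sub>R i) \<longlongrightarrow> x) (nhds 0)" "(?n \<longlongrightarrow> r) (nhds 0)" by (simp_all add: r_def)
    qed
    have in\<Omega>: "\<forall>\<^sub>F t in nhds 0. x + t *\<^sub>R i \<in> \<Omega>"
      by (rule topological_tendstoD[OF lin(1) assms(1,3)])
    have npos: "\<forall>\<^sub>F t in nhds 0. ?n t > 0" using lin(2) r0 by (rule order_tendstoD)
    have wev: "\<forall>\<^sub>F t in nhds 0. (w has_real_derivative w1 (?n t)) (at (?n t))"
      using w1 filterlim_iff[THEN iffD1, OF lin(2)] by (auto simp: r_def y_def)
    have "c * partial_deriv i (partial_deriv i u) x - ?q i \<le> 0"
    proof (rule second_derivative_nonpos_at_max[where g="?g"])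
      have "\<forall>\<^sub>F t in nhds 0. c * u (x + t *\<^sub>R i) - w (norm (x + t *\<^sub>R i - z)) \<le> c * u x - w (norm (x - z))"
        using max filterlim_iff[THEN iffD1, OF lin(1)] by auto
      then show "\<forall>\<^sub>F t in nhds 0. ?g t \<le> ?g 0" by (simp add: y_def algebra_simps)
      show "\<forall>\<^sub>F t in nhds 0. (?g has_real_derivative c * partial_deriv i u (x + t *\<^sub>R i) - w1 (?n t) * ((y \<bullet> i + t) / ?n t)) (at t)"
        using in\<Omega> npos wev
      proof eventually_elim
        case (elim t)
        have "((\<lambda>t. w (?n t)) has_real_derivative w1 (?n t) * ((y \<bullet> i + t) / ?n t)) (at t)"
          by (rule DERIV_chain2[where f=w and g="?n", OF elim(3)], rule norm_along_axis_deriv[OF ni]) (use elim(2) in auto)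
        then show ?case
          by (intro DERIV_diff DERIV_cmult has_real_derivative_along_axis ud elim(1))
      qed
      have n0: "(?n has_real_derivative (y \<bullet> i + 0) / ?n 0) (at 0)"
        by (rule norm_along_axis_deriv[OF ni]) (use r0 in \<open>auto simp: r_def\<close>)
      then have n0': "(?n has_real_derivative (y \<bullet> i) / r) (at 0)" by (simp add: r_def)
      have "(w1 has_real_derivative w2) (at (?n 0))" using w2 by (simp add: y_def)
      then have A: "((\<lambda>t. w1 (?n t)) has_real_derivative w2 * ((y \<bullet> i) / r)) (at 0)"
        by (rule DERIV_chain2[where f=w1, OF _ n0'])
      have B0: "((\<lambda>t. (y \<bullet> i + t) / ?n t) has_real_derivative (1 * ?n 0 - (y \<bullet> i + 0) * ((y \<bullet> i) / r)) / (?n 0 * ?n 0)) (at 0)"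
        by (rule DERIV_divide[OF _ n0']) (use r0 in \<open>auto intro!: derivative_eq_intros simp: r_def\<close>)
      have B: "((\<lambda>t. (y \<bullet> i + t) / ?n t) has_real_derivative (1 - ((y \<bullet> i) / r)\<^sup>2) / r) (at 0)"
      proof -
        have "(1 * r - (p + 0) * (p / r)) / (r * r) = (1 - (p / r)\<^sup>2) / r" for p
          using r0 by (simp add: power2_eq_square field_simps)
        with B0 show ?thesis by (simp add: r_def)
      qed
      have C: "((\<lambda>t. w1 (?n t) * ((y \<bullet> i + t) / ?n t)) has_real_derivative ?q i) (at 0)"
      proof -
        have "((\<lambda>t. w1 (?n t) * ((y \<bullet> i + t) / ?n t)) has_real_derivative
          (w2 * ((y \<bullet> i) / r)) * ((y \<bullet> i + 0) / ?n 0) + ((1 - ((y \<bullet> i) / r)\<^sup>2) / r) * w1 (?n 0)) (at 0)"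
          by (rule DERIV_mult[OF A B])
        then show ?thesis by (simp add: r_def power2_eq_square mult_ac)
      qed
      have E: "((\<lambda>t. c * partial_deriv i u (x + t *\<^sub>R i)) has_real_derivative c * partial_deriv i (partial_deriv i u) x) (at 0)"
        using DERIV_cmult[OF has_real_derivative_along_axis[of "partial_deriv i u" x 0 i], of c] pd[OF i] by simp
      show "((\<lambda>t. c * partial_deriv i u (x + t *\<^sub>R i) - w1 (?n t) * ((y \<bullet> i + t) / ?n t)) has_real_derivative
          c * partial_deriv i (partial_deriv i u) x - ?q i) (at 0)"
        by (rule DERIV_diff[OF E C])
    qed
    then show ?thesis by simp
  qed
  have S: "(\<Sum>i\<in>Basis. ((y \<bullet> i) / r)\<^sup>2) = 1"
  proof -
    have "(\<Sum>i\<in>Basis. ((y \<bullet> i) / r)\<^sup>2) = (\<Sum>i\<in>Basis. (y \<bullet> i)\<^sup>2) / r\<^sup>2"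
      by (simp add: power_divide sum_divide_distrib)
    also have "(\<Sum>i\<in>Basis. (y \<bullet> i)\<^sup>2) = r\<^sup>2"
      unfolding r_def power2_norm_eq_inner by (subst euclidean_inner) (simp add: power2_eq_square)
    finally show ?thesis using r0 by simp
  qed
  have "c * laplacian u x = (\<Sum>i\<in>Basis. c * partial_deriv i (partial_deriv i u) x)"
    by (simp add: laplacian_def sum_distrib_left)
  also have "\<dots> \<le> (\<Sum>i\<in>Basis. ?q i)" by (rule sum_mono) (rule each)
  also have "\<dots> = w2 * (\<Sum>i\<in>Basis. ((y \<bullet> i) / r)\<^sup>2) + w1 r * ((\<Sum>i\<in>(Basis::'a set). 1 - ((y \<bullet> i) / r)\<^sup>2) / r)"
    by (simp only: sum.distrib sum_distrib_left sum_divide_distrib)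
  also have "(\<Sum>i\<in>(Basis::'a set). 1 - ((y \<bullet> i) / r)\<^sup>2) = real DIM('a) - 1"
    by (simp only: sum_subtractf S) simp
  finally have "c * laplacian u x \<le> w2 * 1 + w1 r * ((real DIM('a) - 1) / r)" unfolding S .
  then show ?thesis by (simp add: r_def y_def)
qed

lemma compact_strip:
  fixes \<Omega> :: "'a::euclidean_space set"
  assumes "smooth_bounded_domain \<Omega>" "\<alpha> > 0"
  shows "compact {x \<in> \<Omega>. \<alpha> \<le> bdist \<Omega> x \<and> bdist \<Omega> x \<le> \<beta>}"
proof -
  have \<Omega>: "bounded \<Omega>" "open \<Omega>" using assms by (auto simp: smooth_bounded_domain_def)
  have cont: "continuous_on UNIV (bdist \<Omega>)" unfolding bdist_def[abs_def] by (intro continuous_intros)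
  have "{x \<in> \<Omega>. \<alpha> \<le> bdist \<Omega> x \<and> bdist \<Omega> x \<le> \<beta>} = closure \<Omega> \<inter> {x. \<alpha> \<le> bdist \<Omega> x} \<inter> {x. bdist \<Omega> x \<le> \<beta>}"
  proof safe
    fix x assume x: "x \<in> closure \<Omega>" "\<alpha> \<le> bdist \<Omega> x"
    then have "x \<notin> frontier \<Omega>" using assms(2) by (auto simp: bdist_def)
    then show "x \<in> \<Omega>" using x(1) \<Omega>(2) by (auto simp: frontier_def interior_open)
  qed (use closure_subset in auto)
  moreover have "closed {x. \<alpha> \<le> bdist \<Omega> x}" "closed {x. bdist \<Omega> x \<le> \<beta>}"
    using cont by (auto intro!: closed_Collect_le continuous_intros)
  moreover have "bounded (closure \<Omega> \<inter> {x. \<alpha> \<le> bdist \<Omega> x} \<inter> {x. bdist \<Omega> x \<le> \<beta>})"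
    by (rule bounded_subset[OF bounded_closure[OF \<Omega>(1)]]) auto
  ultimately show ?thesis unfolding compact_eq_bounded_closed by (simp add: closed_Int)
qed


lemma bdist_continuous: "continuous_on S (bdist \<Omega>)"
  unfolding bdist_def[abs_def] by (intro continuous_intros)

lemma nonincreasing_if_deriv_nonpos:
  fixes G :: "real \<Rightarrow> real"
  assumes "\<And>t. \<alpha> < t \<Longrightarrow> t < \<beta> \<Longrightarrow> (G has_real_derivative G1 t) (at t) \<and> G1 t \<le> 0"
    and "\<alpha> < s" "s \<le> t" "t < \<beta>"
  shows "G t \<le> G s"
proof (rule DERIV_nonpos_imp_nonincreasing[OF assms(3)])
  fix x assume "s \<le> x" "x \<le> t"
  then show "\<exists>y. (G has_real_derivative y) (at x) \<and> y \<le> 0" using assms(1)[of x] assms(2,4) by auto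
qed

text \<open>The constant \<open>C\<close> bounds the curvature term \<open>(N - 1) / |x - z|\<close> at points closer to the boundary
  than \<open>R / 2\<close>.\<close>
locale touching_ball_domain =
  fixes \<Omega> :: "'a::euclidean_space set" and R C :: real
  assumes C_def: "C = 2 * real DIM('a) / R" and \<Omega>: "smooth_bounded_domain \<Omega>" and R_pos: "R > 0"
    and balls: "\<And>x. x \<in> \<Omega> \<Longrightarrow> bdist \<Omega> x < R \<Longrightarrow> touched_by_balls \<Omega> R x"
begin

lemma open_\<Omega>: "open \<Omega>" using \<Omega> by (simp add: smooth_bounded_domain_def)

lemma curvature_le: "r \<ge> R / 2 \<Longrightarrow> 0 \<le> p \<Longrightarrow> p * (real DIM('a) - 1) / r \<le> C * p"
proof -
  assume r: "r \<ge> R / 2" and p: "0 \<le> p"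
  have "(real DIM('a) - 1) / r \<le> real DIM('a) / (R / 2)"
    using r R_pos DIM_positive[where 'a='a] by (intro frac_le) auto
  then have "p * ((real DIM('a) - 1) / r) \<le> p * (real DIM('a) / (R / 2))" using p by (rule mult_left_mono)
  then show ?thesis by (simp add: C_def mult_ac)
qed

text \<open>Where \<open>d < t0\<close> and where \<open>d = \<delta>\<close> the quotient \<open>v / w\<close> is at most \<open>1\<close>, so a value above \<open>1\<close> forces a
  maximum over the compact strip \<open>t0 \<le> d \<le> \<delta>\<close> that is also a local maximum in \<open>\<Omega>\<close>.\<close>
lemma quotient_attains_max:
  fixes v w :: "'a \<Rightarrow> real"
  assumes s: "0 \<le> s" "s < t0"
    and w: "\<And>x. x \<in> \<Omega> \<Longrightarrow> s < bdist \<Omega> x \<Longrightarrow> bdist \<Omega> x \<le> \<delta> \<Longrightarrow> w x > 0"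
    and edge: "\<And>x. x \<in> \<Omega> \<Longrightarrow> s < bdist \<Omega> x \<Longrightarrow> bdist \<Omega> x \<le> \<delta> \<Longrightarrow> bdist \<Omega> x < t0 \<or> bdist \<Omega> x = \<delta> \<Longrightarrow> v x \<le> w x"
    and cont: "continuous_on {x \<in> \<Omega>. t0 \<le> bdist \<Omega> x \<and> bdist \<Omega> x \<le> \<delta>} v"
      "continuous_on {x \<in> \<Omega>. t0 \<le> bdist \<Omega> x \<and> bdist \<Omega> x \<le> \<delta>} w"
    and x1: "x1 \<in> \<Omega>" "s < bdist \<Omega> x1" "bdist \<Omega> x1 < \<delta>" "w x1 < v x1"
  obtains x0 m where "x0 \<in> \<Omega>" "s < bdist \<Omega> x0" "bdist \<Omega> x0 < \<delta>" "1 < m" "v x0 = m * w x0"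
    "\<forall>\<^sub>F y in nhds x0. v y \<le> m * w y"
proof -
  let ?d = "bdist \<Omega>"
  define S where "S = {x \<in> \<Omega>. t0 \<le> ?d x \<and> ?d x \<le> \<delta>}"
  define q where "q x = v x / w x" for x
  have small: "q x \<le> 1" if x: "x \<in> \<Omega>" "s < ?d x" "?d x \<le> \<delta>" "?d x < t0 \<or> ?d x = \<delta>" for x
    using edge[OF x] w[OF x(1-3)] by (simp add: q_def)
  have q1: "q x1 > 1" using x1(4) w[OF x1(1,2)] x1(3) by (simp add: q_def)
  have x1S: "x1 \<in> S" unfolding S_def using small[of x1] q1 x1 by (auto simp: not_less[symmetric])
  have "compact S" unfolding S_def by (rule compact_strip[OF \<Omega>]) (use s in simp)
  moreover have "continuous_on S q" unfolding q_def[abs_def] S_def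
  proof (intro continuous_on_divide cont ballI)
    fix x assume "x \<in> {x \<in> \<Omega>. t0 \<le> ?d x \<and> ?d x \<le> \<delta>}"
    then have "w x > 0" using s by (intro w) auto
    then show "w x \<noteq> 0" by simp
  qed
  ultimately obtain x0 where x0: "x0 \<in> S" "\<And>y. y \<in> S \<Longrightarrow> q y \<le> q x0"
    using continuous_attains_sup[of S q] x1S by (metis empty_iff)
  have m: "q x0 > 1" using x0(2)[OF x1S] q1 by simp
  have x0\<Omega>: "x0 \<in> \<Omega>" "s < ?d x0" using x0(1) s by (auto simp: S_def)
  have "?d x0 \<noteq> \<delta>" using small[of x0] m x0\<Omega> by auto
  then have x0\<delta>: "?d x0 < \<delta>" using x0(1) by (simp add: S_def)
  have wq: "v y = q y * w y" "w y > 0" if "y \<in> \<Omega>" "s < ?d y" "?d y < \<delta>" for y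
    using w[OF that(1,2)] that(3) by (simp_all add: q_def)
  have "isCont ?d x0" using bdist_continuous[of UNIV \<Omega>] by (simp add: continuous_on_eq_continuous_at)
  then have dl: "(?d \<longlongrightarrow> ?d x0) (nhds x0)" by (simp add: isCont_def tendsto_nhds_iff)
  have "\<forall>\<^sub>F y in nhds x0. y \<in> \<Omega>" using x0\<Omega>(1) open_\<Omega> by (simp add: eventually_nhds_in_open)
  moreover have "\<forall>\<^sub>F y in nhds x0. s < ?d y" "\<forall>\<^sub>F y in nhds x0. ?d y < \<delta>"
    using order_tendstoD[OF dl] x0\<Omega> x0\<delta> by auto
  ultimately have "\<forall>\<^sub>F y in nhds x0. v y \<le> q x0 * w y"
  proof eventually_elim
    case (elim y)
    have "q y \<le> q x0"
    proof (cases "y \<in> S")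
      case True then show ?thesis by (rule x0(2))
    next
      case False then show ?thesis using small[of y] elim m by (auto simp: S_def)
    qed
    then show ?case using wq[OF elim] by (simp add: mult_right_mono)
  qed
  then show ?thesis using that[OF x0\<Omega> x0\<delta> m] wq(1)[OF x0\<Omega> x0\<delta>] by blast
qed

text \<open>For decreasing \<open>G\<close> the minorant \<open>R - |y - z| \<le> d y\<close> gives \<open>G (d y) \<le> G (R - |y - z|)\<close> with equality at
  \<open>x\<close>, so \<open>x\<close> is also a maximum of \<open>u\<close> minus the smooth function on the right.\<close>
lemma laplacian_le_at_max_of_diff:
  assumes u: "Ck_on 2 \<Omega> u" and x: "x \<in> \<Omega>" and d: "\<alpha> < bdist \<Omega> x" "bdist \<Omega> x < \<beta>" "bdist \<Omega> x < R / 2"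
    and G: "\<And>t. \<alpha> < t \<Longrightarrow> t < \<beta> \<Longrightarrow> (G has_real_derivative G1 t) (at t) \<and> (G1 has_real_derivative G2 t) (at t) \<and> G1 t \<le> 0"
    and max: "\<forall>\<^sub>F y in nhds x. u y - G (bdist \<Omega> y) \<le> u x - G (bdist \<Omega> x)"
  shows "laplacian u x \<le> G2 (bdist \<Omega> x) - C * G1 (bdist \<Omega> x)"
proof -
  let ?d = "bdist \<Omega> x"
  have dR: "?d < R" using d(3) R_pos by simp
  obtain z where z: "norm (x - z) = R - ?d" "\<And>x'. R - norm (x' - z) \<le> bdist \<Omega> x'"
    using balls[OF x dR] unfolding touched_by_balls_def by blast
  let ?w = "\<lambda>r. G (R - r)" let ?w1 = "\<lambda>r. - G1 (R - r)"
  have "1 * laplacian u x \<le> G2 ?d + ?w1 (norm (x - z)) * (real DIM('a) - 1) / norm (x - z)"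
  proof (rule laplacian_le_radial_at_max[OF open_\<Omega> u x, where w="?w"])
    show "x \<noteq> z" using z(1) d(3) R_pos by auto
    have "\<forall>\<^sub>F r in nhds (R - ?d). R - \<beta> < r \<and> r < R - \<alpha>"
      using d by (intro eventually_conj order_tendstoD[OF filterlim_ident]) auto
    then show "\<forall>\<^sub>F r in nhds (norm (x - z)). (?w has_real_derivative ?w1 r) (at r)"
      unfolding z(1)
    proof eventually_elim
      case (elim r)
      have "(?w has_real_derivative G1 (R - r) * (0 - 1)) (at r)"
        by (rule DERIV_chain2[where f=G]) (use G[of "R - r"] elim in \<open>auto intro!: derivative_eq_intros\<close>)
      then show ?case by simp
    qed
    have "((\<lambda>r. G1 (R - r)) has_real_derivative G2 ?d * (0 - 1)) (at (R - ?d))"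
      by (rule DERIV_chain2[where f=G1]) (use G[OF d(1,2)] in \<open>auto intro!: derivative_eq_intros\<close>)
    then show "(?w1 has_real_derivative G2 ?d) (at (norm (x - z)))"
      unfolding z(1) by (auto intro!: derivative_eq_intros)
    have "((\<lambda>y. R - norm (y - z)) \<longlongrightarrow> R - norm (x - z)) (nhds x)" by (intro tendsto_intros filterlim_ident)
    then have "\<forall>\<^sub>F y in nhds x. \<alpha> < R - norm (y - z)" using d z(1) by (intro order_tendstoD(1)) auto
    moreover have "isCont (bdist \<Omega>) x" using bdist_continuous[of UNIV \<Omega>] by (simp add: continuous_on_eq_continuous_at)
    then have "(bdist \<Omega> \<longlongrightarrow> ?d) (nhds x)" by (simp add: isCont_def tendsto_nhds_iff)
    then have "\<forall>\<^sub>F y in nhds x. bdist \<Omega> y < \<beta>" using d(2) by (rule order_tendstoD(2))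
    ultimately show "\<forall>\<^sub>F y in nhds x. 1 * u y - ?w (norm (y - z)) \<le> 1 * u x - ?w (norm (x - z))"
      using max
    proof eventually_elim
      case (elim y)
      have "G (bdist \<Omega> y) \<le> G (R - norm (y - z))"
        by (rule nonincreasing_if_deriv_nonpos[of \<alpha> \<beta> G G1]) (use G elim z(2) in auto)
      then show ?case using elim z(1) by simp
    qed
  qed
  also have "?w1 (norm (x - z)) * (real DIM('a) - 1) / norm (x - z) \<le> C * ?w1 (norm (x - z))"
    by (rule curvature_le) (use z(1) d(3) G[OF d(1,2)] in auto)
  finally show ?thesis by (simp add: z(1))
qed

text \<open>The mirror image, with the majorant \<open>|y - z| - R\<close> of the distance given by the outer ball.\<close>
lemma laplacian_ge_at_max_of_diff:
  assumes u: "Ck_on 2 \<Omega> u" and x: "x \<in> \<Omega>" and d: "\<alpha> < bdist \<Omega> x" "bdist \<Omega> x < \<beta>" "bdist \<Omega> x < R / 2" "\<alpha> \<le> 0"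
    and G: "\<And>t. \<alpha> < t \<Longrightarrow> t < \<beta> \<Longrightarrow> (G has_real_derivative G1 t) (at t) \<and> (G1 has_real_derivative G2 t) (at t) \<and> G1 t \<le> 0"
    and max: "\<forall>\<^sub>F y in nhds x. G (bdist \<Omega> y) - m * u y \<le> G (bdist \<Omega> x) - m * u x"
  shows "G2 (bdist \<Omega> x) + C * G1 (bdist \<Omega> x) \<le> m * laplacian u x"
proof -
  let ?d = "bdist \<Omega> x"
  have d0: "?d \<ge> 0" by (simp add: bdist_def infdist_nonneg)
  have dR: "?d < R" using d(3) R_pos by simp
  obtain z where z: "norm (x - z) = R + ?d" "\<And>x'. x' \<in> \<Omega> \<Longrightarrow> bdist \<Omega> x' \<le> norm (x' - z) - R"
    using balls[OF x dR] unfolding touched_by_balls_def by blast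
  let ?w = "\<lambda>r. - G (r - R)" let ?w1 = "\<lambda>r. - G1 (r - R)"
  have "(- m) * laplacian u x \<le> - G2 ?d + ?w1 (norm (x - z)) * (real DIM('a) - 1) / norm (x - z)"
  proof (rule laplacian_le_radial_at_max[OF open_\<Omega> u x, where w="?w"])
    show "x \<noteq> z" using z(1) d0 R_pos by auto
    have "\<forall>\<^sub>F r in nhds (R + ?d). R + \<alpha> < r \<and> r < R + \<beta>"
      using d by (intro eventually_conj order_tendstoD[OF filterlim_ident]) auto
    then show "\<forall>\<^sub>F r in nhds (norm (x - z)). (?w has_real_derivative ?w1 r) (at r)"
      unfolding z(1)
    proof eventually_elim
      case (elim r)
      have "((\<lambda>r. G (r - R)) has_real_derivative G1 (r - R) * (1 - 0)) (at r)"
        by (rule DERIV_chain2[where f=G]) (use G[of "r - R"] elim in \<open>auto intro!: derivative_eq_intros\<close>)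
      then show ?case by (auto intro!: derivative_eq_intros)
    qed
    have "((\<lambda>r. G1 (r - R)) has_real_derivative G2 ?d * (1 - 0)) (at (R + ?d))"
      by (rule DERIV_chain2[where f=G1]) (use G[OF d(1,2)] in \<open>auto intro!: derivative_eq_intros\<close>)
    then show "(?w1 has_real_derivative - G2 ?d) (at (norm (x - z)))"
      unfolding z(1) by (auto intro!: derivative_eq_intros)
    have "((\<lambda>y. norm (y - z) - R) \<longlongrightarrow> norm (x - z) - R) (nhds x)" by (intro tendsto_intros filterlim_ident)
    then have "\<forall>\<^sub>F y in nhds x. norm (y - z) - R < \<beta>" using d z(1) by (intro order_tendstoD(2)) auto
    moreover have "isCont (bdist \<Omega>) x" using bdist_continuous[of UNIV \<Omega>] by (simp add: continuous_on_eq_continuous_at)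
    then have "(bdist \<Omega> \<longlongrightarrow> ?d) (nhds x)" by (simp add: isCont_def tendsto_nhds_iff)
    then have "\<forall>\<^sub>F y in nhds x. \<alpha> < bdist \<Omega> y" using d(1) by (rule order_tendstoD(1))
    moreover have "\<forall>\<^sub>F y in nhds x. y \<in> \<Omega>" using x open_\<Omega> by (simp add: eventually_nhds_in_open)
    ultimately show "\<forall>\<^sub>F y in nhds x. (- m) * u y - ?w (norm (y - z)) \<le> (- m) * u x - ?w (norm (x - z))"
      using max
    proof eventually_elim
      case (elim y)
      have "G (norm (y - z) - R) \<le> G (bdist \<Omega> y)"
        by (rule nonincreasing_if_deriv_nonpos[of \<alpha> \<beta> G G1]) (use G elim z(2) in auto)
      then show ?case using elim z(1) by simp
    qed
  qed
  also have "?w1 (norm (x - z)) * (real DIM('a) - 1) / norm (x - z) \<le> C * ?w1 (norm (x - z))"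
    by (rule curvature_le) (use z(1) d0 d R_pos G[OF d(1,2)] in auto)
  finally show ?thesis by (simp add: z(1))
qed

end

locale large_solution_setting = touching_ball_domain \<Omega> R C for \<Omega> :: "'a::euclidean_space set" and R C +
  fixes a :: real and b u :: "'a \<Rightarrow> real" and f :: "real \<Rightarrow> real"
  assumes u: "large_solution \<Omega> a b f u"
    and f_quot: "\<And>s t. 0 < s \<Longrightarrow> s < t \<Longrightarrow> f s / s < f t / t"
    and f_super: "\<And>m s t. m > 1 \<Longrightarrow> s \<ge> 0 \<Longrightarrow> t > m * s \<Longrightarrow> m * f s < f t"
begin

lemma u_facts: "Ck_on 2 \<Omega> u" "x \<in> \<Omega> \<Longrightarrow> u x \<ge> 0"
  "x \<in> \<Omega> \<Longrightarrow> laplacian u x = b x * f (u x) - a * u x" "filterlim u at_top (near_boundary \<Omega>)"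
  using u unfolding large_solution_def by (auto simp: algebra_simps)

lemma u_cont: "continuous_on S u" if "S \<subseteq> \<Omega>"
proof -
  have "u differentiable_on \<Omega>" using u_facts(1) by (simp add: numeral_2_eq_2)
  then show ?thesis using that differentiable_imp_continuous_on continuous_on_subset by blast
qed

lemma near_boundaryE:
  assumes "eventually Pr (near_boundary \<Omega>)"
  obtains e where "e > 0" "\<And>x. x \<in> \<Omega> \<Longrightarrow> 0 < bdist \<Omega> x \<Longrightarrow> bdist \<Omega> x < e \<Longrightarrow> Pr x"
proof -
  have "\<exists>Q. (\<exists>e>0. \<forall>y>0. y < e \<longrightarrow> Q y) \<and> (\<forall>x. Q (bdist \<Omega> x) \<longrightarrow> x \<in> \<Omega> \<longrightarrow> Pr x)"
    using assms unfolding near_boundary_def eventually_inf_principal eventually_filtercomap eventually_at_right_field by blast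
  then show ?thesis using that by blast
qed

text \<open>If \<open>u > G (d) + M\<close> somewhere, then \<open>u / (G (d) + M)\<close> attains a maximum \<open>m > 1\<close>, since \<open>G\<close> blows up on
  one side of the strip and \<open>M\<close> dominates \<open>u\<close> on the other.  At the maximum point
  \<open>u = m (w + M)\<close> with \<open>w = G (d)\<close>, and the differential inequality gives
  \<open>b f(u) - a u \<le> m (b f(w) - |a| w)\<close>.  But \<open>f(u) / u > f(w) / w\<close> yields
  \<open>b f(u) > m b f(w) + m M (b f(w) / w)\<close>, and \<open>b f(w) / w \<ge> |a|\<close> by hypothesis: contradiction.\<close>
lemma upper_comparison:
  assumes \<sigma>: "0 < \<sigma>" "\<sigma> < \<delta>" "\<delta> < \<beta>" "\<delta> < R / 2" and M: "M \<ge> 0" "\<And>x. x \<in> \<Omega> \<Longrightarrow> bdist \<Omega> x = \<delta> \<Longrightarrow> u x \<le> M"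
    and G: "\<And>t. \<sigma> < t \<Longrightarrow> t < \<beta> \<Longrightarrow> G t > 0 \<and> (G has_real_derivative G1 t) (at t) \<and> (G1 has_real_derivative G2 t) (at t) \<and> G1 t \<le> 0"
    and Ginf: "filterlim G at_top (at_right \<sigma>)"
    and b: "\<And>x. x \<in> \<Omega> \<Longrightarrow> \<sigma> < bdist \<Omega> x \<Longrightarrow> bdist \<Omega> x < \<delta> \<Longrightarrow> b x > 0"
    and super: "\<And>x. x \<in> \<Omega> \<Longrightarrow> \<sigma> < bdist \<Omega> x \<Longrightarrow> bdist \<Omega> x < \<delta> \<Longrightarrow>
      G2 (bdist \<Omega> x) - C * G1 (bdist \<Omega> x) + \<bar>a\<bar> * G (bdist \<Omega> x) \<le> b x * f (G (bdist \<Omega> x))"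
    and strong: "\<And>x. x \<in> \<Omega> \<Longrightarrow> \<sigma> < bdist \<Omega> x \<Longrightarrow> bdist \<Omega> x < \<delta> \<Longrightarrow> \<bar>a\<bar> * G (bdist \<Omega> x) \<le> b x * f (G (bdist \<Omega> x))"
    and x1: "x1 \<in> \<Omega>" "\<sigma> < bdist \<Omega> x1" "bdist \<Omega> x1 < \<delta>"
  shows "u x1 \<le> G (bdist \<Omega> x1) + M"
proof (rule ccontr)
  let ?d = "bdist \<Omega>"
  assume "\<not> u x1 \<le> G (?d x1) + M"
  then have big: "u x1 > G (?d x1) + M" by simp
  have S0: "compact {x \<in> \<Omega>. \<sigma> \<le> ?d x \<and> ?d x \<le> \<delta>}" by (rule compact_strip[OF \<Omega> \<sigma>(1)])
  have "compact (u ` {x \<in> \<Omega>. \<sigma> \<le> ?d x \<and> ?d x \<le> \<delta>})"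
    by (rule compact_continuous_image[OF u_cont S0]) auto
  then have "bounded (u ` {x \<in> \<Omega>. \<sigma> \<le> ?d x \<and> ?d x \<le> \<delta>})" by (rule compact_imp_bounded)
  then obtain U where U: "\<And>x. x \<in> \<Omega> \<Longrightarrow> \<sigma> \<le> ?d x \<Longrightarrow> ?d x \<le> \<delta> \<Longrightarrow> \<bar>u x\<bar> \<le> U"
    unfolding bounded_iff by auto
  have "\<forall>\<^sub>F t in at_right \<sigma>. U \<le> G t" using Ginf by (simp add: filterlim_at_top)
  then obtain t0 where t0: "t0 > \<sigma>" "\<And>t. \<sigma> < t \<Longrightarrow> t < t0 \<Longrightarrow> U \<le> G t"
    unfolding eventually_at_right_field by auto
  have Gp: "G (?d x) > 0" if "\<sigma> < ?d x" "?d x \<le> \<delta>" for x using G[of "?d x"] that \<sigma> by auto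
  have edge: "u x \<le> G (?d x) + M" if x: "x \<in> \<Omega>" "\<sigma> < ?d x" "?d x \<le> \<delta>" "?d x < t0 \<or> ?d x = \<delta>" for x
  proof (cases "?d x = \<delta>")
    case True then show ?thesis using M(2)[OF x(1)] Gp[OF x(2,3)] by auto
  next
    case False then show ?thesis using t0(2)[of "?d x"] U[of x] x M(1) by auto
  qed
  let ?S = "{x \<in> \<Omega>. t0 \<le> ?d x \<and> ?d x \<le> \<delta>}"
  have "continuous_on {\<sigma><..<\<beta>} G"
    by (intro continuous_at_imp_continuous_on ballI) (use G in \<open>auto intro: DERIV_isCont\<close>)
  then have "continuous_on ?S (\<lambda>x. G (?d x))"
    by (rule continuous_on_compose2[OF _ bdist_continuous]) (use t0 \<sigma> in auto)
  then have Gcont: "continuous_on ?S (\<lambda>x. G (?d x) + M)" by (intro continuous_on_add continuous_on_const)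
  obtain x0 m where x0\<Omega>: "x0 \<in> \<Omega>" "\<sigma> < ?d x0" "?d x0 < \<delta>" and m: "1 < m" and u0: "u x0 = m * (G (?d x0) + M)"
    and quot: "\<forall>\<^sub>F y in nhds x0. u y \<le> m * (G (?d y) + M)"
  proof (rule quotient_attains_max[OF less_imp_le[OF \<sigma>(1)] t0(1) _ edge _ Gcont x1 big])
    show "0 < G (?d x) + M" if "\<sigma> < ?d x" "?d x \<le> \<delta>" for x using Gp[OF that] M(1) by simp
    show "continuous_on ?S u" by (rule u_cont) auto
  qed
  define w where "w = G (?d x0)"
  have w: "w > 0" using G[of "?d x0"] x0\<Omega> \<sigma> by (simp add: w_def)
  note u0 = u0[folded w_def]
  have max: "\<forall>\<^sub>F y in nhds x0. u y - m * (G (?d y) + M) \<le> u x0 - m * (G (?d x0) + M)"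
    using quot by eventually_elim (simp add: u0 w_def)
  have "laplacian u x0 \<le> m * G2 (?d x0) - C * (m * G1 (?d x0))"
  proof (rule laplacian_le_at_max_of_diff[OF u_facts(1) x0\<Omega>(1,2) _ _ _ max])
    show "?d x0 < \<beta>" "?d x0 < R / 2" using x0\<Omega> \<sigma> by auto
    fix t assume t: "\<sigma> < t" "t < \<beta>"
    have "((\<lambda>t. m * (G t + M)) has_real_derivative m * G1 t) (at t)" "((\<lambda>t. m * G1 t) has_real_derivative m * G2 t) (at t)"
      using G[OF t] by (auto intro!: derivative_eq_intros)
    moreover have "m * G1 t \<le> 0" using G[OF t] m by (simp add: mult_le_0_iff)
    ultimately show "((\<lambda>t. m * (G t + M)) has_real_derivative m * G1 t) (at t) \<and> ((\<lambda>t. m * G1 t) has_real_derivative m * G2 t) (at t) \<and> m * G1 t \<le> 0"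
      by blast
  qed
  also have "\<dots> = m * (G2 (?d x0) - C * G1 (?d x0))" by (simp add: algebra_simps)
  also have "\<dots> \<le> m * (b x0 * f w - \<bar>a\<bar> * w)"
    using super[OF x0\<Omega>] m by (intro mult_left_mono) (auto simp: w_def)
  finally have 1: "b x0 * f (u x0) - a * u x0 \<le> m * (b x0 * f w - \<bar>a\<bar> * w)"
    unfolding u_facts(3)[OF x0\<Omega>(1)] .
  have uw: "u x0 > w"
  proof -
    have "w + M \<le> m * (w + M)" using m w M(1) mult_right_mono[of 1 m "w + M"] by simp
    moreover have "1 * w < m * w" using m w by (intro mult_strict_right_mono) auto
    moreover have "m * (w + M) \<ge> m * w" using m M(1) by (intro mult_left_mono) auto
    ultimately show ?thesis using u0 by simp
  qed
  have "f w / w < f (u x0) / u x0" by (rule f_quot[OF w uw])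
  then have "u x0 * (f w / w) < f (u x0)" using uw w by (simp add: field_simps)
  then have 2: "b x0 * (u x0 * (f w / w)) < b x0 * f (u x0)" using b[OF x0\<Omega>] by (rule mult_strict_left_mono)
  have "B * (m * (w + M) * (v / w)) = m * (B * v) + m * M * (B * v / w)" for B v
    using w by (simp add: field_simps)
  then have "b x0 * (u x0 * (f w / w)) = m * (b x0 * f w) + m * M * (b x0 * f w / w)"
    unfolding u0 .
  moreover have "m * M * \<bar>a\<bar> \<le> m * M * (b x0 * f w / w)"
    using strong[OF x0\<Omega>] w m M(1) by (intro mult_left_mono) (simp_all add: w_def pos_le_divide_eq)
  moreover have "a * u x0 \<le> \<bar>a\<bar> * u x0" using uw w by (intro mult_right_mono) auto
  moreover have "\<bar>a\<bar> * u x0 = m * \<bar>a\<bar> * w + m * M * \<bar>a\<bar>" by (simp add: u0 algebra_simps)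
  moreover have "m * (b x0 * f w - \<bar>a\<bar> * w) = m * (b x0 * f w) - m * \<bar>a\<bar> * w" by (simp add: algebra_simps)
  ultimately show False using 1 2 by linarith
qed

text \<open>Here \<open>G (d) / (u + M)\<close> is maximised.  At the maximum point \<open>w = G (d) = m (u + M)\<close>, and the
  inequality gives \<open>b f(w) + |a| w \<le> m (b f(u) - a u)\<close>.  As \<open>m u \<le> w\<close>, the term \<open>|a| w\<close> outweighs
  \<open>- m a u\<close> whatever the sign of \<open>a\<close>, and \<open>f(w) \<le> m f(u)\<close> remains, which contradicts \<open>f_super\<close>.\<close>
lemma lower_comparison:
  assumes \<alpha>: "\<alpha> \<le> 0" "0 < \<delta>" "\<delta> < \<beta>" "\<delta> < R / 2" and M: "M > 0" "G \<delta> \<le> M"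
    and G: "\<And>t. \<alpha> < t \<Longrightarrow> t < \<beta> \<Longrightarrow> G t > 0 \<and> (G has_real_derivative G1 t) (at t) \<and> (G1 has_real_derivative G2 t) (at t) \<and> G1 t \<le> 0"
    and Gbound: "\<And>t. 0 < t \<Longrightarrow> t < \<delta> \<Longrightarrow> G t \<le> U"
    and b: "\<And>x. x \<in> \<Omega> \<Longrightarrow> 0 < bdist \<Omega> x \<Longrightarrow> bdist \<Omega> x < \<delta> \<Longrightarrow> b x > 0"
    and sub: "\<And>x. x \<in> \<Omega> \<Longrightarrow> 0 < bdist \<Omega> x \<Longrightarrow> bdist \<Omega> x < \<delta> \<Longrightarrow>
      b x * f (G (bdist \<Omega> x)) + \<bar>a\<bar> * G (bdist \<Omega> x) \<le> G2 (bdist \<Omega> x) + C * G1 (bdist \<Omega> x)"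
    and x1: "x1 \<in> \<Omega>" "0 < bdist \<Omega> x1" "bdist \<Omega> x1 < \<delta>"
  shows "G (bdist \<Omega> x1) \<le> u x1 + M"
proof (rule ccontr)
  let ?d = "bdist \<Omega>"
  assume "\<not> G (?d x1) \<le> u x1 + M"
  then have big: "G (?d x1) > u x1 + M" by simp
  have "\<forall>\<^sub>F x in near_boundary \<Omega>. U \<le> u x" using u_facts(4) by (simp add: filterlim_at_top)
  then obtain t0 where t0: "t0 > 0" "\<And>x. x \<in> \<Omega> \<Longrightarrow> 0 < ?d x \<Longrightarrow> ?d x < t0 \<Longrightarrow> U \<le> u x"
    using near_boundaryE by blast
  have edge: "G (?d x) \<le> u x + M" if x: "x \<in> \<Omega>" "0 < ?d x" "?d x \<le> \<delta>" "?d x < t0 \<or> ?d x = \<delta>" for x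
  proof (cases "?d x = \<delta>")
    case True then show ?thesis using M(2) u_facts(2)[OF x(1)] by simp
  next
    case False then show ?thesis using t0(2)[of x] Gbound[of "?d x"] x M(1) by auto
  qed
  let ?S = "{x \<in> \<Omega>. t0 \<le> ?d x \<and> ?d x \<le> \<delta>}"
  have "continuous_on {\<alpha><..<\<beta>} G"
    by (intro continuous_at_imp_continuous_on ballI) (use G in \<open>auto intro: DERIV_isCont\<close>)
  then have Gcont: "continuous_on ?S (\<lambda>x. G (?d x))"
    by (rule continuous_on_compose2[OF _ bdist_continuous]) (use t0 \<alpha> in auto)
  obtain x0 m where x0\<Omega>: "x0 \<in> \<Omega>" "0 < ?d x0" "?d x0 < \<delta>" and m: "1 < m" and w0: "G (?d x0) = m * (u x0 + M)"
    and quot: "\<forall>\<^sub>F y in nhds x0. G (?d y) \<le> m * (u y + M)"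
  proof (rule quotient_attains_max[OF order_refl t0(1) _ edge Gcont _ x1 big])
    show "0 < u x + M" if "x \<in> \<Omega>" for x using u_facts(2)[OF that] M(1) by simp
    show "continuous_on ?S (\<lambda>x. u x + M)" by (intro continuous_on_add continuous_on_const u_cont) auto
  qed
  define w where "w = G (?d x0)"
  have up: "u x0 \<ge> 0" by (rule u_facts(2)[OF x0\<Omega>(1)])
  note w = w0[folded w_def]
  have max: "\<forall>\<^sub>F y in nhds x0. G (?d y) - m * u y \<le> G (?d x0) - m * u x0"
    using quot by eventually_elim (simp add: w0 algebra_simps)
  have "G2 (?d x0) + C * G1 (?d x0) \<le> m * laplacian u x0"
    by (rule laplacian_ge_at_max_of_diff[OF u_facts(1) x0\<Omega>(1) _ _ _ \<alpha>(1) _ max, of \<beta>])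
      (use x0\<Omega> \<alpha> G in auto)
  with sub[OF x0\<Omega>] have "b x0 * f w + \<bar>a\<bar> * w \<le> m * (b x0 * f (u x0) - a * u x0)"
    unfolding u_facts(3)[OF x0\<Omega>(1)] w_def by linarith
  moreover have "- (a * (m * u x0)) \<le> \<bar>a\<bar> * (m * u x0)"
    using up m abs_ge_minus_self[of a] mult_right_mono[of "- a" "\<bar>a\<bar>" "m * u x0"] by simp
  moreover have "\<bar>a\<bar> * (m * u x0) \<le> \<bar>a\<bar> * w"
    unfolding w using m M(1) by (intro mult_left_mono) auto
  ultimately have "b x0 * f w \<le> b x0 * (m * f (u x0))" by (simp add: algebra_simps)
  then have "f w \<le> m * f (u x0)" using b[OF x0\<Omega>] by simp
  moreover have "m * u x0 < w" unfolding w using m M(1) by (simp add: distrib_left)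
  then have "m * f (u x0) < f w" by (rule f_super[OF m up])
  ultimately show False by simp
qed

end

section \<open>Two-sided bounds for large solutions\<close>

lemma powr_add_le:
  fixes t z \<theta> :: real
  assumes "0 \<le> t" "0 \<le> z" "0 < \<theta>"
  shows "(t + z) powr \<theta> \<le> 2 powr \<theta> * (t powr \<theta> + z powr \<theta>)"
proof -
  have "(t + z) powr \<theta> \<le> (2 * max t z) powr \<theta>" using assms by (intro powr_mono2) auto
  also have "\<dots> = 2 powr \<theta> * (max t z) powr \<theta>" using assms by (intro powr_mult)
  also have "(max t z) powr \<theta> \<le> t powr \<theta> + z powr \<theta>" by (simp add: max_def)
  finally show ?thesis by (simp add: mult_left_mono)
qed

text \<open>All that the expansion of \<open>b\<close> contributes is a relative error of order \<open>d powr \<theta>\<close>, which is \<open>o(s)\<close>;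
  the precise coefficient is lost in the constant \<open>C2\<close>.\<close>
locale boundary_blowup =
  profile f \<phi> \<rho> \<tau> lstar B U1 k k' K h \<nu> l1 L +
  large_solution_setting \<Omega> R C a b u f
  for f \<phi> :: "real \<Rightarrow> real" and \<rho> \<tau> lstar B U1 and k k' K h \<nu> l1 L
    and \<Omega> :: "'a::euclidean_space set" and R C a b u +
  fixes \<theta> C2 e0 :: real
  assumes \<theta>_pos: "\<theta> > 0" and C2_pos: "C2 > 0" and e0_pos: "e0 > 0"
    and k_mono: "\<And>x t. 0 < x \<Longrightarrow> x \<le> t \<Longrightarrow> t < \<nu> \<Longrightarrow> k x \<le> k t"
    and b_bounds: "\<And>x. x \<in> \<Omega> \<Longrightarrow> 0 < bdist \<Omega> x \<Longrightarrow> bdist \<Omega> x < e0 \<Longrightarrow>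
       (1 - C2 * bdist \<Omega> x powr \<theta>) * (k (bdist \<Omega> x))\<^sup>2 \<le> b x \<and> b x \<le> (1 + C2 * bdist \<Omega> x powr \<theta>) * (k (bdist \<Omega> x))\<^sup>2"
begin

lemma powr_small: "c > 0 \<Longrightarrow> \<forall>\<^sub>F t in at_right 0. c * t powr \<theta> < 1 / 4"
proof -
  assume "c > 0"
  have th: "((\<lambda>t. t powr \<theta>) \<longlongrightarrow> 0) (at_right 0)" by (rule tendsto_0_if_rate[OF \<sigma>_at_top log_rate_powr_0[OF \<theta>_pos]])
  have "((\<lambda>t. c * t powr \<theta>) \<longlongrightarrow> c * 0) (at_right 0)" by (intro tendsto_intros th)
  then show ?thesis by (rule order_tendstoD(2)) simp
qed

text \<open>The barrier must be infinite at positive distance \<open>z\<close> from the boundary, where nothing is known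
  about \<open>u\<close>, so the profile is shifted to \<open>t = d - z\<close>.  Monotonicity of \<open>k\<close> works in favour of the shift,
  but the error \<open>d powr \<theta>\<close> of the weight is not controlled by \<open>t powr \<theta>\<close>.  The excess is of order
  \<open>Y = C3 * z powr \<theta>\<close>; the factor \<open>m z = (1 + 2 Y) powr (2 / \<rho>)\<close> compensates it, because
  \<open>f (m w) \<ge> m powr (1 + \<rho> / 2) * f w = m (1 + 2 Y) f w\<close>.\<close>
lemma upper_bound:
  assumes q: "q > chi"
  shows "\<exists>M \<delta>. \<delta> > 0 \<and> (\<forall>x\<in>\<Omega>. 0 < bdist \<Omega> x \<longrightarrow> bdist \<Omega> x < \<delta> \<longrightarrow> u x \<le> W q (bdist \<Omega> x) + M)"
proof -
  let ?d = "bdist \<Omega>"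
  \<comment> \<open>from \<open>(t + z) powr \<theta> \<le> 2 powr \<theta> * (t powr \<theta> + z powr \<theta>)\<close>\<close>
  define C3 where "C3 = 2 powr \<theta> * C2"
  have C3: "C3 > 0" using C2_pos by (simp add: C3_def)
  obtain V where V: "V > 0" "\<And>w m. w \<ge> V \<Longrightarrow> m \<ge> 1 \<Longrightarrow> m powr (1 + \<rho> / 2) * f w \<le> f (m * w)"
    using f_power_growth by blast
  let ?good = "\<lambda>t. V \<le> W q t \<and> (0 < W q t \<and> (W q has_real_derivative W1 q t) (at t) \<and> (W1 q has_real_derivative W2 q t) (at t) \<and> W1 q t \<le> 0)
     \<and> W2 q t - C * W1 q t + \<bar>a\<bar> * W q t \<le> (1 - C3 * t powr \<theta>) * ((k t)\<^sup>2 * f (W q t))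
     \<and> \<bar>a\<bar> * W q t \<le> (1 - C3 * t powr \<theta>) * ((k t)\<^sup>2 * f (W q t)) \<and> C3 * t powr \<theta> < 1 / 4"
  have "\<forall>\<^sub>F t in at_right 0. V \<le> W q t" using W_at_top by (simp add: filterlim_at_top)
  then have "\<forall>\<^sub>F t in at_right 0. ?good t"
    by (intro eventually_conj ansatz_regular ansatz_supersolution[OF q \<theta>_pos] linear_term_dominated[OF \<theta>_pos] powr_small[OF C3])
  then obtain \<beta>0 where \<beta>0: "\<beta>0 > 0" "\<And>t. 0 < t \<Longrightarrow> t < \<beta>0 \<Longrightarrow> ?good t"
    unfolding eventually_at_right_field by auto
  define \<beta> where "\<beta> = min \<beta>0 (min \<nu> (min e0 (R / 2)))"
  have \<beta>: "\<beta> > 0" "\<beta> \<le> \<nu>" "\<beta> \<le> e0" "\<beta> \<le> R / 2" and good: "\<And>t. 0 < t \<Longrightarrow> t < \<beta> \<Longrightarrow> ?good t"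
    using \<beta>0 \<nu>_pos e0_pos R_pos by (auto simp: \<beta>_def)
  define \<delta> where "\<delta> = \<beta> / 2"
  have \<delta>: "\<delta> > 0" "\<delta> < \<beta>" "\<delta> < R / 2" using \<beta> by (auto simp: \<delta>_def)
  have "compact (u ` {x \<in> \<Omega>. \<delta> \<le> ?d x \<and> ?d x \<le> \<delta>})"
    by (rule compact_continuous_image[OF u_cont compact_strip[OF \<Omega> \<delta>(1)]]) auto
  then have "bounded (u ` {x \<in> \<Omega>. \<delta> \<le> ?d x \<and> ?d x \<le> \<delta>})" by (rule compact_imp_bounded)
  then obtain M0 where M0: "\<forall>x\<in>{x \<in> \<Omega>. \<delta> \<le> ?d x \<and> ?d x \<le> \<delta>}. \<bar>u x\<bar> \<le> M0" unfolding bounded_iff by auto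
  define M where "M = max 0 M0"
  have M: "M \<ge> 0" "u x \<le> M" if "x \<in> \<Omega>" "?d x = \<delta>" for x
    using M0 that by (auto simp: M_def)
  have M': "M \<ge> 0" by (simp add: M_def)
  define m where "m z = (1 + 2 * (C3 * z powr \<theta>)) powr (2 / \<rho>)" for z
  have bound: "u x \<le> m z * W q (?d x - z) + M" if x: "x \<in> \<Omega>" "?d x < \<delta>" and z: "0 < z" "z < ?d x" for x z
  proof -
    have zd: "z < \<delta>" "z < \<beta>" using x z \<delta> by auto
    define Y where "Y = C3 * z powr \<theta>"
    have Y: "0 \<le> Y" "Y < 1 / 4" using good[of z] z zd C3 by (auto simp: Y_def)
    have m1: "m z \<ge> 1" unfolding m_def Y_def[symmetric] using Y \<rho>_pos by (intro ge_one_powr_ge_zero) auto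
    have mp: "m z powr (1 + \<rho> / 2) = m z * (1 + 2 * Y)"
    proof -
      have "m z powr (\<rho> / 2) = 1 + 2 * Y"
        unfolding m_def Y_def[symmetric] using Y \<rho>_pos by (simp add: powr_powr)
      then show ?thesis using m1 by (simp add: powr_add)
    qed
    have key: "m z * ((1 - C3 * t powr \<theta>) * ((k t)\<^sup>2 * f (W q t))) \<le> b y * f (m z * W q t) \<and> b y > 0"
      if y: "y \<in> \<Omega>" "z < ?d y" "?d y < \<delta>" and t: "t = ?d y - z" for y t
    proof -
      have t0: "0 < t" "t < \<beta>" "?d y = t + z" using y t z \<delta> by auto
      define X where "X = C3 * t powr \<theta>"
      have X: "0 \<le> X" "X < 1 / 4" using good[OF t0(1,2)] C3 by (auto simp: X_def)
      have kt: "k t > 0" "k t \<le> k (?d y)" using t0 z y \<delta> \<beta> by (auto intro!: k_pos k_mono)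
      have kk: "(k t)\<^sup>2 \<le> (k (?d y))\<^sup>2" using kt by (intro power_mono) auto
      have "C2 * ?d y powr \<theta> \<le> C2 * (2 powr \<theta> * (t powr \<theta> + z powr \<theta>))"
        unfolding t0(3) using C2_pos t0 z by (intro mult_left_mono powr_add_le \<theta>_pos) auto
      also have "\<dots> = X + Y" by (simp add: X_def Y_def C3_def algebra_simps)
      finally have "1 - X - Y \<le> 1 - C2 * ?d y powr \<theta>" by simp
      then have "(1 - X - Y) * (k t)\<^sup>2 \<le> (1 - C2 * ?d y powr \<theta>) * (k (?d y))\<^sup>2"
        using X Y kk by (intro mult_mono) auto
      also have "\<dots> \<le> b y" using b_bounds[OF y(1)] y z \<delta> \<beta> by auto
      finally have bl: "(1 - X - Y) * (k t)\<^sup>2 \<le> b y" .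
      have bp: "(1 - X - Y) * (k t)\<^sup>2 > 0" using X Y kt by (intro mult_pos_pos) auto
      have fW: "f (W q t) > 0" "m z * (1 + 2 * Y) * f (W q t) \<le> f (m z * W q t)"
        using good[OF t0(1,2)] f_pos V(2)[of "W q t" "m z"] m1 by (auto simp: mp)
      \<comment> \<open>this inequality dictates the factor \<open>1 + 2 * Y\<close> and the bound \<open>1 / 4\<close> on \<open>X\<close> and \<open>Y\<close>\<close>
      have "1 - X \<le> (1 - X - Y) * (1 + 2 * Y)"
      proof -
        have "(1 - X - Y) * (1 + 2 * Y) - (1 - X) = Y * (1 - 2 * X - 2 * Y)" by (simp add: algebra_simps)
        moreover have "Y * (1 - 2 * X - 2 * Y) \<ge> 0" using X Y by (intro mult_nonneg_nonneg) auto
        ultimately show ?thesis by linarith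
      qed
      then have "(1 - X) * (m z * ((k t)\<^sup>2 * f (W q t))) \<le> (1 - X - Y) * (1 + 2 * Y) * (m z * ((k t)\<^sup>2 * f (W q t)))"
        using m1 fW(1) by (intro mult_right_mono) auto
      also have "\<dots> = ((1 - X - Y) * (k t)\<^sup>2) * (m z * (1 + 2 * Y) * f (W q t))" by (simp add: mult_ac)
      also have "\<dots> \<le> b y * f (m z * W q t)"
        using bl bp fW m1 Y by (intro mult_mono) auto
      finally show ?thesis using bl bp by (simp add: X_def mult_ac)
    qed
    have Wsup: "W2 q t - C * W1 q t + \<bar>a\<bar> * W q t \<le> (1 - C3 * t powr \<theta>) * ((k t)\<^sup>2 * f (W q t))"
      "\<bar>a\<bar> * W q t \<le> (1 - C3 * t powr \<theta>) * ((k t)\<^sup>2 * f (W q t))" if "0 < t" "t < \<beta>" for t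
      using good[OF that] by auto
    show ?thesis
    proof (rule upper_comparison[where \<sigma>=z and \<delta>=\<delta> and \<beta>=\<beta> and G="\<lambda>t. m z * W q (t - z)"
            and ?G1.0="\<lambda>t. m z * W1 q (t - z)" and ?G2.0="\<lambda>t. m z * W2 q (t - z)" and M=M and ?x1.0=x])
      fix t assume t: "z < t" "t < \<beta>"
      have g: "?good (t - z)" using good[of "t - z"] t z by auto
      have "(W q has_real_derivative W1 q (t - z)) (at (t + - z))" "(W1 q has_real_derivative W2 q (t - z)) (at (t + - z))"
        using g by simp_all
      then have "((\<lambda>t. W q (t - z)) has_real_derivative W1 q (t - z)) (at t)"
        "((\<lambda>t. W1 q (t - z)) has_real_derivative W2 q (t - z)) (at t)"
        unfolding DERIV_shift by simp_all
      then have "((\<lambda>t. m z * W q (t - z)) has_real_derivative m z * W1 q (t - z)) (at t)"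
        "((\<lambda>t. m z * W1 q (t - z)) has_real_derivative m z * W2 q (t - z)) (at t)"
        by (auto intro!: derivative_eq_intros)
      moreover have "m z * W q (t - z) > 0" "m z * W1 q (t - z) \<le> 0" using g m1 by (auto simp: mult_le_0_iff)
      ultimately show "m z * W q (t - z) > 0 \<and> ((\<lambda>t. m z * W q (t - z)) has_real_derivative m z * W1 q (t - z)) (at t)
        \<and> ((\<lambda>t. m z * W1 q (t - z)) has_real_derivative m z * W2 q (t - z)) (at t) \<and> m z * W1 q (t - z) \<le> 0" by blast
    next
      have "filterlim (\<lambda>t. W q (t - z)) at_top (at_right z)"
        using W_at_top[of q] unfolding filterlim_at_right_to_0[of "\<lambda>t. W q (t - z)" _ z] by simp
      then show "filterlim (\<lambda>t. m z * W q (t - z)) at_top (at_right z)"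
        using m1 by (intro filterlim_tendsto_pos_mult_at_top[OF tendsto_const]) auto
    next
      fix y assume y: "y \<in> \<Omega>" "z < ?d y" "?d y < \<delta>"
      define t where "t = ?d y - z"
      have t: "0 < t" "t < \<beta>" using y z \<delta> by (auto simp: t_def)
      note ky = key[OF y t_def]
      show "b y > 0" using ky by simp
      have "m z * W2 q t - C * (m z * W1 q t) + \<bar>a\<bar> * (m z * W q t) = m z * (W2 q t - C * W1 q t + \<bar>a\<bar> * W q t)"
        by (simp add: algebra_simps)
      also have "\<dots> \<le> m z * ((1 - C3 * t powr \<theta>) * ((k t)\<^sup>2 * f (W q t)))"
        using m1 by (intro mult_left_mono Wsup t) auto
      finally show "m z * W2 q (?d y - z) - C * (m z * W1 q (?d y - z)) + \<bar>a\<bar> * (m z * W q (?d y - z)) \<le> b y * f (m z * W q (?d y - z))"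
        using ky unfolding t_def by linarith
      have "\<bar>a\<bar> * (m z * W q t) = m z * (\<bar>a\<bar> * W q t)" by simp
      also have "\<dots> \<le> m z * ((1 - C3 * t powr \<theta>) * ((k t)\<^sup>2 * f (W q t)))"
        using m1 by (intro mult_left_mono Wsup t) auto
      finally show "\<bar>a\<bar> * (m z * W q (?d y - z)) \<le> b y * f (m z * W q (?d y - z))"
        using ky unfolding t_def by linarith
    qed (use x z zd \<delta> M M' in auto)
  qed
  have "u x \<le> W q (?d x) + M" if x: "x \<in> \<Omega>" "0 < ?d x" "?d x < \<delta>" for x
  proof -
    have th: "((\<lambda>t. t powr \<theta>) \<longlongrightarrow> 0) (at_right 0)" by (rule tendsto_0_if_rate[OF \<sigma>_at_top log_rate_powr_0[OF \<theta>_pos]])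
    have "(m \<longlongrightarrow> (1 + 2 * (C3 * 0)) powr (2 / \<rho>)) (at_right 0)"
      unfolding m_def[abs_def] by (intro tendsto_intros th) simp
    then have ml: "(m \<longlongrightarrow> 1) (at_right 0)" by simp
    have "isCont (W q) (?d x)" using good[of "?d x"] x \<delta> by (auto intro: DERIV_isCont)
    moreover have "((\<lambda>z. ?d x - z) \<longlongrightarrow> ?d x - 0) (at_right 0)" by (intro tendsto_intros)
    ultimately have "((\<lambda>z. W q (?d x - z)) \<longlongrightarrow> W q (?d x)) (at_right 0)"
      by (intro isCont_tendsto_compose[of _ "W q"]) simp_all
    then have "((\<lambda>z. m z * W q (?d x - z) + M) \<longlongrightarrow> 1 * W q (?d x) + M) (at_right 0)"
      by (intro tendsto_intros ml)
    then have "((\<lambda>z. m z * W q (?d x - z) + M) \<longlongrightarrow> W q (?d x) + M) (at_right 0)" by simp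
    then show ?thesis
    proof (rule tendsto_lowerbound)
      show "\<forall>\<^sub>F z in at_right 0. u x \<le> m z * W q (?d x - z) + M"
        using near0[OF x(2)] by eventually_elim (use bound x in auto)
    qed simp
  qed
  then show ?thesis using \<delta>(1) by blast
qed

text \<open>The profile shifted outwards, \<open>W q (d + z)\<close>, is bounded near the boundary, where \<open>u\<close> tends to
  infinity.  Both \<open>k\<close> and \<open>t powr \<theta>\<close> increase, so the shift preserves the inequality.\<close>
lemma lower_bound:
  assumes q: "q < chi"
  shows "\<exists>M \<delta>. \<delta> > 0 \<and> (\<forall>x\<in>\<Omega>. 0 < bdist \<Omega> x \<longrightarrow> bdist \<Omega> x < \<delta> \<longrightarrow> W q (bdist \<Omega> x) \<le> u x + M)"
proof -
  let ?d = "bdist \<Omega>"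
  let ?good = "\<lambda>t. (0 < W q t \<and> (W q has_real_derivative W1 q t) (at t) \<and> (W1 q has_real_derivative W2 q t) (at t) \<and> W1 q t \<le> 0)
     \<and> (1 + C2 * t powr \<theta>) * ((k t)\<^sup>2 * f (W q t)) + \<bar>a\<bar> * W q t \<le> W2 q t + C * W1 q t \<and> C2 * t powr \<theta> < 1 / 4"
  have "\<forall>\<^sub>F t in at_right 0. ?good t"
    by (intro eventually_conj ansatz_regular ansatz_subsolution[OF q \<theta>_pos] powr_small[OF C2_pos])
  then obtain \<beta>0 where \<beta>0: "\<beta>0 > 0" "\<And>t. 0 < t \<Longrightarrow> t < \<beta>0 \<Longrightarrow> ?good t"
    unfolding eventually_at_right_field by auto
  define \<beta> where "\<beta> = min \<beta>0 (min \<nu> (min e0 (R / 2)))"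
  have \<beta>: "\<beta> > 0" "\<beta> \<le> \<nu>" "\<beta> \<le> e0" "\<beta> \<le> R / 2" and good: "\<And>t. 0 < t \<Longrightarrow> t < \<beta> \<Longrightarrow> ?good t"
    using \<beta>0 \<nu>_pos e0_pos R_pos by (auto simp: \<beta>_def)
  define \<delta> where "\<delta> = \<beta> / 2"
  have \<delta>: "\<delta> > 0" "\<delta> < \<beta>" "\<delta> < R / 2" using \<beta> by (auto simp: \<delta>_def)
  define M where "M = W q \<delta>"
  have anti: "W q t \<le> W q x" if "0 < x" "x \<le> t" "t < \<beta>" for x t
    by (rule nonincreasing_if_deriv_nonpos[of 0 \<beta> "W q" "W1 q"]) (use good that in auto)
  have M: "M > 0" using good[OF \<delta>(1,2)] by (simp add: M_def)
  have bound: "W q (?d x + z) \<le> u x + M" if x: "x \<in> \<Omega>" "0 < ?d x" "?d x < \<delta>" and z: "0 < z" "z < \<beta> - \<delta>" for x z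
  proof (rule lower_comparison[where \<alpha>="- z" and \<delta>=\<delta> and \<beta>="\<beta> - z" and G="\<lambda>t. W q (t + z)"
            and ?G1.0="\<lambda>t. W1 q (t + z)" and ?G2.0="\<lambda>t. W2 q (t + z)" and M=M and U="W q z" and ?x1.0=x])
    fix t assume t: "- z < t" "t < \<beta> - z"
    have g: "?good (t + z)" using good[of "t + z"] t by auto
    have "((\<lambda>t. W q (t + z)) has_real_derivative W1 q (t + z)) (at t)"
      "((\<lambda>t. W1 q (t + z)) has_real_derivative W2 q (t + z)) (at t)"
      using g by (simp_all flip: DERIV_shift)
    then show "W q (t + z) > 0 \<and> ((\<lambda>t. W q (t + z)) has_real_derivative W1 q (t + z)) (at t)
        \<and> ((\<lambda>t. W1 q (t + z)) has_real_derivative W2 q (t + z)) (at t) \<and> W1 q (t + z) \<le> 0" using g by simp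
  next
    show "W q (\<delta> + z) \<le> M" unfolding M_def by (rule anti) (use z \<delta> in auto)
    show "W q (t + z) \<le> W q z" if "0 < t" "t < \<delta>" for t by (rule anti) (use z \<delta> that in auto)
  next
    fix y assume y: "y \<in> \<Omega>" "0 < ?d y" "?d y < \<delta>"
    define t where "t = ?d y + z"
    have t: "0 < t" "t < \<beta>" "?d y \<le> t" using y z \<delta> by (auto simp: t_def)
    have kd: "k (?d y) > 0" "k (?d y) \<le> k t" using t y \<delta> \<beta> by (auto intro!: k_pos k_mono)
    have kk: "(k (?d y))\<^sup>2 \<le> (k t)\<^sup>2" using kd by (intro power_mono) auto
    have bb: "(1 - C2 * ?d y powr \<theta>) * (k (?d y))\<^sup>2 \<le> b y" "b y \<le> (1 + C2 * ?d y powr \<theta>) * (k (?d y))\<^sup>2"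
      using b_bounds[OF y(1)] y \<delta> \<beta> by auto
    have "(1 - C2 * ?d y powr \<theta>) * (k (?d y))\<^sup>2 > 0" using good[of "?d y"] y \<delta> kd by (intro mult_pos_pos) auto
    then show "b y > 0" using bb by linarith
    have fW: "f (W q t) > 0" using good[OF t(1,2)] f_pos by auto
    have "b y \<le> (1 + C2 * t powr \<theta>) * (k t)\<^sup>2"
    proof (rule order_trans[OF bb(2)])
      have "?d y powr \<theta> \<le> t powr \<theta>" using t y \<theta>_pos by (intro powr_mono2) auto
      then show "(1 + C2 * ?d y powr \<theta>) * (k (?d y))\<^sup>2 \<le> (1 + C2 * t powr \<theta>) * (k t)\<^sup>2"
        using kk C2_pos by (intro mult_mono) (auto intro!: add_nonneg_nonneg)
    qed
    then have "b y * f (W q t) \<le> (1 + C2 * t powr \<theta>) * (k t)\<^sup>2 * f (W q t)" using fW by (intro mult_right_mono) auto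
    then show "b y * f (W q (?d y + z)) + \<bar>a\<bar> * W q (?d y + z) \<le> W2 q (?d y + z) + C * W1 q (?d y + z)"
      using good[OF t(1,2)] unfolding t_def by (simp add: mult.assoc)
  qed (use x z \<delta> M in auto)
  have "W q (?d x) \<le> u x + M" if x: "x \<in> \<Omega>" "0 < ?d x" "?d x < \<delta>" for x
  proof -
    have "isCont (W q) (?d x)" using good[of "?d x"] x \<delta> by (auto intro: DERIV_isCont)
    moreover have "((\<lambda>z. ?d x + z) \<longlongrightarrow> ?d x + 0) (at_right 0)" by (intro tendsto_intros)
    ultimately have "((\<lambda>z. W q (?d x + z)) \<longlongrightarrow> W q (?d x)) (at_right 0)"
      by (intro isCont_tendsto_compose[of _ "W q"]) simp_all
    then show ?thesis
    proof (rule tendsto_upperbound)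
      have "0 < \<beta> - \<delta>" using \<delta> by simp
      from near0[OF this] show "\<forall>\<^sub>F z in at_right 0. W q (?d x + z) \<le> u x + M"
        by eventually_elim (use bound x in auto)
    qed simp
  qed
  then show ?thesis using \<delta>(1) by blast
qed

lemma eventually_near_boundaryI:
  assumes "\<forall>\<^sub>F t in at_right 0. Pr t"
  shows "\<forall>\<^sub>F x in near_boundary \<Omega>. x \<in> \<Omega> \<and> 0 < bdist \<Omega> x \<and> Pr (bdist \<Omega> x)"
proof -
  have "\<forall>\<^sub>F t in at_right 0. 0 < t \<and> Pr t" using assms eventually_at_right_less[of 0] by eventually_elim simp
  then show ?thesis
    unfolding near_boundary_def eventually_inf_principal by (rule eventually_filtercomapI[THEN eventually_mono]) auto
qed

text \<open>\<open>h\<close> grows like a power of \<open>1 / t\<close>, hence constants are negligible against \<open>h * s\<close>.\<close>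
lemma h_s_dominates:
  assumes "e > 0"
  shows "\<forall>\<^sub>F t in at_right 0. M / (\<xi> * h t) < e * s t"
proof -
  have "((\<lambda>t. \<sigma> t * (1 / h t)) \<longlongrightarrow> (\<rho> * l1 / 2) powr \<tau> * 0) (at_right 0)"
    by (rule rate_transfer[OF inverse_times_ln_powr_0 h_at_top ln_h_lim])
  then have "((\<lambda>t. M / \<xi> * (\<sigma> t * (1 / h t))) \<longlongrightarrow> M / \<xi> * ((\<rho> * l1 / 2) powr \<tau> * 0)) (at_right 0)"
    by (rule tendsto_mult[OF tendsto_const])
  then have "\<forall>\<^sub>F t in at_right 0. M / \<xi> * (\<sigma> t * (1 / h t)) < e"
    by (rule order_tendstoD(2)) (use assms in simp)
  then show ?thesis using near0[OF zero_less_one]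
  proof eventually_elim
    case (elim t)
    have sp: "s t > 0" using elim(2) by simp
    have "M / (\<xi> * h t) = s t * (M / \<xi> * (\<sigma> t * (1 / h t)))"
    proof -
      have "s t * (p * (\<sigma> t * r)) = (\<sigma> t * s t) * (p * r)" for p r by (simp only: mult_ac)
      then show ?thesis using \<sigma>_s elim(2) by simp
    qed
    also have "\<dots> < s t * e" using elim(1) sp by (rule mult_strict_left_mono)
    finally show ?case by (simp add: mult.commute)
  qed
qed

lemma two_term_rate:
  "(\<lambda>x. u x / (\<xi> * h (bdist \<Omega> x)) - 1 - chi * s (bdist \<Omega> x)) \<in> o[near_boundary \<Omega>](\<lambda>x. s (bdist \<Omega> x))"
proof (rule landau_o.smallI)
  fix e :: real assume e: "e > 0"
  let ?d = "bdist \<Omega>"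
  have e2: "e / 2 > 0" using e by simp
  obtain M1 \<delta>1 where 1: "\<delta>1 > 0" "\<And>x. x \<in> \<Omega> \<Longrightarrow> 0 < ?d x \<Longrightarrow> ?d x < \<delta>1 \<Longrightarrow> u x \<le> W (chi + e / 2) (?d x) + M1"
    using upper_bound[of "chi + e / 2"] e by auto
  obtain M2 \<delta>2 where 2: "\<delta>2 > 0" "\<And>x. x \<in> \<Omega> \<Longrightarrow> 0 < ?d x \<Longrightarrow> ?d x < \<delta>2 \<Longrightarrow> W (chi - e / 2) (?d x) \<le> u x + M2"
    using lower_bound[of "chi - e / 2"] e by auto
  have "\<forall>\<^sub>F t in at_right 0. (0 < t \<and> t < min 1 (min \<delta>1 \<delta>2)) \<and> h t > 0 \<and> M1 / (\<xi> * h t) < e / 2 * s t \<and> M2 / (\<xi> * h t) < e / 2 * s t"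
    by (intro eventually_conj h_s_dominates[OF e2] near0 filterlim_at_top_dense[THEN iffD1, OF h_at_top, rule_format]) (use 1 2 in auto)
  from eventually_near_boundaryI[OF this]
  show "\<forall>\<^sub>F x in near_boundary \<Omega>. norm (u x / (\<xi> * h (?d x)) - 1 - chi * s (?d x)) \<le> e * norm (s (?d x))"
  proof eventually_elim
    case (elim x)
    define t where "t = ?d x"
    have d: "\<xi> * h t > 0" using elim \<xi>_pos by (auto simp: t_def)
    have "\<xi> \<noteq> 0" "h t \<noteq> 0" using d by auto
    then have Wd: "W q t / (\<xi> * h t) = 1 + q * s t" for q by (simp add: W_def)
    have "u x / (\<xi> * h t) \<le> (W (chi + e / 2) t + M1) / (\<xi> * h t)"
      using 1(2)[of x] elim d by (intro divide_right_mono) (auto simp: t_def)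
    then have up: "u x / (\<xi> * h t) \<le> 1 + (chi + e / 2) * s t + M1 / (\<xi> * h t)"
      unfolding add_divide_distrib Wd .
    have "W (chi - e / 2) t / (\<xi> * h t) \<le> (u x + M2) / (\<xi> * h t)"
      using 2(2)[of x] elim d by (intro divide_right_mono) (auto simp: t_def)
    then have lo: "1 + (chi - e / 2) * s t \<le> u x / (\<xi> * h t) + M2 / (\<xi> * h t)"
      unfolding add_divide_distrib Wd .
    have small: "M1 / (\<xi> * h t) < e / 2 * s t" "M2 / (\<xi> * h t) < e / 2 * s t" using elim by (auto simp: t_def)
    have dist: "(chi + e / 2) * y = chi * y + e / 2 * y" "(chi - e / 2) * y = chi * y - e / 2 * y" "e * y = e / 2 * y + e / 2 * y" for y
      by (simp_all add: algebra_simps)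
    have "\<bar>u x / (\<xi> * h t) - 1 - chi * s t\<bar> \<le> e * s t"
      using up lo small unfolding dist by linarith
    then show ?case by (simp add: t_def)
  qed
qed

end

section \<open>The two-term blow-up rate\<close>

theorem theorem1p3:
  fixes \<Omega> \<Omega>\<^sub>0 :: "'a::euclidean_space set"
    and b u :: "'a \<Rightarrow> real"
    and f k h :: "real \<Rightarrow> real"
    and a \<mu> \<rho> \<eta> \<tau> \<theta> c l\<^sub>1 L lstar \<xi>\<^sub>0 chi2 chi :: real
  assumes "DIM('a) \<ge> 3"
    and "smooth_bounded_domain \<Omega>"
    and "0 < \<mu>" and "\<mu> < 1" and "holder_on \<mu> (closure \<Omega>) b"
    and "\<forall>x\<in>\<Omega>. b x \<ge> 0" and "\<exists>x\<in>\<Omega>. b x \<noteq> 0"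
    and "\<Omega>\<^sub>0 = interior {x \<in> \<Omega>. b x = 0}"
    and "connected \<Omega>\<^sub>0" and "closure \<Omega>\<^sub>0 \<subseteq> \<Omega>"
    and "\<forall>x \<in> \<Omega> - closure \<Omega>\<^sub>0. b x > 0"
    and "exterior_cone_condition \<Omega>\<^sub>0"
    and "C1_on_nonneg f" and "\<forall>s\<ge>0. f s \<ge> 0"
    and "strict_mono_on {0<..} (\<lambda>s. f s / s)"
    and "\<rho> > 0" and "- \<rho> - 2 < \<eta>" and "\<eta> \<le> 0" and "\<tau> > 0" and "\<theta> > 0"
    and "class_K01 \<tau> l\<^sub>1 L k"
    and "\<exists>r \<in> o[near_boundary \<Omega>](\<lambda>x. bdist \<Omega> x powr \<theta>).
           \<forall>\<^sub>F x in near_boundary \<Omega>.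
             b x = (k (bdist \<Omega> x))\<^sup>2 * (1 + c * bdist \<Omega> x powr \<theta> + r x)"
    and "blowup_profile f k h"
    and "\<xi>\<^sub>0 = ((2 + l\<^sub>1 * \<rho>) / (2 + \<rho>)) powr (1 / \<rho>)"
    and "chi2 = L / (2 + \<rho> * l\<^sub>1)"
    and "(class_F \<rho> \<eta> f \<and> \<eta> * L \<noteq> 0 \<and> chi = chi2) \<or>
         (class_F0 \<rho> \<tau> lstar f \<and> (lstar * (l\<^sub>1 - 1))\<^sup>2 + L\<^sup>2 \<noteq> 0 \<and>
          chi = chi2 - lstar / \<rho> * (\<rho> * l\<^sub>1 / 2) powr \<tau> *
                (2 * (1 - l\<^sub>1) / ((\<rho> + 2) * (\<rho> * l\<^sub>1 + 2)) + ln \<xi>\<^sub>0))"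
    and "ereal a < first_dirichlet_eigenvalue \<Omega>\<^sub>0"
    and "large_solution \<Omega> a b f u"
  shows "\<exists>r \<in> o[near_boundary \<Omega>](\<lambda>x. (- ln (bdist \<Omega> x)) powr (- \<tau>)).
           \<forall>\<^sub>F x in near_boundary \<Omega>.
             u x = \<xi>\<^sub>0 * h (bdist \<Omega> x) * (1 + chi * (- ln (bdist \<Omega> x)) powr (- \<tau>) + r x)"
proof -
  \<comment> \<open>For regularly varying \<open>\<phi>\<close> of negative index the second case applies with the rate \<open>0\<close>.\<close>
  have "\<exists>\<phi> ls. karamata_form \<rho> f \<phi> \<and> ((\<lambda>u. ln u powr \<tau> * \<phi> u) \<longlongrightarrow> ls) at_top \<and>
      chi = chi2 - ls / \<rho> * (\<rho> * l\<^sub>1 / 2) powr \<tau> * (2 * (1 - l\<^sub>1) / ((\<rho> + 2) * (\<rho> * l\<^sub>1 + 2)) + ln \<xi>\<^sub>0)"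
    using assms(26)
  proof
    assume *: "class_F \<rho> \<eta> f \<and> \<eta> * L \<noteq> 0 \<and> chi = chi2"
    then have "class_F \<rho> \<eta> f" "\<eta> < 0" using assms(18) by auto
    then obtain \<phi> where "karamata_form \<rho> f \<phi>" "((\<lambda>u. ln u powr \<tau> * \<phi> u) \<longlongrightarrow> 0) at_top"
      by (rule class_F_log_rate)
    then show ?thesis using * by (intro exI[of _ \<phi>] exI[of _ 0]) simp
  next
    assume "class_F0 \<rho> \<tau> lstar f \<and> (lstar * (l\<^sub>1 - 1))\<^sup>2 + L\<^sup>2 \<noteq> 0 \<and>
          chi = chi2 - lstar / \<rho> * (\<rho> * l\<^sub>1 / 2) powr \<tau> *
                (2 * (1 - l\<^sub>1) / ((\<rho> + 2) * (\<rho> * l\<^sub>1 + 2)) + ln \<xi>\<^sub>0)"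
    then show ?thesis unfolding class_F0_def by blast
  qed
  then obtain \<phi> ls where \<phi>: "karamata_form \<rho> f \<phi>" "((\<lambda>u. ln u powr \<tau> * \<phi> u) \<longlongrightarrow> ls) at_top"
    and chi: "chi = chi2 - ls / \<rho> * (\<rho> * l\<^sub>1 / 2) powr \<tau> * (2 * (1 - l\<^sub>1) / ((\<rho> + 2) * (\<rho> * l\<^sub>1 + 2)) + ln \<xi>\<^sub>0)"
    by blast
  obtain B where B: "B > 0" "\<And>u. u > B \<Longrightarrow> (f has_real_derivative f u * (\<rho> + 1 + \<phi> u) / u) (at u)"
    using karamata_form_deriv[OF \<phi>(1)] by blast
  have f_cont: "continuous_on {0..} f"
    using assms(13) unfolding C1_on_nonneg_def
    by (auto simp: continuous_on_eq_continuous_within intro: DERIV_continuous)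
  interpret N: nonlinearity f \<phi> \<rho> \<tau> ls B
    by unfold_locales (use f_cont assms(14,15,16,19) B \<phi>(2) in auto)
  have K: "class_K l\<^sub>1 k" "0 < l\<^sub>1"
    "((\<lambda>t. (- ln t) powr \<tau> * (deriv (primitive_ratio k) t - l\<^sub>1)) \<longlongrightarrow> L) (at_right 0)"
    using assms(21) unfolding class_K01_def by auto
  define K where "K t = integral {0..t} k" for t
  obtain \<nu> k' where \<nu>: "\<nu> > 0"
    "\<And>t. 0 < t \<Longrightarrow> t < \<nu> \<Longrightarrow> k t > 0"
    "\<And>t x. 0 < x \<Longrightarrow> x \<le> t \<Longrightarrow> t < \<nu> \<Longrightarrow> k x \<le> k t"
    "\<And>t. 0 < t \<Longrightarrow> t < \<nu> \<Longrightarrow> K t > 0"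
    "\<And>t. 0 < t \<Longrightarrow> t < \<nu> \<Longrightarrow> (k has_real_derivative k' t) (at t)"
    "\<And>t. 0 < t \<Longrightarrow> t < \<nu> \<Longrightarrow> (K has_real_derivative k t) (at t)"
    "(K \<longlongrightarrow> 0) (at_right 0)"
    "((\<lambda>t. K t / k t) \<longlongrightarrow> 0) (at_right 0)"
    "\<And>t. 0 < t \<Longrightarrow> t < \<nu> \<Longrightarrow> deriv (primitive_ratio k) t = 1 - K t * k' t / (k t)\<^sup>2"
    unfolding K_def[abs_def] by (rule class_K_primitive[OF K(1)]) blast
  have near0: "\<forall>\<^sub>F t in at_right 0. 0 < t \<and> t < x" if "x > 0" for x :: real
    using eventually_at_right_real[of 0 x] that by simp
  have rate: "((\<lambda>t. (- ln t) powr \<tau> * ((1 - K t * k' t / (k t)\<^sup>2) - l\<^sub>1)) \<longlongrightarrow> L) (at_right 0)"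
    using K(3) by (rule Lim_transform_eventually) (use near0[OF \<nu>(1)] in eventually_elim, simp add: \<nu>(9))
  let ?g = "\<lambda>s. 1 / sqrt (2 * N.F s)"
  have "\<forall>\<^sub>F t in at_right 0. h t > 0 \<and> (?g has_integral K t) {h t..}"
    using assms(23) unfolding blowup_profile_def N.F_def K_def .
  then obtain e where e: "e > 0" "\<And>t. 0 < t \<Longrightarrow> t < e \<Longrightarrow> h t > 0 \<and> (?g has_integral K t) {h t..}"
    unfolding eventually_at_right_field by auto
  define t0 where "t0 = min e \<nu> / 2"
  have t0: "0 < t0" "t0 < e" "t0 < \<nu>" using e(1) \<nu>(1) by (auto simp: t0_def)
  define U1 where "U1 = h t0"
  have U1: "U1 > 0" "(?g has_integral K t0) {U1..}" using e(2)[OF t0(1,2)] by (auto simp: U1_def)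
  interpret KO: keller_osserman f \<phi> \<rho> \<tau> ls B U1
    by unfold_locales (use U1 in auto)
  \<comment> \<open>\<open>h t < U1\<close> would make the tail integral from \<open>h t\<close> at least \<open>K t0\<close>, but \<open>K t < K t0\<close> for small \<open>t\<close>\<close>
  have h_eq: "\<forall>\<^sub>F t in at_right 0. U1 \<le> h t \<and> KO.I (h t) = K t"
    using near0[OF e(1)] order_tendstoD(2)[OF \<nu>(7) \<nu>(4)[OF t0(1,3)]]
  proof eventually_elim
    case (elim t)
    have ht: "h t > 0" "(?g has_integral K t) {h t..}" using e(2) elim by auto
    have "U1 \<le> h t"
    proof (rule ccontr)
      assume "\<not> U1 \<le> h t"
      then have "integral {U1..} ?g \<le> integral {h t..} ?g"
        using U1(2) ht N.F_pos by (intro integral_subset_le) (auto simp: integrable_on_def less_imp_le)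
      then show False using U1(2) ht(2) elim by (simp add: integral_unique)
    qed
    then show ?case using ht(2) by (simp add: KO.I_def integral_unique)
  qed
  obtain R where R: "R > 0" "\<And>x. x \<in> \<Omega> \<Longrightarrow> bdist \<Omega> x < R \<Longrightarrow> touched_by_balls \<Omega> R x"
    using uniform_touching_balls[OF assms(2)] by blast
  interpret LS: large_solution_setting \<Omega> R "2 * real DIM('a) / R" a b u f
    by unfold_locales (use assms(2,28) R N.f_quot_less N.f_superlinear in auto)
  obtain r where r: "r \<in> o[near_boundary \<Omega>](\<lambda>x. bdist \<Omega> x powr \<theta>)"
    "\<forall>\<^sub>F x in near_boundary \<Omega>. b x = (k (bdist \<Omega> x))\<^sup>2 * (1 + c * bdist \<Omega> x powr \<theta> + r x)"
    using assms(22) by blast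
  have "\<forall>\<^sub>F x in near_boundary \<Omega>. norm (r x) \<le> 1 * norm (bdist \<Omega> x powr \<theta>)"
    by (rule landau_o.smallD[OF r(1)]) simp
  with r(2) have "\<forall>\<^sub>F x in near_boundary \<Omega>.
      (1 - (\<bar>c\<bar> + 1) * bdist \<Omega> x powr \<theta>) * (k (bdist \<Omega> x))\<^sup>2 \<le> b x \<and> b x \<le> (1 + (\<bar>c\<bar> + 1) * bdist \<Omega> x powr \<theta>) * (k (bdist \<Omega> x))\<^sup>2"
  proof eventually_elim
    case (elim x)
    define y where "y = bdist \<Omega> x powr \<theta>"
    have y: "y \<ge> 0" "\<bar>r x\<bar> \<le> y" using elim(2) by (auto simp: y_def)
    have "\<bar>c * y\<bar> \<le> \<bar>c\<bar> * y" using y(1) by (simp add: abs_mult)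
    then have "1 - (\<bar>c\<bar> + 1) * y \<le> 1 + c * y + r x" "1 + c * y + r x \<le> 1 + (\<bar>c\<bar> + 1) * y"
      using y unfolding distrib_right by linarith+
    then show ?case unfolding elim(1) y_def[symmetric] by (simp add: mult.commute[of "(k (bdist \<Omega> x))\<^sup>2"] mult_right_mono)
  qed
  then obtain e0 where e0: "e0 > 0" "\<And>x. x \<in> \<Omega> \<Longrightarrow> 0 < bdist \<Omega> x \<Longrightarrow> bdist \<Omega> x < e0 \<Longrightarrow>
      (1 - (\<bar>c\<bar> + 1) * bdist \<Omega> x powr \<theta>) * (k (bdist \<Omega> x))\<^sup>2 \<le> b x \<and> b x \<le> (1 + (\<bar>c\<bar> + 1) * bdist \<Omega> x powr \<theta>) * (k (bdist \<Omega> x))\<^sup>2"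
    by (rule LS.near_boundaryE) (rule that)
  interpret BB: boundary_blowup f \<phi> \<rho> \<tau> ls B U1 k k' K h \<nu> l\<^sub>1 L \<Omega> R "2 * real DIM('a) / R" a b u \<theta> "\<bar>c\<bar> + 1" e0
    by unfold_locales (use \<nu> K(2) rate h_eq assms(20) e0 in auto)
  have \<xi>: "BB.\<xi> = \<xi>\<^sub>0" by (simp add: BB.\<xi>_def BB.A_def assms(24))
  have chi_eq: "BB.chi = chi"
  proof -
    have p: "2 + \<rho> * l\<^sub>1 > 0" "\<rho> + 2 > 0" "\<rho> > 0" using assms(16) K(2) by (auto intro: add_pos_pos)
    have A: "BB.A = (2 + \<rho> * l\<^sub>1) / (\<rho> + 2)" by (simp add: BB.A_def mult.commute add.commute)
    have alg: "((L * (\<rho> / m) - (1 - l\<^sub>1) * (w * (2 * ls / m\<^sup>2))) / (v / m) - w * ls * y) / \<rho>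
        = L / v - ls / \<rho> * w * (2 * (1 - l\<^sub>1) / (m * v) + y)" if "m > 0" "v > 0" for m v w y
      using that p(3) by (simp add: power2_eq_square field_simps)
    have "BB.chi = L / (2 + \<rho> * l\<^sub>1) - ls / \<rho> * (\<rho> * l\<^sub>1 / 2) powr \<tau> * (2 * (1 - l\<^sub>1) / ((\<rho> + 2) * (2 + \<rho> * l\<^sub>1)) + ln \<xi>\<^sub>0)"
      unfolding BB.chi_def BB.a1_def A BB.\<kappa>_def \<xi> by (rule alg[OF p(2,1)])
    then show ?thesis unfolding chi assms(25) by (simp add: add.commute)
  qed
  have "\<forall>\<^sub>F t in at_right 0. h t > 0"
    by (rule filterlim_at_top_dense[THEN iffD1, OF BB.h_at_top, rule_format])
  from BB.eventually_near_boundaryI[OF this]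
  have "\<forall>\<^sub>F x in near_boundary \<Omega>. u x = \<xi>\<^sub>0 * h (bdist \<Omega> x) * (1 + chi * (- ln (bdist \<Omega> x)) powr (- \<tau>)
      + (u x / (\<xi>\<^sub>0 * h (bdist \<Omega> x)) - 1 - chi * (- ln (bdist \<Omega> x)) powr (- \<tau>)))"
  proof eventually_elim
    case (elim x)
    then have "\<xi>\<^sub>0 * h (bdist \<Omega> x) \<noteq> 0" using BB.\<xi>_pos \<xi> by auto
    then show ?case by simp
  qed
  then show ?thesis using BB.two_term_rate[unfolded \<xi> chi_eq] by (rule bexI)
qed

end
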